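(* Let $k\in\mathbb{N}$, $x_k=\frac{\sqrt{2k+1}-1}{\sqrt{2k+1}+1}$ and $\alpha_k=\sqrt{2k+1}\,\ln x_k$. Let $a,b$ be positive integers with $b$ odd and $b>4a$. Assume that the equation $\frac{z(z-a)(z-2a)}{(z-(b-2a))(z-(b-a))(z-b)}=\frac{1}{x_k}$ has a unique real solution $z_0>b$, and that the equation $\frac{(z+2a)(z+a)z}{(z+(b-2a))(z+(b-a))(z+b)}=\frac{1}{x_k}$ has a root $z_1$ with $\mathrm{Im}\,z_1>0$. Define $$M_1=\ln\frac{(z_0-(b-2a))^{b-2a}(z_0-(b-a))^{b-a}(z_0-b)^b}{(z_0-2a)^{2a}(z_0-a)^a(b-4a)^{b-4a}(b-2a)^{b-2a}b^b}-\frac{b}{2}\ln x_k,$$ $$M_2=\ln\frac{|z_1+(b-2a)|^{b-2a}|z_1+(b-a)|^{b-a}|z_1+b|^b}{|z_1+2a|^{2a}|z_1+a|^a(b-4a)^{b-4a}(b-2a)^{b-2a}b^b}-\frac{b}{2}\ln x_k,$$ $K_1=-\frac{b-2a}{2}\ln m$ if $k=2m$ and $K_1=-\frac{b-2a}{2}\ln k+\frac{3(b-2a)}{2}\ln 2$ if $k=2m-1$, and $N_1=\lim_{n\to\infty,\ n \text{ odd}}\frac1n\ln\frac{d_{bn}}{\Delta}$ (with $d_{bn}$, $\Delta=\Delta(n)$ as in the context). If $M_2+K_1+N_1<0$, then $$\mu(\alpha_k)\le 1-\frac{M_1+K_1+N_1}{M_2+K_1+N_1}.$$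
   Context: For irrational real $\alpha$, the irrationality measure $\mu(\alpha)$ is the supremum of all $\kappa$ such that $|\alpha-p/q|<q^{-\kappa}$ has infinitely many rational solutions $p/q$. $d_N$ is the least common multiple of $1,\dots,N$; $[\cdot]$ is the floor and $\{\cdot\}$ the fractional part. Let $\Omega$ be the set of $y\in[0,1)$ such that for all real $x$: $\big([x-2ay]-[x-(b-2a)y]-[(b-4a)y]\big)+\big([x-ay]-[x-(b-a)y]-[(b-2a)y]\big)+\big([x]-[x-by]-[by]\big)\ge1$. For odd positive $n$, $\Delta$ is the product of all primes $p>\sqrt{bn}$ with $\{n/p\}\in\Omega$. (The limit defining $N_1$ exists.) *)

theory Defs
  imports "HOL-Analysis.Analysis" "HOL-Computational_Algebra.Primes"
begin

definition irrationality_measure :: "real \<Rightarrow> ereal" where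
  "irrationality_measure \<alpha> =
     Sup {ereal \<kappa> | \<kappa>. infinite {(p::int, q::nat). q > 0 \<and> coprime p (int q) \<and>
                                   \<bar>\<alpha> - real_of_int p / real q\<bar> < real q powr (-\<kappa>)}}"

definition dlcm :: "nat \<Rightarrow> nat" where
  "dlcm N = Lcm {1..N}"

definition Omega :: "nat \<Rightarrow> nat \<Rightarrow> real set" where
  "Omega a b = {y. 0 \<le> y \<and> y < 1 \<and> (\<forall>x::real.
      (\<lfloor>x - 2 * real a * y\<rfloor> - \<lfloor>x - (real b - 2 * real a) * y\<rfloor> - \<lfloor>(real b - 4 * real a) * y\<rfloor>)
    + (\<lfloor>x - real a * y\<rfloor> - \<lfloor>x - (real b - real a) * y\<rfloor> - \<lfloor>(real b - 2 * real a) * y\<rfloor>)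
    + (\<lfloor>x\<rfloor> - \<lfloor>x - real b * y\<rfloor> - \<lfloor>real b * y\<rfloor>) \<ge> 1)}"

definition Delta :: "nat \<Rightarrow> nat \<Rightarrow> nat \<Rightarrow> nat" where
  "Delta a b n = \<Prod> {p::nat. prime p \<and> sqrt (real (b * n)) < real p \<and>
                          frac (real n / real p) \<in> Omega a b}"

end

theory Submission
  imports Defs "HOL-Complex_Analysis.Complex_Analysis" "HOL-Real_Asymp.Real_Asymp"
begin

text \<open>
  Let \<open>R(t)\<close> be the product over \<open>i < 3\<close> of the binomial coefficients \<open>binomial (t - ian - 1) ((b - 2ia)n)\<close>, let
  \<open>f(z) = R(z) x\<^sub>k\<^sup>z\<close> and \<open>d = sqrt (2k + 1)\<close>. Summing over integers \<open>\<nu>\<close>, the two series \<open>\<Sum> R(\<nu>) x\<^sub>k\<^sup>\<nu>\<close> and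
  \<open>\<Sum> f'(\<nu>) = \<Sum> R'(\<nu>) x\<^sub>k\<^sup>\<nu> + ln x\<^sub>k \<Sum> R(\<nu>) x\<^sub>k\<^sup>\<nu>\<close> yield, after a normalisation, a linear form in \<open>1\<close> and \<open>\<alpha>\<^sub>k\<close>.

  Arithmetic: for odd \<open>n\<close> the polynomial \<open>R\<close> is odd about \<open>c = (bn + 1)/2\<close>, and \<open>R'\<close> is even about \<open>c\<close>. Expanding both in
  central binomial bases, whose generating functions are \<open>(x/(1-x)\<^sup>2)\<^sup>j\<close> and \<open>(1+x)/(1-x) (x/(1-x)\<^sup>2)\<^sup>j\<close>, that is
  \<open>(k/2)\<^sup>j\<close> and \<open>d (k/2)\<^sup>j\<close> at \<open>x\<^sub>k\<close>, gives the powers of \<open>k\<close> in \<open>K\<^sub>1\<close>; counting multiples of prime powers among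
  the nodes gives the factor \<open>d\<^sub>b\<^sub>n/\<Delta>\<close>.

  Analysis: the first series has positive terms, and its growth rate is read off at the maximal term \<open>\<nu> \<approx> z\<^sub>0 n\<close>. The second
  one equals the integral of \<open>f(z) (\<pi> / sin \<pi>z)\<^sup>2\<close> over a vertical line, up to a constant factor; the line is chosen
  through \<open>n w\<close> with \<open>w = - cnj z\<^sub>1\<close>, and on it the modulus of the integrand is maximal at the critical point \<open>n w\<close>.
\<close>

section \<open>Linear forms and the irrationality measure\<close>

text \<open>Parity is what leaves only \<open>1\<close> and the target number. With \<open>S\<close>
  and \<open>T\<close> rational in \<open>k\<close>, the two series centred at \<open>c\<close> are
  \<open>S\<close> and \<open>d T + S ln x\<close>, so multiplying the second by \<open>d\<close>
  gives \<open>(2k+1) T + S (d ln x)\<close>: the square root survives only inside the number to be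
  approximated. Each side of the argument wants its own starting index: \<open>c\<close> for the
  arithmetic, \<open>bn + 1\<close> for positive terms, an integer near \<open>n Re w\<close> for
  the contour. The first series may start late because \<open>R\<close> vanishes from
  \<open>c\<close> to \<open>bn\<close>; the second because two blocks of zeros overlap on
  \<open>an < \<nu> \<le> (b-a)n\<close>, so that \<open>R\<close> and \<open>R'\<close> both vanish
  there. This is why \<open>b/2 < Re w < b - a\<close> has to be extracted from the equation for
  \<open>z1\<close> before the line can be moved. The squared cosecant turns values of
  \<open>f\<close> into a sum of \<open>f'\<close> and brings the decay
  \<open>exp (-2 pi |y|)\<close>; the critical point is therefore the height at which three angles
  add up to \<open>2 pi\<close>. Only the exact growth of the coefficients and an upper bound for
  the forms enter the irrationality measure; no determinant of consecutive forms has to be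
  nonzero.\<close>

lemma finite_bounded_fractions:
  fixes \<alpha> Q0 :: real
  shows "finite {(p::int, q::nat). q > 0 \<and> real q \<le> Q0 \<and> \<bar>\<alpha> - real_of_int p / real q\<bar> \<le> 1}"
proof (rule finite_subset)
  let ?C = "Q0 * (\<bar>\<alpha>\<bar> + 1)"
  show "{(p::int, q::nat). q > 0 \<and> real q \<le> Q0 \<and> \<bar>\<alpha> - real_of_int p / real q\<bar> \<le> 1}
      \<subseteq> {\<lfloor>-?C\<rfloor>..\<lceil>?C\<rceil>} \<times> {..nat \<lceil>Q0\<rceil>}"
  proof clarify
    fix p :: int and q :: nat
    assume q: "q > 0" "real q \<le> Q0" and le: "\<bar>\<alpha> - real_of_int p / real q\<bar> \<le> 1"
    have "\<bar>real_of_int p / real q\<bar> \<le> \<bar>\<alpha>\<bar> + 1"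
      using le by linarith
    then have "\<bar>real_of_int p\<bar> \<le> real q * (\<bar>\<alpha>\<bar> + 1)"
      using q by (simp add: abs_divide field_simps)
    also have "\<dots> \<le> ?C"
      using q by (intro mult_right_mono) auto
    finally have "\<bar>real_of_int p\<bar> \<le> ?C" .
    then have "p \<in> {\<lfloor>-?C\<rfloor>..\<lceil>?C\<rceil>}"
      by (auto simp: le_ceiling_iff floor_le_iff)
    moreover have "q \<le> nat \<lceil>Q0\<rceil>"
      using q by linarith
    ultimately show "p \<in> {\<lfloor>-?C\<rfloor>..\<lceil>?C\<rceil>} \<and> q \<in> {..nat \<lceil>Q0\<rceil>}" by simp
  qed
qed simp

text \<open>\<open>\<alpha>\<close> is an arbitrary real here and may be rational, so fractions
  equal to \<open>\<alpha>\<close> are counted apart; in lowest terms there is at most one.\<close>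

lemma finite_coprime_fractions_eq:
  "finite {(p::int, q::nat). q > 0 \<and> coprime p (int q) \<and> \<alpha> = real_of_int p / real q}" (is "finite ?S")
proof -
  have "s = t" if s: "s \<in> ?S" and t: "t \<in> ?S" for s t
  proof -
    obtain p q where 1: "s = (p, q)" "q > 0" "coprime p (int q)" "\<alpha> = real_of_int p / real q"
      using s by auto
    obtain p' q' where 2: "t = (p', q')" "q' > 0" "coprime p' (int q')" "\<alpha> = real_of_int p' / real q'"
      using t by auto
    have "real_of_int p * real q' = real_of_int p' * real q"
      using 1 2 by (simp add: field_simps)
    then have eq: "p * int q' = p' * int q"
      by (metis of_int_eq_iff of_int_mult of_int_of_nat_eq)
    have "int q dvd int q'"
      using 1(3) eq by (metis coprime_commute coprime_dvd_mult_right_iff dvd_triv_right)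
    moreover have "int q' dvd int q"
      using 2(3) eq by (metis coprime_commute coprime_dvd_mult_right_iff dvd_triv_right)
    ultimately have "q = q'" by (simp add: dvd_antisym)
    then show ?thesis using eq 1 2 by simp
  qed
  note eq = this
  show ?thesis
  proof (cases "?S = {}")
    case True
    show ?thesis unfolding True by simp
  next
    case False
    then have "is_singleton ?S" using eq by (rule is_singletonI')
    then show ?thesis unfolding is_singleton_def by (elim exE) simp
  qed
qed

text \<open>The form with the least index \<open>M \<ge> m0\<close> that is nonzero at
  \<open>(P, Q)\<close> and has error at most \<open>1/(2Q)\<close> bounds the distance from below,
  since an integer of modulus at least 1 splits into two parts, one of them at most 1/2. Minimality
  bounds \<open>M\<close> linearly in \<open>ln Q\<close>. If the preceding form vanishes at
  \<open>P/Q\<close>, it determines the distance exactly, which bounds the index as well; this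
  replaces any independence of consecutive forms.\<close>

lemma approximation_quality_bound:
  fixes q p :: "nat \<Rightarrow> int" and \<alpha> \<sigma> \<tau> \<epsilon> \<kappa> :: real and P :: int and Q m0 :: nat
  assumes nz: "\<And>m. q m \<noteq> 0" and eps: "\<epsilon> > 0" "3 * \<epsilon> < \<tau>" and sig: "\<sigma> \<ge> 0"
    and lo: "\<And>m. m \<ge> m0 \<Longrightarrow> exp ((\<sigma> - \<epsilon>) * real m) \<le> \<bar>real_of_int (q m)\<bar>"
    and hi: "\<And>m. m \<ge> m0 \<Longrightarrow> \<bar>real_of_int (q m)\<bar> \<le> exp ((\<sigma> + \<epsilon>) * real m)"
    and err: "\<And>m. m \<ge> m0 \<Longrightarrow> \<bar>real_of_int (q m) * \<alpha> + real_of_int (p m)\<bar> \<le> exp (- (\<tau> - \<epsilon>) * real m)"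
    and Q: "Q > 0" and ne: "\<alpha> \<noteq> real_of_int P / real Q"
    and close: "\<bar>\<alpha> - real_of_int P / real Q\<bar> < real Q powr (-\<kappa>)"
  shows "(\<kappa> - 1) * ln (real Q) \<le>
           ln 2 + (\<sigma> + \<epsilon>) * (real m0 + 1 + (ln (real Q) + ln 2 + (\<sigma> + \<epsilon>)) / (\<tau> - 3 * \<epsilon>))"
proof -
  define A B L where "A = \<sigma> + \<epsilon>" and "B = \<tau> - 3 * \<epsilon>" and "L = ln (real Q)"
  define \<delta> where "\<delta> = \<bar>\<alpha> - real_of_int P / real Q\<bar>"
  define e where "e m = \<bar>real_of_int (q m) * \<alpha> + real_of_int (p m)\<bar>" for m
  define good where "good m \<longleftrightarrow> m \<ge> m0 \<and> q m * P + p m * int Q \<noteq> 0 \<and> 2 * real Q * e m \<le> 1" for m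
  have AB: "A > 0" "B > 0" and L0: "L \<ge> 0" and \<delta>: "\<delta> > 0" and Q1: "real Q > 0"
    using eps sig Q ne by (auto simp: A_def B_def L_def \<delta>_def)
  have expL: "real Q = exp L" using Q1 by (simp add: L_def)
  have form: "real_of_int (q m * P + p m * int Q)
      = real Q * (real_of_int (q m) * \<alpha> + real_of_int (p m)) - real_of_int (q m) * real Q * (\<alpha> - real_of_int P / real Q)" for m
    using Q1 by (simp add: field_simps)
  have deg: "e m = \<bar>real_of_int (q m)\<bar> * \<delta>" if "q m * P + p m * int Q = 0" for m
  proof -
    have "real Q * (real_of_int (q m) * \<alpha> + real_of_int (p m)) = real Q * (real_of_int (q m) * (\<alpha> - real_of_int P / real Q))"
      using form[of m] that by simp
    then have "real_of_int (q m) * \<alpha> + real_of_int (p m) = real_of_int (q m) * (\<alpha> - real_of_int P / real Q)"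
      using Q1 by simp
    then show ?thesis by (simp add: e_def \<delta>_def abs_mult)
  qed
  have e_lim: "e \<longlonglongrightarrow> 0"
  proof (rule real_tendsto_sandwich)
    show "\<forall>\<^sub>F m in sequentially. 0 \<le> e m" by (simp add: e_def)
    show "\<forall>\<^sub>F m in sequentially. e m \<le> exp (- (\<tau> - \<epsilon>)) ^ m"
      using eventually_ge_at_top[of m0]
      by eventually_elim (use err in \<open>auto simp: e_def exp_of_nat_mult[symmetric] mult.commute\<close>)
    show "(\<lambda>m. exp (- (\<tau> - \<epsilon>)) ^ m) \<longlonglongrightarrow> 0"
      using eps by (intro LIMSEQ_realpow_zero) auto
  qed simp
  \<comment> \<open>A form that vanishes at \<open>P/Q\<close> has error
    \<open>|q m| \<delta> \<ge> \<delta>\<close>; below this threshold both conditions for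
    \<open>good\<close> hold.\<close>
  have "\<forall>\<^sub>F m in sequentially. e m < min \<delta> (1 / (2 * real Q))"
    using e_lim \<delta> Q1 by (intro order_tendstoD(2)[OF e_lim]) auto
  then have "\<forall>\<^sub>F m in sequentially. good m"
    using eventually_ge_at_top[of m0]
  proof eventually_elim
    case (elim m)
    have "\<bar>real_of_int (q m)\<bar> \<ge> 1" using nz[of m] by linarith
    then have "\<delta> \<le> \<bar>real_of_int (q m)\<bar> * \<delta>" using \<delta> by simp
    then have "q m * P + p m * int Q \<noteq> 0" using deg[of m] elim by linarith
    moreover have "2 * real Q * e m \<le> 1" using elim Q1 by (simp add: field_simps)
    ultimately show ?case using elim by (simp add: good_def)
  qed
  then have ex: "\<exists>m. good m" by (auto simp: eventually_sequentially)
  define M where "M = (LEAST m. good m)"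
  have M: "good M" unfolding M_def using ex by (rule LeastI_ex)
  have min: "\<not> good m" if "m < M" for m using that not_less_Least unfolding M_def by blast
  have Mm0: "M \<ge> m0" using M by (simp add: good_def)
  have half: "1 / 2 \<le> real Q * \<bar>real_of_int (q M)\<bar> * \<delta>"
  proof -
    have "1 \<le> \<bar>q M * P + p M * int Q\<bar>" using M by (auto simp: good_def)
    then have "1 \<le> \<bar>real_of_int (q M * P + p M * int Q)\<bar>" by linarith
    also have "\<dots> \<le> real Q * e M + \<bar>real_of_int (q M)\<bar> * real Q * \<delta>"
      unfolding form e_def \<delta>_def using Q1
      by (intro order_trans[OF abs_triangle_ineq4]) (simp add: abs_mult)
    finally show ?thesis using M by (simp add: good_def mult_ac)
  qed
  also have "\<dots> \<le> real Q * exp (A * real M) * \<delta>"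
    using hi[OF Mm0] Q1 \<delta> by (intro mult_right_mono mult_left_mono) (auto simp: A_def)
  finally have half2: "exp (- ln 2) \<le> exp (L + A * real M) * \<delta>"
    by (simp add: exp_add expL[symmetric] exp_minus)
  also have "\<dots> \<le> exp (L + A * real M) * exp (- \<kappa> * L)"
    using close Q1 by (intro mult_left_mono) (auto simp: \<delta>_def powr_def L_def)
  finally have "- ln 2 \<le> L + A * real M - \<kappa> * L"
    by (simp flip: exp_add)
  then have main: "(\<kappa> - 1) * L \<le> ln 2 + A * real M" by (simp add: algebra_simps)
  have "real M \<le> real m0 + 1 + (L + ln 2 + A) / B"
  proof (cases "M = m0")
    case True
    then show ?thesis using AB L0 by simp
  next
    case False
    then obtain N where N: "M = Suc N" "N \<ge> m0" using Mm0 by (cases M) auto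
    \<comment> \<open>The predecessor \<open>N\<close> of \<open>M\<close> fails in one of two ways.
      If its form vanishes, the exponents \<open>\<sigma> + \<epsilon>\<close>,
      \<open>\<sigma> - \<epsilon>\<close> and \<open>\<tau> - \<epsilon>\<close> combine to
      \<open>\<tau> - 3\<epsilon>\<close>, the origin of \<open>B\<close>; if its error is too
      large, the bound is stronger.\<close>
    have "B * real N \<le> L + ln 2 + A"
    proof (cases "q N * P + p N * int Q = 0")
      case True
      have "exp (- ln 2 + (\<sigma> - \<epsilon>) * real N) \<le> exp (L + A * real M) * \<delta> * \<bar>real_of_int (q N)\<bar>"
        unfolding exp_add[of "- ln 2"] using half2 lo[OF N(2)] \<delta> by (intro mult_mono) auto
      also have "\<dots> = exp (L + A * real M) * e N" using deg[OF True] by (simp add: mult_ac)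
      also have "\<dots> \<le> exp (L + A * real M) * exp (- (\<tau> - \<epsilon>) * real N)"
        using err[OF N(2)] by (simp add: e_def)
      finally have "- ln 2 + (\<sigma> - \<epsilon>) * real N \<le> L + A * real M - (\<tau> - \<epsilon>) * real N"
        by (simp flip: exp_add add: algebra_simps)
      then show ?thesis unfolding A_def B_def N(1) by (simp add: algebra_simps)
    next
      case False
      then have "1 < 2 * real Q * e N" using min[of N] N by (auto simp: good_def)
      also have "\<dots> \<le> 2 * real Q * exp (- (\<tau> - \<epsilon>) * real N)"
        using err[OF N(2)] Q1 by (simp add: e_def)
      also have "\<dots> = exp (ln 2 + L - (\<tau> - \<epsilon>) * real N)"
        by (simp add: exp_add exp_diff expL exp_minus field_simps)
      finally have "0 < ln 2 + L - (\<tau> - \<epsilon>) * real N"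
        by simp
      moreover have "B * real N \<le> (\<tau> - \<epsilon>) * real N"
        using eps by (intro mult_right_mono) (auto simp: B_def)
      ultimately show ?thesis using AB by linarith
    qed
    then have "real N \<le> (L + ln 2 + A) / B" using AB by (simp add: field_simps)
    then show ?thesis using N by simp
  qed
  then have "A * real M \<le> A * (real m0 + 1 + (L + ln 2 + A) / B)"
    using AB by (intro mult_left_mono) auto
  then show ?thesis using main unfolding A_def B_def L_def by linarith
qed

text \<open>For \<open>\<kappa> - 1 > \<sigma>/\<tau>\<close> some \<open>\<epsilon> > 0\<close>
  keeps the slope \<open>(\<sigma> + \<epsilon>)/(\<tau> - 3\<epsilon>)\<close> of the preceding
  bound below \<open>\<kappa> - 1\<close>. Then \<open>ln Q\<close> is bounded and only finitely
  many fractions qualify.\<close>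

lemma irrationality_measure_le:
  fixes q p :: "nat \<Rightarrow> int" and \<alpha> \<sigma> \<tau> :: real
  assumes nz: "\<And>m. q m \<noteq> 0"
    and lim: "(\<lambda>m. ln \<bar>real_of_int (q m)\<bar> / real m) \<longlonglongrightarrow> \<sigma>"
    and tau: "\<tau> > 0"
    and err: "\<And>\<epsilon>. \<epsilon> > 0 \<Longrightarrow> \<forall>\<^sub>F m in sequentially.
                \<bar>real_of_int (q m) * \<alpha> + real_of_int (p m)\<bar> \<le> exp (- (\<tau> - \<epsilon>) * real m)"
  shows "irrationality_measure \<alpha> \<le> ereal (1 + \<sigma> / \<tau>)"
  unfolding irrationality_measure_def
proof (rule Sup_least)
  fix z :: ereal
  let ?S = "\<lambda>\<kappa>. {(p::int, q::nat). q > 0 \<and> coprime p (int q) \<and>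
               \<bar>\<alpha> - real_of_int p / real q\<bar> < real q powr (-\<kappa>)}"
  assume "z \<in> {ereal \<kappa> |\<kappa>. infinite (?S \<kappa>)}"
  then obtain \<kappa> where z: "z = ereal \<kappa>" and inf: "infinite (?S \<kappa>)"
    unfolding mem_Collect_eq by (elim exE conjE)
  show "z \<le> ereal (1 + \<sigma> / \<tau>)"
  proof (rule ccontr)
    assume "\<not> ?thesis"
    then have kap: "\<kappa> - 1 > \<sigma> / \<tau>" using z by simp
    have sig: "\<sigma> \<ge> 0"
    proof (rule tendsto_lowerbound[OF lim])
      have "\<bar>real_of_int (q m)\<bar> \<ge> 1" for m using nz[of m] by linarith
      then show "\<forall>\<^sub>F m in sequentially. 0 \<le> ln \<bar>real_of_int (q m)\<bar> / real m" by simp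
    qed simp
    then have kap1: "\<kappa> > 1" using kap tau by (smt (verit) divide_nonneg_pos)
    have "((\<lambda>\<epsilon>. (\<sigma> + \<epsilon>) / (\<tau> - 3 * \<epsilon>)) \<longlongrightarrow> (\<sigma> + 0) / (\<tau> - 3 * 0)) (at_right 0)"
      using tau by (intro tendsto_intros) auto
    then have "\<forall>\<^sub>F \<epsilon> in at_right 0. (\<sigma> + \<epsilon>) / (\<tau> - 3 * \<epsilon>) < \<kappa> - 1"
      using kap by (intro order_tendstoD(2)) auto
    moreover have "\<forall>\<^sub>F \<epsilon> in at_right 0. (\<epsilon>::real) > 0" by (rule eventually_at_right_less)
    moreover have "\<forall>\<^sub>F \<epsilon> in at_right 0. \<epsilon> < \<tau> / 3"
      using tau by (intro eventually_at_rightI[of 0 "\<tau> / 3"]) auto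
    ultimately have "\<forall>\<^sub>F \<epsilon> in at_right 0. \<epsilon> > 0 \<and> \<epsilon> < \<tau> / 3 \<and> (\<sigma> + \<epsilon>) / (\<tau> - 3 * \<epsilon>) < \<kappa> - 1"
      by eventually_elim (intro conjI)
    then have "\<exists>\<epsilon>. \<epsilon> > 0 \<and> \<epsilon> < \<tau> / 3 \<and> (\<sigma> + \<epsilon>) / (\<tau> - 3 * \<epsilon>) < \<kappa> - 1"
      by (rule eventually_happens'[OF trivial_limit_at_right_real])
    then obtain \<epsilon> where eps: "\<epsilon> > 0" "3 * \<epsilon> < \<tau>" and less: "(\<sigma> + \<epsilon>) / (\<tau> - 3 * \<epsilon>) < \<kappa> - 1"
      by (elim exE conjE) simp
    have "\<forall>\<^sub>F m in sequentially. \<bar>ln \<bar>real_of_int (q m)\<bar> / real m - \<sigma>\<bar> < \<epsilon>"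
      using lim eps(1) by (auto simp: tendsto_iff dist_real_def)
    then have "\<forall>\<^sub>F m in sequentially. exp ((\<sigma> - \<epsilon>) * real m) \<le> \<bar>real_of_int (q m)\<bar>
        \<and> \<bar>real_of_int (q m)\<bar> \<le> exp ((\<sigma> + \<epsilon>) * real m)
        \<and> \<bar>real_of_int (q m) * \<alpha> + real_of_int (p m)\<bar> \<le> exp (- (\<tau> - \<epsilon>) * real m)"
      using err[OF eps(1)] eventually_gt_at_top[of 0]
    proof eventually_elim
      case (elim m)
      let ?l = "ln \<bar>real_of_int (q m)\<bar>"
      have "?l / real m \<le> \<sigma> + \<epsilon>" "\<sigma> - \<epsilon> \<le> ?l / real m"
        using elim(1) by linarith+
      then have "?l \<le> (\<sigma> + \<epsilon>) * real m" "(\<sigma> - \<epsilon>) * real m \<le> ?l"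
        using elim(3) by (simp_all add: field_simps)
      moreover have "\<bar>real_of_int (q m)\<bar> = exp ?l" using nz[of m] by simp
      ultimately show ?case using elim(2) by (metis exp_le_cancel_iff)
    qed
    then obtain m0 where m0: "\<forall>m\<ge>m0. exp ((\<sigma> - \<epsilon>) * real m) \<le> \<bar>real_of_int (q m)\<bar>
        \<and> \<bar>real_of_int (q m)\<bar> \<le> exp ((\<sigma> + \<epsilon>) * real m)
        \<and> \<bar>real_of_int (q m) * \<alpha> + real_of_int (p m)\<bar> \<le> exp (- (\<tau> - \<epsilon>) * real m)"
      unfolding eventually_sequentially by (elim exE)
    define A B where "A = \<sigma> + \<epsilon>" and "B = \<tau> - 3 * \<epsilon>"
    \<comment> \<open>\<open>C\<close> is the bound for \<open>ln Q\<close> obtained by solving the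
      linear inequality of \<open>approximation_quality_bound\<close>.\<close>
    define C where "C = (ln 2 + A * (real m0 + 1 + (ln 2 + A) / B)) / (\<kappa> - 1 - A / B)"
    have AB: "A > 0" "B > 0" "A / B < \<kappa> - 1" using eps sig less by (auto simp: A_def B_def)
    have sub: "?S \<kappa> \<subseteq> {(p::int, q::nat). q > 0 \<and> coprime p (int q) \<and> \<alpha> = real_of_int p / real q}
        \<union> {(p::int, q::nat). q > 0 \<and> real q \<le> exp C \<and> \<bar>\<alpha> - real_of_int p / real q\<bar> \<le> 1}"
    proof (rule subsetI)
      fix r assume r: "r \<in> ?S \<kappa>"
      obtain P :: int and Q :: nat where PQ: "r = (P, Q)" by (cases r)
      have Q: "Q > 0" "coprime P (int Q)" and close: "\<bar>\<alpha> - real_of_int P / real Q\<bar> < real Q powr (-\<kappa>)"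
        using r unfolding PQ by auto
      have "0 < Q \<and> coprime P (int Q) \<and> \<alpha> = real_of_int P / real Q"
        if nin: "\<not> (0 < Q \<and> real Q \<le> exp C \<and> \<bar>\<alpha> - real_of_int P / real Q\<bar> \<le> 1)"
      proof -
        have "real Q powr (-\<kappa>) \<le> 1"
          using Q kap1 by (simp add: powr_minus field_simps ge_one_powr_ge_zero)
        then have "real Q > exp C" using nin close Q by linarith
        then have big: "ln (real Q) > C" using Q by (metis exp_less_cancel_iff exp_ln of_nat_0_less_iff)
        show "0 < Q \<and> coprime P (int Q) \<and> \<alpha> = real_of_int P / real Q"
        proof (rule ccontr)
          assume "\<not> ?thesis"
          then have ne: "\<alpha> \<noteq> real_of_int P / real Q" using Q by simp
          have "(\<kappa> - 1) * ln (real Q) \<le> ln 2 + A * (real m0 + 1 + (ln (real Q) + ln 2 + A) / B)"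
            unfolding A_def B_def
            by (rule approximation_quality_bound[OF nz eps sig _ _ _ Q(1) ne close]) (use m0 in auto)
          then have "(\<kappa> - 1 - A / B) * ln (real Q) \<le> ln 2 + A * (real m0 + 1 + (ln 2 + A) / B)"
            by (simp add: algebra_simps add_divide_distrib)
          then have "ln (real Q) \<le> C"
            unfolding C_def using AB by (subst pos_le_divide_eq) (auto simp: mult_ac)
          then show False using big by simp
        qed
      qed
      then show "r \<in> {(p::int, q::nat). q > 0 \<and> coprime p (int q) \<and> \<alpha> = real_of_int p / real q}
        \<union> {(p::int, q::nat). q > 0 \<and> real q \<le> exp C \<and> \<bar>\<alpha> - real_of_int p / real q\<bar> \<le> 1}"
        unfolding PQ by auto
    qed
    have "finite (?S \<kappa>)"
      by (rule finite_subset[OF sub finite_UnI[OF finite_coprime_fractions_eq finite_bounded_fractions]])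
    then show False using inf by simp
  qed
qed

section \<open>Generating functions of odd and even polynomials\<close>

text \<open>The values of the \<open>B j\<close> at \<open>0, 1, 2, ...\<close> form a unitriangular
  integer matrix, so the coefficients come from the values of \<open>h\<close> by integer recursion:
  a common denominator \<open>C\<close> of the values also serves the coefficients, and leading
  zeros of \<open>h\<close> give leading zero coefficients. Agreement on \<open>0..J\<close> extends
  to \<open>-J..J\<close> by parity, which is more points than the degree allows.\<close>

lemma central_interpolation:
  fixes B :: "nat \<Rightarrow> real poly" and h :: "real poly" and \<sigma> C :: real
  assumes degB: "\<And>j. j \<in> {1..J} \<Longrightarrow> degree (B j) \<le> 2 * J" and degh: "degree h \<le> 2 * J"
    and parB: "\<And>j t. j \<ge> 1 \<Longrightarrow> poly (B j) (-t) = \<sigma> * poly (B j) t"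
    and parh: "\<And>t. poly h (-t) = \<sigma> * poly h t"
    and h0: "poly h 0 = 0"
    and diag: "\<And>j. j \<ge> 1 \<Longrightarrow> poly (B j) (real j) = 1"
    and low: "\<And>i j. i < j \<Longrightarrow> poly (B j) (real i) = 0"
    and int: "\<And>i j. j \<ge> 1 \<Longrightarrow> poly (B j) (real i) \<in> \<int>"
    and Cint: "\<And>i. C * poly h (real i) \<in> \<int>"
  shows "\<exists>a. (\<forall>j. C * a j \<in> \<int>) \<and> (\<forall>j. (\<forall>i\<le>j. poly h (real i) = 0) \<longrightarrow> a j = 0) \<and>
             h = (\<Sum>j=1..J. smult (a j) (B j))"
proof -
  have "\<exists>a. (\<forall>j. C * a j \<in> \<int>) \<and> (\<forall>j. (\<forall>i\<le>j. poly h (real i) = 0) \<longrightarrow> a j = 0) \<and>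
          (\<forall>i\<le>K. poly h (real i) = (\<Sum>j=1..K. a j * poly (B j) (real i)))" for K
  proof (induction K)
    case 0
    show ?case by (rule exI[of _ "\<lambda>_. 0"]) (use h0 in auto)
  next
    case (Suc K)
    then obtain a where a: "\<And>j. C * a j \<in> \<int>" "\<And>j. (\<forall>i\<le>j. poly h (real i) = 0) \<Longrightarrow> a j = 0"
        "\<And>i. i \<le> K \<Longrightarrow> poly h (real i) = (\<Sum>j=1..K. a j * poly (B j) (real i))"
      by auto
    \<comment> \<open>The defect at the next node. The new basis polynomial is 1 there and 0 at all
      earlier nodes, so the values already matched are untouched.\<close>
    define v where "v = poly h (real (Suc K)) - (\<Sum>j=1..K. a j * poly (B j) (real (Suc K)))"
    define a' where "a' = a(Suc K := v)"
    have split: "(\<Sum>j=1..Suc K. a' j * poly (B j) t)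
        = (\<Sum>j=1..K. a j * poly (B j) t) + v * poly (B (Suc K)) t" for t
    proof -
      have "(\<Sum>j=1..K. a' j * poly (B j) t) = (\<Sum>j=1..K. a j * poly (B j) t)"
        by (intro sum.cong) (auto simp: a'_def)
      then show ?thesis by (simp add: a'_def)
    qed
    have "C * v = C * poly h (real (Suc K)) - (\<Sum>j=1..K. (C * a j) * poly (B j) (real (Suc K)))"
      by (simp add: v_def right_diff_distrib sum_distrib_left mult.assoc)
    also have "\<dots> \<in> \<int>"
      by (intro Ints_diff Ints_sum Ints_mult[OF a(1) int] Cint) auto
    finally have "C * v \<in> \<int>" .
    moreover have "v = 0" if "\<forall>i\<le>Suc K. poly h (real i) = 0"
    proof -
      have "a j = 0" if "j \<in> {1..K}" for j
        using a(2)[of j] \<open>\<forall>i\<le>Suc K. poly h (real i) = 0\<close> that by auto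
      then have "(\<Sum>j=1..K. a j * poly (B j) (real (Suc K))) = 0" by simp
      then show ?thesis using that[rule_format, of "Suc K"] unfolding v_def by simp
    qed
    moreover have "poly h (real i) = (\<Sum>j=1..Suc K. a' j * poly (B j) (real i))" if "i \<le> Suc K" for i
    proof (cases "i = Suc K")
      case True
      then show ?thesis unfolding split using diag[of "Suc K"] by (simp add: v_def)
    next
      case False
      then show ?thesis unfolding split using a(3)[of i] low[of i "Suc K"] that by simp
    qed
    ultimately show ?case
    proof (intro exI[of _ a'] conjI allI impI)
      show "C * a' j \<in> \<int>" for j
        using a(1)[of j] \<open>C * v \<in> \<int>\<close> by (simp add: a'_def)
      show "a' j = 0" if "\<forall>i\<le>j. poly h (real i) = 0" for j
        using a(2)[OF that] that \<open>(\<forall>i\<le>Suc K. poly h (real i) = 0) \<Longrightarrow> v = 0\<close>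
        by (cases "j = Suc K") (simp_all add: a'_def)
    qed
  qed
  then obtain a where a: "\<And>j. C * a j \<in> \<int>" "\<And>j. (\<forall>i\<le>j. poly h (real i) = 0) \<Longrightarrow> a j = 0"
      "\<And>i. i \<le> J \<Longrightarrow> poly h (real i) = (\<Sum>j=1..J. a j * poly (B j) (real i))"
    by blast
  let ?g = "\<Sum>j=1..J. smult (a j) (B j)"
  have "h = ?g"
  proof (rule poly_eqI_degree)
    let ?A = "(real_of_int ` {- int J..int J})"
    have "card ?A = 2 * J + 1"
      by (subst card_image) (auto simp: inj_on_def)
    then show "degree h < card ?A" "degree ?g < card ?A"
      using degh degB by (auto intro!: le_imp_less_Suc degree_sum_le order_trans[OF degree_smult_le])
    have nonneg: "poly h (real i) = poly ?g (real i)" if "i \<le> J" for i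
      using a(3)[OF that] by (simp add: poly_sum)
    fix x assume "x \<in> ?A"
    then obtain z where z: "x = real_of_int z" "\<bar>z\<bar> \<le> int J" by auto
    define i where "i = nat \<bar>z\<bar>"
    have i: "i \<le> J" "x = real i \<or> x = - real i" using z by (auto simp: i_def abs_if split: if_splits)
    have "poly ?g (- real i) = \<sigma> * poly ?g (real i)"
      by (simp add: poly_sum sum_distrib_left parB mult_ac)
    then show "poly h x = poly ?g x"
      using i nonneg[of i] parh[of "real i"] by auto
  qed
  then show ?thesis using a by blast
qed

text \<open>The negative binomial series with its index moved by \<open>m - r\<close>; the terms
  gained by the shift are zero because there \<open>t + r < m\<close>.\<close>

lemma choose_shift_sums:
  fixes x :: real
  assumes x: "\<bar>x\<bar> < 1" and r: "r \<le> m"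
  shows "(\<lambda>t. real ((t + r) choose m) * x ^ t) sums (x ^ (m - r) / (1 - x) ^ (m + 1))"
proof -
  obtain d where m: "m = r + d" using r le_Suc_ex by blast
  have "(\<lambda>n. ((- real (m + 1)) gchoose n) * (-x) ^ n) sums (1 + (-x)) powr (- real (m + 1))"
    by (rule gen_binomial_real) (use x in auto)
  moreover have "((- real (m + 1)) gchoose n) * (-x) ^ n = real ((n + m) choose m) * x ^ n" for n
  proof -
    have "(- real (m + 1)) gchoose n = (-1) ^ n * ((real (n + m)) gchoose n)"
      by (subst gbinomial_minus) (simp add: algebra_simps)
    also have "(real (n + m)) gchoose n = real ((n + m) choose m)"
      using binomial_symmetric[of m "n + m"] by (simp add: binomial_gbinomial)
    finally show ?thesis by (simp add: power_mult_distrib[symmetric] mult_ac flip: power_mult_distrib)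
  qed
  moreover have "(1 + (-x)) powr (- real (m + 1)) = 1 / (1 - x) ^ (m + 1)"
    using x by (subst powr_minus_divide, subst powr_realpow) auto
  ultimately have "(\<lambda>n. real ((n + m) choose m) * x ^ n) sums (1 / (1 - x) ^ (m + 1))" by simp
  then have "(\<lambda>n. x ^ (m - r) * (real ((n + m) choose m) * x ^ n)) sums (x ^ (m - r) * (1 / (1 - x) ^ (m + 1)))"
    by (rule sums_mult)
  also have "(\<lambda>n. x ^ (m - r) * (real ((n + m) choose m) * x ^ n))
      = (\<lambda>n. real ((n + (m - r) + r) choose m) * x ^ (n + (m - r)))"
    by (simp add: m power_add ac_simps)
  finally have "(\<lambda>n. real ((n + (m - r) + r) choose m) * x ^ (n + (m - r))) sums (x ^ (m - r) / (1 - x) ^ (m + 1))"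
    by simp
  then show ?thesis
    by (subst (asm) sums_zero_iff_shift) (use r in \<open>auto simp: binomial_eq_0\<close>)
qed

definition choose_poly :: "nat \<Rightarrow> nat \<Rightarrow> real poly" where
  "choose_poly r m = smult (1 / fact m) (\<Prod>i<m. [:real r - real i, 1:])"

lemma poly_choose_poly: "poly (choose_poly r m) t = (t + real r) gchoose m"
  by (simp add: choose_poly_def poly_prod gbinomial_prod_rev atLeast0LessThan algebra_simps)

lemma poly_choose_poly_nat: "poly (choose_poly r m) (real t) = real ((t + r) choose m)"
  by (simp add: poly_choose_poly binomial_gbinomial)

lemma degree_choose_poly: "degree (choose_poly r m) \<le> m"
proof -
  have "degree (\<Prod>i<m. [:real r - real i, 1:]) \<le> (\<Sum>i<m. degree [:real r - real i, 1:])"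
    by (rule degree_prod_sum_le[OF finite_lessThan, unfolded o_def])
  then show ?thesis unfolding choose_poly_def by (intro order_trans[OF degree_smult_le]) simp
qed

text \<open>The source of both central bases: \<open>r = s = j - 1\<close> makes the binomial of
  order \<open>2j - 1\<close> odd, while for order \<open>2j\<close> reflection swaps the shifts
  \<open>j\<close> and \<open>j - 1\<close>, so that their sum is even.\<close>

lemma poly_choose_poly_minus:
  assumes "m = r + s + 1"
  shows "poly (choose_poly r m) (- t) = (-1) ^ m * poly (choose_poly s m) t"
proof -
  have "(- t + real r) gchoose m = (- (t - real r)) gchoose m" by (simp add: algebra_simps)
  also have "\<dots> = (-1) ^ m * ((t - real r + real m - 1) gchoose m)" by (rule gbinomial_minus)
  also have "t - real r + real m - 1 = t + real s" using assms by simp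
  finally show ?thesis by (simp add: poly_choose_poly)
qed

text \<open>In the basis \<open>binomial (t + j - 1) (2j - 1)\<close> the shift formula yields
  \<open>x^j / (1-x)^(2j)\<close>, an exact power. The vanishing clause for \<open>a j\<close> is
  kept because it decides which powers of \<open>k\<close> can later be divided out.\<close>

lemma odd_poly_generating_function:
  fixes h :: "real poly" and C :: real
  assumes deg: "degree h \<le> 2 * J" and odd: "\<And>t. poly h (-t) = - poly h t"
    and Cint: "\<And>i. C * poly h (real i) \<in> \<int>"
  shows "\<exists>a. (\<forall>j. C * a j \<in> \<int>) \<and> (\<forall>j. (\<forall>i\<le>j. poly h (real i) = 0) \<longrightarrow> a j = 0) \<and>
     (\<forall>x. \<bar>x\<bar> < 1 \<longrightarrow> (\<lambda>t. poly h (real t) * x ^ t) sums (\<Sum>j=1..J. a j * (x / (1 - x)\<^sup>2) ^ j))"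
proof -
  define B where "B j = choose_poly (j - 1) (2 * j - 1)" for j
  have h0: "poly h 0 = 0" using odd[of 0] by simp
  have "\<exists>a. (\<forall>j. C * a j \<in> \<int>) \<and> (\<forall>j. (\<forall>i\<le>j. poly h (real i) = 0) \<longrightarrow> a j = 0) \<and>
             h = (\<Sum>j=1..J. smult (a j) (B j))"
  proof (rule central_interpolation[where \<sigma> = "-1"])
    show "degree (B j) \<le> 2 * J" if "j \<in> {1..J}" for j
      using that unfolding B_def by (intro order_trans[OF degree_choose_poly]) auto
    show "poly (B j) (-t) = -1 * poly (B j) t" if "j \<ge> 1" for j t
      unfolding B_def using that by (subst poly_choose_poly_minus[where s = "j - 1"]) auto
    show "poly (B j) (real j) = 1" if "j \<ge> 1" for j
      unfolding B_def poly_choose_poly_nat using that by (simp add: mult_2)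
    show "poly (B j) (real i) = 0" if "i < j" for i j
      unfolding B_def poly_choose_poly_nat using that by (auto simp: binomial_eq_0_iff)
    show "poly (B j) (real i) \<in> \<int>" for i j
      unfolding B_def poly_choose_poly_nat by simp
  qed (use deg odd Cint h0 in auto)
  then obtain a where a: "\<And>j. C * a j \<in> \<int>" "\<And>j. (\<forall>i\<le>j. poly h (real i) = 0) \<Longrightarrow> a j = 0"
      and h: "h = (\<Sum>j=1..J. smult (a j) (B j))" by blast
  have "(\<lambda>t. poly h (real t) * x ^ t) sums (\<Sum>j=1..J. a j * (x / (1 - x)\<^sup>2) ^ j)" if x: "\<bar>x\<bar> < 1" for x
  proof -
    have "(\<lambda>t. a j * (poly (B j) (real t) * x ^ t)) sums (a j * (x / (1 - x)\<^sup>2) ^ j)" if "j \<in> {1..J}" for j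
    proof -
      have "2 * j - 1 - (j - 1) = j" "2 * j - 1 + 1 = 2 * j" using that by auto
      then show ?thesis
        using choose_shift_sums[OF x, of "j - 1" "2 * j - 1"] that unfolding B_def poly_choose_poly_nat
        by (intro sums_mult) (simp add: power_divide power_mult)
    qed
    then have "(\<lambda>t. \<Sum>j=1..J. a j * (poly (B j) (real t) * x ^ t)) sums (\<Sum>j=1..J. a j * (x / (1 - x)\<^sup>2) ^ j)"
      by (rule sums_sum)
    then show ?thesis
      by (subst h) (simp add: poly_sum sum_distrib_right sum_distrib_left mult_ac)
  qed
  then show ?thesis using a by blast
qed

text \<open>The two shifted binomials contribute \<open>x^j\<close> and \<open>x^(j+1)\<close> over
  the same denominator, whence the common factor \<open>(1+x)/(1-x)\<close>. The condition
  \<open>h(0) = 0\<close> accounts for the missing constant basis polynomial.\<close>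

lemma even_poly_generating_function:
  fixes h :: "real poly" and C :: real
  assumes deg: "degree h \<le> 2 * J" and even: "\<And>t. poly h (-t) = poly h t" and h0: "poly h 0 = 0"
    and Cint: "\<And>i. C * poly h (real i) \<in> \<int>"
  shows "\<exists>a. (\<forall>j. C * a j \<in> \<int>) \<and> (\<forall>j. (\<forall>i\<le>j. poly h (real i) = 0) \<longrightarrow> a j = 0) \<and>
     (\<forall>x. \<bar>x\<bar> < 1 \<longrightarrow> (\<lambda>t. poly h (real t) * x ^ t) sums
        ((1 + x) / (1 - x) * (\<Sum>j=1..J. a j * (x / (1 - x)\<^sup>2) ^ j)))"
proof -
  define B where "B j = choose_poly j (2 * j) + choose_poly (j - 1) (2 * j)" for j
  have "\<exists>a. (\<forall>j. C * a j \<in> \<int>) \<and> (\<forall>j. (\<forall>i\<le>j. poly h (real i) = 0) \<longrightarrow> a j = 0) \<and>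
             h = (\<Sum>j=1..J. smult (a j) (B j))"
  proof (rule central_interpolation[where \<sigma> = 1])
    show "degree (B j) \<le> 2 * J" if "j \<in> {1..J}" for j
      using that unfolding B_def
      by (intro degree_add_le order_trans[OF degree_choose_poly]) auto
    show "poly (B j) (-t) = 1 * poly (B j) t" if "j \<ge> 1" for j t
      unfolding B_def poly_add using that
        poly_choose_poly_minus[of "2 * j" j "j - 1" t] poly_choose_poly_minus[of "2 * j" "j - 1" j t]
      by simp
    show "poly (B j) (real j) = 1" if "j \<ge> 1" for j
      unfolding B_def poly_add poly_choose_poly_nat using that by (simp add: mult_2 binomial_eq_0)
    show "poly (B j) (real i) = 0" if "i < j" for i j
      unfolding B_def poly_add poly_choose_poly_nat using that by (simp add: binomial_eq_0)
    show "poly (B j) (real i) \<in> \<int>" for i j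
      unfolding B_def poly_add poly_choose_poly_nat by simp
  qed (use deg even Cint h0 in auto)
  then obtain a where a: "\<And>j. C * a j \<in> \<int>" "\<And>j. (\<forall>i\<le>j. poly h (real i) = 0) \<Longrightarrow> a j = 0"
      and h: "h = (\<Sum>j=1..J. smult (a j) (B j))" by blast
  have "(\<lambda>t. poly h (real t) * x ^ t) sums ((1 + x) / (1 - x) * (\<Sum>j=1..J. a j * (x / (1 - x)\<^sup>2) ^ j))"
    if x: "\<bar>x\<bar> < 1" for x
  proof -
    have "(\<lambda>t. a j * (poly (B j) (real t) * x ^ t)) sums (a j * ((1 + x) / (1 - x) * (x / (1 - x)\<^sup>2) ^ j))"
      if "j \<in> {1..J}" for j
    proof -
      have "(\<lambda>t. real ((t + j) choose (2 * j)) * x ^ t + real ((t + (j - 1)) choose (2 * j)) * x ^ t)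
        sums (x ^ j / (1 - x) ^ (2 * j + 1) + x ^ (j + 1) / (1 - x) ^ (2 * j + 1))"
        using choose_shift_sums[OF x, of j "2 * j"] choose_shift_sums[OF x, of "j - 1" "2 * j"] that
        by (intro sums_add) (simp_all add: mult_2 algebra_simps)
      also have "x ^ j / (1 - x) ^ (2 * j + 1) + x ^ (j + 1) / (1 - x) ^ (2 * j + 1)
        = (1 + x) / (1 - x) * (x / (1 - x)\<^sup>2) ^ j"
        proof -
          have "(1 - x) ^ (2 * j + 1) = (1 - x) * ((1 - x)\<^sup>2) ^ j" by (simp add: power_mult)
          then have "x ^ j / (1 - x) ^ (2 * j + 1) + x ^ (j + 1) / (1 - x) ^ (2 * j + 1)
              = (x ^ j + x ^ (j + 1)) / ((1 - x) * ((1 - x)\<^sup>2) ^ j)"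
            by (simp only: add_divide_distrib)
          also have "x ^ j + x ^ (j + 1) = (1 + x) * x ^ j" by (simp add: distrib_right)
          finally show ?thesis by (simp add: power_divide)
        qed
      finally show ?thesis
        unfolding B_def poly_add poly_choose_poly_nat by (intro sums_mult) (simp add: algebra_simps)
    qed
    then have "(\<lambda>t. \<Sum>j=1..J. a j * (poly (B j) (real t) * x ^ t)) sums
        (\<Sum>j=1..J. a j * ((1 + x) / (1 - x) * (x / (1 - x)\<^sup>2) ^ j))"
      by (rule sums_sum)
    then show ?thesis
      by (subst h) (simp add: poly_sum sum_distrib_right sum_distrib_left mult_ac)
  qed
  then show ?thesis using a by blast
qed

section \<open>Divisibility\<close>

text \<open>The zeros of \<open>R\<close>, tagged by the binomial factor they come from: a set of
  pairs keeps a multiple zero as several elements, so removing one element removes exactly one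
  linear factor.\<close>

definition nodes :: "nat \<Rightarrow> nat \<Rightarrow> nat \<Rightarrow> (nat \<times> nat) set" where
  "nodes a b n = (SIGMA i:{..<3}. {i * a * n<..(b - i * a) * n})"

text \<open>Generic in the ring because the same product is used over the integers for divisibility,
  over the reals for series and over the complex numbers for contours.\<close>

definition node_prod :: "(nat \<times> nat) set \<Rightarrow> 'a::comm_ring_1 \<Rightarrow> 'a" where
  "node_prod I t = (\<Prod>r\<in>I. t - of_nat (snd r))"

definition nodes_den :: "nat \<Rightarrow> nat \<Rightarrow> nat \<Rightarrow> nat" where
  "nodes_den a b n = (\<Prod>i<3. fact ((b - 2 * i * a) * n))"

lemma sum_lessThan_3: "(\<Sum>i<(3::nat). f i) = f 0 + f 1 + f 2"
  by (simp add: eval_nat_numeral)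

lemma finite_nodes [simp]: "finite (nodes a b n)"
  by (simp add: nodes_def)

text \<open>The differences \<open>\<nu> - j\<close> run through the integers in
  \<open>(\<nu> - 1 - q, \<nu> - 1 - p]\<close>; the \<open>- 1\<close> comes from the block being
  open on the left. Quotients are floors, so \<open>\<nu>\<close> may lie anywhere.\<close>

lemma card_multiples_block:
  fixes \<nu> :: int
  assumes P: "P > 0" and pq: "p \<le> q"
  shows "int (card {j \<in> {p<..q}. int P dvd \<nu> - int j}) = (\<nu> - 1 - int p) div int P - (\<nu> - 1 - int q) div int P"
  using pq
proof (induction q rule: dec_induct)
  case base
  show ?case by simp
next
  case (step q)
  have set: "{j \<in> {p<..Suc q}. int P dvd \<nu> - int j}
      = (if int P dvd \<nu> - int (Suc q) then insert (Suc q) {j \<in> {p<..q}. int P dvd \<nu> - int j}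
         else {j \<in> {p<..q}. int P dvd \<nu> - int j})"
    using step(1) by (auto simp: le_Suc_eq)
  have "(\<nu> - 1 - int q) div int P - (\<nu> - 1 - int (Suc q)) div int P
      = (if int P dvd \<nu> - int (Suc q) then 1 else 0)"
  proof -
    define m where "m = \<nu> - 1 - int (Suc q)"
    have "(m + 1) div int P - m div int P = (if int P dvd m + 1 then 1 else 0)"
    proof (cases "int P dvd m + 1")
      case True
      then obtain k where k: "m + 1 = int P * k" by auto
      then have "m = int P * (k - 1) + (int P - 1)" by (simp add: algebra_simps)
      then have "m div int P = k - 1"
        using P by (intro int_div_pos_eq[where r = "int P - 1"]) auto
      moreover have "(m + 1) div int P = k" using k P by simp
      ultimately show ?thesis using True by simp
    next
      case False
      define k r where "k = (m + 1) div int P" and "r = (m + 1) mod int P"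
      have "r \<noteq> 0" using False unfolding r_def dvd_eq_mod_eq_0 .
      moreover have "0 \<le> r" "r < int P" using P by (simp_all add: r_def)
      ultimately have r: "0 < r" "r < int P" by simp_all
      have "m = int P * k + (r - 1)" using mult_div_mod_eq[of "int P" "m + 1"] unfolding k_def r_def by linarith
      then have "m div int P = k" using r by (intro int_div_pos_eq[where r = "r - 1"]) auto
      then show ?thesis using False by (simp add: k_def)
    qed
    then show ?thesis by (simp add: m_def algebra_simps)
  qed
  then show ?case using step(3) unfolding set by auto
qed

lemma sum_card_swap:
  assumes "finite A" "finite B"
  shows "(\<Sum>i\<in>A. card {r \<in> B. R i r}) = (\<Sum>r\<in>B. card {i \<in> A. R i r})"
proof -
  have "(\<Sum>i\<in>A. card {r \<in> B. R i r}) = (\<Sum>i\<in>A. \<Sum>r\<in>B. if R i r then 1 else 0)"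
    using assms by (intro sum.cong refl) (simp add: sum.If_cases Int_def)
  also have "\<dots> = (\<Sum>r\<in>B. \<Sum>i\<in>A. if R i r then 1 else 0)" by (rule sum.swap)
  also have "\<dots> = (\<Sum>r\<in>B. card {i \<in> A. R i r})"
    using assms by (intro sum.cong refl) (simp add: sum.If_cases Int_def)
  finally show ?thesis .
qed

lemma card_power_dvd:
  fixes x p :: int
  assumes "prime p" "x \<noteq> 0"
  shows "card {i \<in> {1..L}. p ^ i dvd x} = min L (multiplicity p x)"
proof -
  have "{i \<in> {1..L}. p ^ i dvd x} = {1..min L (multiplicity p x)}"
    using assms by (auto simp: power_dvd_iff_le_multiplicity)
  then show ?thesis by simp
qed

lemma multiplicity_prod_ge:
  fixes f :: "'i \<Rightarrow> int" and p :: int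
  assumes p: "prime p" and A: "finite A" and nz: "\<And>r. r \<in> A \<Longrightarrow> f r \<noteq> 0"
  shows "(\<Sum>i=1..L. card {r \<in> A. p ^ i dvd f r}) \<le> multiplicity p (\<Prod>r\<in>A. f r)"
proof -
  have "(\<Sum>i=1..L. card {r \<in> A. p ^ i dvd f r}) = (\<Sum>r\<in>A. card {i \<in> {1..L}. p ^ i dvd f r})"
    using A by (intro sum_card_swap) auto
  also have "\<dots> \<le> (\<Sum>r\<in>A. multiplicity p (f r))"
  proof (rule sum_mono)
    fix r assume "r \<in> A"
    then show "card {i \<in> {1..L}. p ^ i dvd f r} \<le> multiplicity p (f r)"
      using card_power_dvd[OF p nz, of r L] by linarith
  qed
  also have "\<dots> = multiplicity p (\<Prod>r\<in>A. f r)"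
    using p A nz by (subst prime_elem_multiplicity_prod_distrib) auto
  finally show ?thesis .
qed

lemma multiplicity_int: "multiplicity (int p) (int x) = multiplicity p x"
  unfolding multiplicity_def by (simp flip: of_nat_power)

text \<open>Legendre's formula, cut off at a level beyond which no number up to \<open>M\<close> is
  divisible by the prime power.\<close>

lemma multiplicity_fact_le:
  fixes p :: nat
  assumes p: "prime p" and L: "M < p ^ Suc L"
  shows "multiplicity p (fact M) \<le> (\<Sum>i=1..L. M div p ^ i)"
proof -
  have p': "prime (int p)" using p by simp
  have "multiplicity (int p) (fact M) = multiplicity (int p) (\<Prod>j\<in>{1..M}. int j)"
    by (simp add: fact_prod)
  also have "\<dots> = (\<Sum>j\<in>{1..M}. multiplicity (int p) (int j))"
    using p' by (subst prime_elem_multiplicity_prod_distrib) auto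
  also have "\<dots> = (\<Sum>j\<in>{1..M}. card {i \<in> {1..L}. int p ^ i dvd int j})"
  proof (intro sum.cong refl)
    fix j assume j: "j \<in> {1..M}"
    have "multiplicity (int p) (int j) \<le> L"
    proof (rule ccontr)
      assume "\<not> ?thesis"
      then have "int p ^ Suc L dvd int j"
        using j p' by (subst power_dvd_iff_le_multiplicity) auto
      then have "p ^ Suc L dvd j" by (metis int_dvd_int_iff of_nat_power)
      then have "p ^ Suc L \<le> j" using j by (intro dvd_imp_le) auto
      then show False using j L by auto
    qed
    then show "multiplicity (int p) (int j) = card {i \<in> {1..L}. int p ^ i dvd int j}"
      using card_power_dvd[OF p', of "int j" L] j by simp
  qed
  also have "\<dots> = (\<Sum>i=1..L. card {j \<in> {1..M}. int p ^ i dvd int j})"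
    by (rule sum_card_swap[symmetric]) auto
  also have "\<dots> = (\<Sum>i=1..L. M div p ^ i)"
  proof (intro sum.cong refl)
    fix i
    have pos: "p ^ i > 0" using p by (simp add: prime_gt_0_nat)
    \<comment> \<open>Reflection brings the count into the form of
      \<open>card_multiples_block\<close>, evaluated at \<open>M + 1\<close>.\<close>
    have "bij_betw (\<lambda>j. Suc M - j) {j \<in> {0<..M}. int (p ^ i) dvd int (Suc M) - int j} {j \<in> {1..M}. int p ^ i dvd int j}"
      by (rule bij_betw_byWitness[where f' = "\<lambda>j. Suc M - j"]) (auto simp: of_nat_diff)
    then have "card {j \<in> {1..M}. int p ^ i dvd int j} = card {j \<in> {0<..M}. int (p ^ i) dvd int (Suc M) - int j}"
      by (simp add: bij_betw_same_card)
    then have "int (card {j \<in> {1..M}. int p ^ i dvd int j}) = int M div int (p ^ i)"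
      using card_multiples_block[OF pos, of 0 M "int (Suc M)"] by simp
    then show "card {j \<in> {1..M}. int p ^ i dvd int j} = M div p ^ i"
      by (metis of_nat_eq_iff zdiv_int)
  qed
  finally have "multiplicity (int p) (int (fact M)) = (\<Sum>i=1..L. M div p ^ i)" by simp
  then show ?thesis by (metis multiplicity_int order_refl)
qed

lemma card_multiples_nodes:
  fixes \<nu> :: int
  assumes P: "P > 0" and ab: "4 * a < b"
  shows "int (card {r \<in> nodes a b n. int P dvd \<nu> - int (snd r)})
       = (\<Sum>i<3. (\<nu> - 1 - int (i * a * n)) div int P - (\<nu> - 1 - int ((b - i * a) * n)) div int P)"
proof -
  have "{r \<in> nodes a b n. int P dvd \<nu> - int (snd r)}
      = (SIGMA i:{..<3}. {j \<in> {i * a * n<..(b - i * a) * n}. int P dvd \<nu> - int j})"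
    by (auto simp: nodes_def)
  then have "int (card {r \<in> nodes a b n. int P dvd \<nu> - int (snd r)})
      = (\<Sum>i<3. int (card {j \<in> {i * a * n<..(b - i * a) * n}. int P dvd \<nu> - int j}))"
    by simp
  also have "\<dots> = (\<Sum>i<3. (\<nu> - 1 - int (i * a * n)) div int P - (\<nu> - 1 - int ((b - i * a) * n)) div int P)"
  proof (intro sum.cong refl card_multiples_block[OF P] mult_right_mono)
    fix i :: nat assume "i \<in> {..<3}"
    then have "i * a \<le> 2 * a" by (intro mult_right_mono) auto
    then show "i * a \<le> b - i * a" using ab by linarith
  qed simp
  finally show ?thesis .
qed

text \<open>Superadditivity of the floor, block by block: every block contains at least as many
  multiples as Legendre's formula counts in the factorial dividing it.\<close>

lemma card_multiples_nodes_ge: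
  fixes \<nu> :: int
  assumes P: "P > 0" and ab: "4 * a < b"
  shows "(\<Sum>i<3. (b - 2 * i * a) * n div P) \<le> card {r \<in> nodes a b n. int P dvd \<nu> - int (snd r)}"
proof -
  have "int (\<Sum>i<3. (b - 2 * i * a) * n div P) = (\<Sum>i<3. int ((b - 2 * i * a) * n) div int P)"
    by (simp add: zdiv_int)
  also have "\<dots> \<le> int (card {r \<in> nodes a b n. int P dvd \<nu> - int (snd r)})"
    unfolding card_multiples_nodes[OF assms]
  proof (intro sum_mono)
    fix i :: nat assume "i \<in> {..<3}"
    then have "i * a \<le> 2 * a" by (intro mult_right_mono) auto
    moreover have "2 * i * a = 2 * (i * a)" by simp
    ultimately have eq: "(b - i * a) = i * a + (b - 2 * i * a)" using ab by linarith
    define u v where "u = \<nu> - 1 - int ((b - i * a) * n)" and "v = int ((b - 2 * i * a) * n)"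
    have "int ((b - i * a) * n) = int (i * a * n) + v"
      by (subst eq) (simp add: v_def algebra_simps)
    then have "\<nu> - 1 - int (i * a * n) = u + v" by (simp add: u_def)
    moreover have "v div int P \<le> (u + v) div int P - u div int P"
      using div_add1_eq[of u v "int P"] P by (simp add: pos_imp_zdiv_nonneg_iff)
    ultimately show "int ((b - 2 * i * a) * n) div int P
        \<le> (\<nu> - 1 - int (i * a * n)) div int P - (\<nu> - 1 - int ((b - i * a) * n)) div int P"
      unfolding u_def v_def by (simp only:)
  qed
  finally show ?thesis by linarith
qed

text \<open>Taking \<open>x = (\<nu> - 1)/P\<close> in the condition defining \<open>Omega\<close>
  gives one multiple more than the factorials use up. Replacing \<open>n/P\<close> by its fractional
  part is harmless, since in each of the three brackets the coefficients of \<open>y\<close> add up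
  to zero and the integer parts cancel.\<close>

lemma Omega_imp_card_multiples_nodes:
  fixes \<nu> :: int
  assumes P: "P > 0" and ab: "4 * a < b" and \<Omega>: "frac (real n / real P) \<in> Omega a b"
  shows "(\<Sum>i<3. (b - 2 * i * a) * n div P) + 1 \<le> card {r \<in> nodes a b n. int P dvd \<nu> - int (snd r)}"
proof -
  define N where "N = \<lfloor>real n / real P\<rfloor>"
  define y where "y = frac (real n / real P)"
  define x where "x = real_of_int (\<nu> - 1) / real P"
  have y: "y = real n / real P - real_of_int N" by (simp add: y_def N_def frac_def)
  have fl: "\<lfloor>x - real c * y\<rfloor> = (\<nu> - 1 - int (c * n)) div int P + int c * N" for c
  proof -
    have "x - real c * y = real_of_int (\<nu> - 1 - int (c * n)) / real_of_int (int P) + real_of_int (int c * N)"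
      using P by (simp add: x_def y field_simps)
    then show ?thesis by (simp only: floor_add_int[symmetric] floor_divide_of_int_eq)
  qed
  have fl2: "\<lfloor>real c * y\<rfloor> = int (c * n) div int P - int c * N" for c
  proof -
    have "real c * y = real_of_int (int (c * n)) / real_of_int (int P) - real_of_int (int c * N)"
      using P by (simp add: y field_simps)
    then show ?thesis by (simp only: floor_diff_of_int floor_divide_of_int_eq)
  qed
  have r: "real b - 2 * real a = real (b - 2 * a)" "real b - 4 * real a = real (b - 4 * a)"
      "real b - real a = real (b - a)" "2 * real a = real (2 * a)"
    using ab by auto
  have "(\<lfloor>x - 2 * real a * y\<rfloor> - \<lfloor>x - (real b - 2 * real a) * y\<rfloor> - \<lfloor>(real b - 4 * real a) * y\<rfloor>)
    + (\<lfloor>x - real a * y\<rfloor> - \<lfloor>x - (real b - real a) * y\<rfloor> - \<lfloor>(real b - 2 * real a) * y\<rfloor>)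
    + (\<lfloor>x\<rfloor> - \<lfloor>x - real b * y\<rfloor> - \<lfloor>real b * y\<rfloor>) \<ge> 1"
    using \<Omega> unfolding y_def[symmetric] Omega_def by blast
  then have ge: "1 \<le> (\<lfloor>x - real (2 * a) * y\<rfloor> - \<lfloor>x - real (b - 2 * a) * y\<rfloor> - \<lfloor>real (b - 4 * a) * y\<rfloor>)
    + (\<lfloor>x - real a * y\<rfloor> - \<lfloor>x - real (b - a) * y\<rfloor> - \<lfloor>real (b - 2 * a) * y\<rfloor>)
    + (\<lfloor>x - real 0 * y\<rfloor> - \<lfloor>x - real b * y\<rfloor> - \<lfloor>real b * y\<rfloor>)"
    by (simp only: of_nat_0 mult_zero_left diff_zero flip: r)
  have "int (2 * a) = 2 * int a" "int (b - 2 * a) = int b - 2 * int a" "int (b - 4 * a) = int b - 4 * int a"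
      "int (b - a) = int b - int a"
    using ab by auto
  note c = this
  have cN: "int (2 * a) * N = 2 * int a * N" "int (b - 2 * a) * N = int b * N - 2 * int a * N"
      "int (b - 4 * a) * N = int b * N - 4 * int a * N" "int (b - a) * N = int b * N - int a * N"
    unfolding c by (simp_all add: algebra_simps)
  have "(\<Sum>i<3. int ((b - 2 * i * a) * n) div int P) + 1
      \<le> (\<Sum>i<3. (\<nu> - 1 - int (i * a * n)) div int P - (\<nu> - 1 - int ((b - i * a) * n)) div int P)"
  proof -
    have e: "b - 2 * 0 * a = b" "b - 2 * 1 * a = b - 2 * a" "b - 2 * 2 * a = b - 4 * a"
        "0 * a * n = 0 * n" "1 * a * n = a * n" "b - 0 * a = b" "b - 1 * a = b - a"
      by simp_all
    show ?thesis
      unfolding sum_lessThan_3 e using ge unfolding fl fl2 cN by linarith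
  qed
  also have "\<dots> = int (card {r \<in> nodes a b n. int P dvd \<nu> - int (snd r)})"
    by (rule card_multiples_nodes[OF P ab, symmetric])
  finally have "(\<Sum>i<3. int ((b - 2 * i * a) * n) div int P) + 1
      \<le> int (card {r \<in> nodes a b n. int P dvd \<nu> - int (snd r)})" .
  moreover have "int (\<Sum>i<3. (b - 2 * i * a) * n div P) = (\<Sum>i<3. int ((b - 2 * i * a) * n) div int P)"
    by (simp add: zdiv_int)
  ultimately show ?thesis by linarith
qed

text \<open>At \<open>\<nu> = bn + 1\<close> all differences lie in \<open>1..bn\<close>; if
  \<open>P\<close> exceeded \<open>bn\<close> there would be no multiple at all, against the surplus
  just found. Hence only finitely many primes enter \<open>Delta\<close>, and each of them divides
  \<open>dlcm (b * n)\<close>.\<close>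

lemma Omega_imp_le:
  assumes P: "P > 0" and ab: "4 * a < b" and \<Omega>: "frac (real n / real P) \<in> Omega a b"
  shows "P \<le> b * n"
proof (rule ccontr)
  assume "\<not> ?thesis"
  then have gt: "b * n < P" by simp
  have b: "b > 0" using ab by simp
  have empty: "{r \<in> nodes a b n. int P dvd int (b * n + 1) - int (snd r)} = {}"
  proof -
    have "\<not> int P dvd int (b * n + 1) - int (snd r)" if "r \<in> nodes a b n" for r
    proof -
      have "snd r \<ge> 1" "snd r \<le> b * n"
        using that by (auto simp: nodes_def intro: order_trans[of _ "(b - _) * n"])
      then have "0 < int (b * n + 1) - int (snd r)" "int (b * n + 1) - int (snd r) < int P"
        using gt by linarith+
      then show ?thesis using zdvd_not_zless by blast
    qed
    then show ?thesis by blast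
  qed
  then show False
    using Omega_imp_card_multiples_nodes[OF assms, of "int (b * n + 1)"] unfolding empty by simp
qed

lemma Delta_pos: "Delta a b n > 0"
  unfolding Delta_def by (cases rule: prod_pos) (auto intro!: prod_pos simp: prime_gt_0_nat)

lemma dlcm_pos: "dlcm N > 0"
  unfolding dlcm_def by (metis Lcm_0_iff_nat atLeastAtMost_iff finite_atLeastAtMost gr0I not_one_le_zero)

lemma multiplicity_Delta_le:
  assumes p: "prime p" and ab: "4 * a < b"
  shows "multiplicity p (Delta a b n) \<le> (if frac (real n / real p) \<in> Omega a b then 1 else 0)"
proof -
  let ?S = "{p. prime p \<and> sqrt (real (b * n)) < real p \<and> frac (real n / real p) \<in> Omega a b}"
  \<comment> \<open>Finiteness matters: a product over an infinite set is 1 by convention.\<close>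
  have fin: "finite ?S"
    by (rule finite_subset[of _ "{..b * n}"]) (auto intro: Omega_imp_le[OF _ ab] simp: prime_gt_0_nat)
  have "multiplicity p (Delta a b n) = (\<Sum>q\<in>?S. multiplicity p q)"
    unfolding Delta_def using p fin by (subst prime_elem_multiplicity_prod_distrib) auto
  also have "\<dots> = (\<Sum>q\<in>?S. if q = p then 1 else 0)"
    using p by (intro sum.cong refl) (auto simp: prime_multiplicity_other)
  also have "\<dots> \<le> (if frac (real n / real p) \<in> Omega a b then 1 else 0)"
    using fin by auto
  finally show ?thesis .
qed

text \<open>Prime by prime and level by level: all nodes together have enough multiples of
  \<open>p^l\<close> for the factorials, with one extra at \<open>l = 1\<close> if \<open>p\<close>
  is an \<open>Omega\<close> prime. Deleting \<open>s\<close> costs at most one multiple per level,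
  hence at most \<open>L\<close> in total, and \<open>L\<close> is the exponent of \<open>p\<close>
  in the least common multiple.\<close>

lemma nodes_dvd:
  fixes \<nu> :: int
  assumes ab: "4 * a < b" and s: "s \<in> nodes a b n"
  shows "int (nodes_den a b n * Delta a b n) dvd int (dlcm (b * n)) * node_prod (nodes a b n - {s}) \<nu>"
proof (cases "node_prod (nodes a b n - {s}) \<nu> = 0")
  case False
  let ?I = "nodes a b n"
  have den0: "nodes_den a b n > 0" by (simp add: nodes_den_def prod_pos)
  have nz: "\<nu> - int (snd r) \<noteq> 0" if "r \<in> ?I - {s}" for r
    using False that by (auto simp: node_prod_def)
  show ?thesis
  proof (rule multiplicity_le_imp_dvd)
    show "int (nodes_den a b n * Delta a b n) \<noteq> 0" using den0 Delta_pos[of a b n] by simp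
    fix p' :: int assume p': "prime p'"
    define p where "p = nat p'"
    have p: "p' = int p" "prime p" using p' by (auto simp: p_def prime_ge_0_int)
    define L where "L = multiplicity p (dlcm (b * n))"
    have dl: "p ^ i dvd dlcm (b * n)" if "p ^ i \<le> b * n" for i
      unfolding dlcm_def using that p by (intro dvd_Lcm) (auto simp: prime_gt_0_nat Suc_le_eq)
    have "\<not> p ^ Suc L dvd dlcm (b * n)"
      using p dlcm_pos[of "b * n"] unfolding L_def
      by (subst power_dvd_iff_le_multiplicity) auto
    \<comment> \<open>So levels above \<open>L\<close> do not occur in any of the three
      factorials.\<close>
    then have big: "b * n < p ^ Suc L" using dl by (meson not_le)
    define w where "w = (if frac (real n / real p) \<in> Omega a b then 1 else 0 :: nat)"
    have w: "w \<le> L"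
    proof (cases "frac (real n / real p) \<in> Omega a b")
      case True
      then have "p ^ 1 dvd dlcm (b * n)"
        using Omega_imp_le[OF _ ab True] p by (intro dl) (auto simp: prime_gt_0_nat)
      then have "1 \<le> L" using p dlcm_pos[of "b * n"] unfolding L_def
        by (subst (asm) power_dvd_iff_le_multiplicity) auto
      then show ?thesis by (simp add: w_def)
    qed (simp add: w_def)
    have cnt: "(\<Sum>i<3. (b - 2 * i * a) * n div p ^ l) + (if l = 1 then w else 0)
        \<le> card {r \<in> ?I - {s}. int p ^ l dvd \<nu> - int (snd r)} + 1" for l
    proof -
      have pl: "p ^ l > 0" using p by (simp add: prime_gt_0_nat)
      have "(\<Sum>i<3. (b - 2 * i * a) * n div p ^ l) + (if l = 1 then w else 0)
          \<le> card {r \<in> ?I. int (p ^ l) dvd \<nu> - int (snd r)}"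
        using card_multiples_nodes_ge[OF pl ab] Omega_imp_card_multiples_nodes[OF _ ab, of p n] p
        by (auto simp: w_def prime_gt_0_nat)
      also have "\<dots> \<le> card (insert s {r \<in> ?I - {s}. int p ^ l dvd \<nu> - int (snd r)})"
        by (intro card_mono) auto
      also have "\<dots> \<le> card {r \<in> ?I - {s}. int p ^ l dvd \<nu> - int (snd r)} + 1"
        by (simp add: card_insert_if)
      finally show ?thesis .
    qed
    have "multiplicity p (nodes_den a b n) = (\<Sum>i<3. multiplicity p (fact ((b - 2 * i * a) * n)))"
      unfolding nodes_den_def using p by (subst prime_elem_multiplicity_prod_distrib) auto
    also have "\<dots> \<le> (\<Sum>i<3. \<Sum>l=1..L. (b - 2 * i * a) * n div p ^ l)"
      using p by (intro sum_mono multiplicity_fact_le le_less_trans[OF _ big]) auto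
    also have "\<dots> = (\<Sum>l=1..L. \<Sum>i<3. (b - 2 * i * a) * n div p ^ l)" by (rule sum.swap)
    finally have den: "multiplicity p (nodes_den a b n) \<le> (\<Sum>l=1..L. \<Sum>i<3. (b - 2 * i * a) * n div p ^ l)" .
    have "multiplicity p' (int (nodes_den a b n * Delta a b n)) = multiplicity p (nodes_den a b n * Delta a b n)"
      unfolding p by (rule multiplicity_int)
    also have "\<dots> = multiplicity p (nodes_den a b n) + multiplicity p (Delta a b n)"
      using p den0 Delta_pos[of a b n] by (subst prime_elem_multiplicity_mult_distrib) auto
    also have "\<dots> \<le> (\<Sum>l=1..L. \<Sum>i<3. (b - 2 * i * a) * n div p ^ l) + w"
      using den multiplicity_Delta_le[OF p(2) ab, of n] by (simp add: w_def)
    also have "\<dots> = (\<Sum>l=1..L. (\<Sum>i<3. (b - 2 * i * a) * n div p ^ l) + (if l = 1 then w else 0))"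
      using w by (cases "L = 0") (auto simp: sum.distrib)
    also have "\<dots> \<le> (\<Sum>l=1..L. card {r \<in> ?I - {s}. int p ^ l dvd \<nu> - int (snd r)} + 1)"
      by (intro sum_mono cnt)
    also have "\<dots> = (\<Sum>l=1..L. card {r \<in> ?I - {s}. int p ^ l dvd \<nu> - int (snd r)}) + L"
      unfolding sum.distrib by simp
    also have "\<dots> \<le> multiplicity (int p) (node_prod (?I - {s}) \<nu>) + multiplicity (int p) (int (dlcm (b * n)))"
      unfolding node_prod_def L_def multiplicity_int using p nz
      by (intro add_mono multiplicity_prod_ge) auto
    also have "\<dots> = multiplicity p' (int (dlcm (b * n)) * node_prod (?I - {s}) \<nu>)"
      using p False dlcm_pos[of "b * n"] by (subst prime_elem_multiplicity_mult_distrib) auto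
    finally show "multiplicity p' (int (nodes_den a b n * Delta a b n))
        \<le> multiplicity p' (int (dlcm (b * n)) * node_prod (?I - {s}) \<nu>)" .
  qed
qed simp

section \<open>Sums of derivatives as contour integrals\<close>

lemma sin_pi_eq_0_complex: "sin (of_real pi * z) = 0 \<longleftrightarrow> z \<in> \<int>" for z :: complex
proof -
  have "sin (of_real pi * z) = 0 \<longleftrightarrow> (\<exists>n::int. of_real pi * z = of_real pi * of_int n)"
    by (subst sin_eq_0) (simp add: mult.commute)
  also have "\<dots> \<longleftrightarrow> z \<in> \<int>"
    by (auto simp: Ints_def)
  finally show ?thesis .
qed

lemma residue_times_cot:
  fixes F :: "complex \<Rightarrow> complex" and \<nu> :: nat
  assumes F: "F holomorphic_on UNIV"
  shows "residue (\<lambda>z. F z * (of_real pi * cos (of_real pi * z) / sin (of_real pi * z))) (of_nat \<nu>) = F (of_nat \<nu>)"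
proof (rule residue_simple'[of "ball (of_nat \<nu>) 1"])
  let ?n = "of_nat \<nu> :: complex"
  have "z \<notin> \<int>" if "z \<in> ball ?n 1 - {?n}" for z
  proof
    assume "z \<in> \<int>"
    then obtain m where m: "z = of_int m" by (auto elim: Ints_cases)
    have "dist ?n z = \<bar>real_of_int (int \<nu> - m)\<bar>"
      unfolding m dist_norm by (metis norm_of_int of_int_diff of_int_of_nat_eq)
    then have "int \<nu> = m" using that by auto
    then show False using that m by auto
  qed
  then show "(\<lambda>z. F z * (of_real pi * cos (of_real pi * z) / sin (of_real pi * z))) holomorphic_on ball ?n 1 - {?n}"
    using holomorphic_on_subset[OF F] by (intro holomorphic_intros) (auto simp: sin_pi_eq_0_complex)
  have c: "cos (of_real pi * ?n) \<noteq> 0"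
    using cos_int_times_real[of "int \<nu>"] sin_pi_eq_0_complex[of ?n] sin_squared_eq[of "of_real pi * ?n"]
    by (auto simp: Ints_of_nat)
  have "((\<lambda>z. sin (of_real pi * z)) has_field_derivative (of_real pi * cos (of_real pi * ?n))) (at ?n)"
    by (auto intro!: derivative_eq_intros)
  then have "((\<lambda>z. (sin (of_real pi * z) - sin (of_real pi * ?n)) / (z - ?n)) \<longlongrightarrow> of_real pi * cos (of_real pi * ?n)) (at ?n)"
    by (simp add: has_field_derivative_iff)
  moreover have "sin (of_real pi * ?n) = 0" by (simp add: sin_pi_eq_0_complex)
  ultimately have lim: "((\<lambda>z. sin (of_real pi * z) / (z - ?n)) \<longlongrightarrow> of_real pi * cos (of_real pi * ?n)) (at ?n)"
    by simp
  have "isCont F ?n"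
    using F by (metis UNIV_I continuous_on_eq_continuous_at holomorphic_on_imp_continuous_on open_UNIV)
  then have limF: "(F \<longlongrightarrow> F ?n) (at ?n)" by (simp add: isCont_def)
  have "((\<lambda>z. F z * (of_real pi * cos (of_real pi * z)) / (sin (of_real pi * z) / (z - ?n))) \<longlongrightarrow>
      F ?n * (of_real pi * cos (of_real pi * ?n)) / (of_real pi * cos (of_real pi * ?n))) (at ?n)"
    by (intro tendsto_divide[OF tendsto_mult[OF limF] lim] tendsto_intros) (use c in auto)
  then show "((\<lambda>z. F z * (of_real pi * cos (of_real pi * z) / sin (of_real pi * z)) * (z - ?n)) \<longlongrightarrow> F ?n) (at ?n)"
    using c by simp
qed auto

text \<open>The double poles are avoided: \<open>- f(z) pi cot (pi z)\<close> is a primitive of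
  \<open>f (pi/sin)^2 - f' pi cot\<close>, so on a closed path both integrands have the same
  integral, and the second one has only simple poles, with residues \<open>f'(\<nu>)\<close>. The
  vertical sides run half-way between integers.\<close>

lemma contour_integral_rectpath_csc2:
  fixes f :: "complex \<Rightarrow> complex" and k M :: nat
  defines "lo \<equiv> Complex (real k - 1/2) (- real M)" and "hi \<equiv> Complex (real (k + M) - 1/2) (real M)"
  assumes f: "f holomorphic_on UNIV" and M: "M \<ge> 1"
  shows "contour_integral (rectpath lo hi) (\<lambda>z. f z * (of_real pi / sin (of_real pi * z))\<^sup>2)
           = 2 * of_real pi * \<i> * (\<Sum>\<nu>\<in>{k..<k+M}. deriv f (of_nat \<nu>))"
    and "path_image (rectpath lo hi) \<inter> \<int> = {}"
proof -
  define S where "S = {z. real k - 3/4 < Re z \<and> Re z < real (k + M) - 1/4}"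
  define pts where "pts = (of_nat ` {k..<k+M} :: complex set)"
  have "S = {z. real k - 3/4 < Re z} \<inter> {z. Re z < real (k + M) - 1/4}" by (auto simp: S_def)
  then have S: "open S" "convex S"
    by (auto intro!: open_Int open_halfspace_Re_gt open_halfspace_Re_lt convex_Int convex_halfspace_Re_gt convex_halfspace_Re_lt)
  have le: "Re lo < Re hi" "Im lo < Im hi" using M by (auto simp: lo_def hi_def)
  have cS: "cbox lo hi \<subseteq> S" by (auto simp: lo_def hi_def S_def in_cbox_complex_iff)
  have int: "z \<in> pts" if zS: "z \<in> S" and zZ: "z \<in> \<int>" for z
  proof -
    obtain m where m: "z = of_int m" using zZ by (auto elim: Ints_cases)
    have "real k - 3/4 < real_of_int m" "real_of_int m < real (k + M) - 1/4"
      using zS by (auto simp: S_def m)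
    then have "int k \<le> m" "m < int (k + M)" by linarith+
    then have "m = int (nat m)" "nat m \<in> {k..<k+M}" by auto
    then show ?thesis unfolding pts_def m by (metis image_eqI of_int_of_nat_eq)
  qed
  have pb: "z \<in> box lo hi" if "z \<in> pts" for z
    using that M by (auto simp: pts_def in_box_complex_iff lo_def hi_def)
  have ptS: "pts \<subseteq> S" by (auto simp: pts_def S_def)
  have img: "path_image (rectpath lo hi) \<subseteq> S - pts"
    using path_image_rectpath_cbox_minus_box[of lo hi] le pb cS by auto
  then show "path_image (rectpath lo hi) \<inter> \<int> = {}" using int by blast
  have ns: "sin (of_real pi * z) \<noteq> 0" if "z \<in> S - pts" for z
    using that int by (auto simp: sin_pi_eq_0_complex)
  let ?F = "\<lambda>z. deriv f z * (of_real pi * cos (of_real pi * z) / sin (of_real pi * z))"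
  let ?G = "\<lambda>z. - (of_real pi * f z * cos (of_real pi * z) / sin (of_real pi * z))"
  let ?g = "\<lambda>z. f z * (of_real pi / sin (of_real pi * z))\<^sup>2"
  have df: "deriv f holomorphic_on UNIV" using f by (intro holomorphic_deriv) auto
  have hF: "?F holomorphic_on S - pts"
  proof -
    have "deriv f holomorphic_on S - pts" by (rule holomorphic_on_subset[OF df]) simp
    moreover have "(\<lambda>z. of_real pi * cos (of_real pi * z) / sin (of_real pi * z)) holomorphic_on S - pts"
      using ns by (intro holomorphic_intros)
    ultimately show ?thesis by (rule holomorphic_on_mult)
  qed
  have hg: "?g holomorphic_on S - pts"
    using holomorphic_on_subset[OF f] ns by (intro holomorphic_intros) auto
  have opn: "open (S - pts)" using S by (intro open_Diff finite_imp_closed) (auto simp: pts_def)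
  have "(?G has_field_derivative ?g z - ?F z) (at z)" if z: "z \<in> S - pts" for z
  proof -
    have fd: "(f has_field_derivative deriv f z) (at z)"
      using f by (intro holomorphic_derivI) auto
    define p S' C' where "p = (of_real pi :: complex)" and "S' = sin (p * z)" and "C' = cos (p * z)"
    have S': "S' \<noteq> 0" and sc: "S'\<^sup>2 + C'\<^sup>2 = 1"
      using ns[OF z] by (simp_all add: p_def S'_def C'_def)
    have "- ((p * deriv f z * C' - p * f z * (p * S')) * S' - p * f z * C' * (p * C')) = p\<^sup>2 * f z - p * deriv f z * C' * S'"
      using sc by algebra
    then have "- ((p * deriv f z * C' - p * f z * (p * S')) * S' - p * f z * C' * (p * C')) / (S' * S') = ?g z - ?F z"
      using S' by (simp add: field_simps power2_eq_square flip: p_def S'_def C'_def)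
    moreover have "(?G has_field_derivative
        - ((p * deriv f z * C' - p * f z * (p * S')) * S' - p * f z * C' * (p * C')) / (S' * S')) (at z)"
      unfolding p_def[symmetric]
    proof (rule DERIV_cong)
      have dS: "((\<lambda>z. sin (p * z)) has_field_derivative C' * p) (at z)"
        by (auto intro!: derivative_eq_intros simp: C'_def)
      have dC: "((\<lambda>z. cos (p * z)) has_field_derivative - S' * p) (at z)"
        by (auto intro!: derivative_eq_intros simp: S'_def)
      show "((\<lambda>z. - (p * f z * cos (p * z) / sin (p * z))) has_field_derivative
          - (((p * deriv f z * cos (p * z) + - S' * p * (p * f z)) * sin (p * z) - p * f z * cos (p * z) * (C' * p))
             / (sin (p * z) * sin (p * z)))) (at z)"
        using S' by (intro DERIV_minus DERIV_divide DERIV_mult DERIV_cmult fd dS dC) (simp add: S'_def)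
    qed (simp add: mult_ac minus_divide_left flip: S'_def C'_def)
    ultimately show ?thesis by simp
  qed
  then have "((\<lambda>z. ?g z - ?F z) has_contour_integral
      (?G (pathfinish (rectpath lo hi)) - ?G (pathstart (rectpath lo hi)))) (rectpath lo hi)"
    by (intro contour_integral_primitive[where S = "S - pts"] img)
       (auto intro: has_field_derivative_at_within)
  then have zero: "((\<lambda>z. ?g z - ?F z) has_contour_integral 0) (rectpath lo hi)" by simp
  have iF: "?F contour_integrable_on (rectpath lo hi)"
    by (rule contour_integrable_holomorphic_simple[OF hF opn _ img]) simp
  have ig: "?g contour_integrable_on (rectpath lo hi)"
    by (rule contour_integrable_holomorphic_simple[OF hg opn _ img]) simp
  have "contour_integral (rectpath lo hi) ?g = contour_integral (rectpath lo hi) ?F"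
    using contour_integral_unique[OF zero] contour_integral_diff[OF ig iF] by simp
  also have "\<dots> = 2 * pi * \<i> * (\<Sum>p\<in>pts. winding_number (rectpath lo hi) p * residue ?F p)"
  proof (rule Residue_theorem[OF S(1) _ _ hF _ _ img])
    show "connected S" using S by (simp add: convex_connected)
    show "\<forall>z. z \<notin> S \<longrightarrow> winding_number (rectpath lo hi) z = 0"
      using cS le by (auto intro!: winding_number_rectpath_outside)
  qed (auto simp: pts_def)
  also have "(\<Sum>p\<in>pts. winding_number (rectpath lo hi) p * residue ?F p) = (\<Sum>\<nu>\<in>{k..<k+M}. deriv f (of_nat \<nu>))"
  proof -
    have "winding_number (rectpath lo hi) p * residue ?F p = deriv f p" if p: "p \<in> pts" for p
    proof -
      obtain \<nu> where \<nu>: "p = of_nat \<nu>" using p by (auto simp: pts_def)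
      show ?thesis
        unfolding winding_number_rectpath[OF pb[OF p]] unfolding \<nu> residue_times_cot[OF df] by simp
    qed
    then have "(\<Sum>p\<in>pts. winding_number (rectpath lo hi) p * residue ?F p) = (\<Sum>p\<in>pts. deriv f p)"
      by (intro sum.cong refl)
    then show ?thesis unfolding pts_def by (simp add: sum.reindex inj_on_def)
  qed
  finally show "contour_integral (rectpath lo hi) ?g
      = 2 * of_real pi * \<i> * (\<Sum>\<nu>\<in>{k..<k+M}. deriv f (of_nat \<nu>))" by simp
qed

text \<open>On these lines the squared modulus of the sine is \<open>cosh^2 (pi Im z)\<close>,
  written below as \<open>(u + 1/u + 2)/4\<close> with \<open>u = exp (2 pi Im z)\<close>.\<close>

lemma norm_sin_half_integer:
  fixes k :: nat
  assumes "Re z = real k - 1/2"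
  shows "exp (2 * pi * \<bar>Im z\<bar>) / 4 \<le> (norm (sin (of_real pi * z)))\<^sup>2" "1 \<le> (norm (sin (of_real pi * z)))\<^sup>2"
proof -
  define u where "u = exp (2 * (pi * Im z))"
  have u: "u > 0" by (simp add: u_def)
  have "cos (2 * (pi * Re z)) = cos (- pi + 2 * pi * real k)"
    unfolding assms by (intro arg_cong[of _ _ cos]) (simp add: algebra_simps)
  also have "\<dots> = -1" using cos_2npi[of k] by (simp add: cos_add mult_ac)
  finally have eq: "(norm (sin (of_real pi * z)))\<^sup>2 = (u + inverse u + 2) / 4"
    by (simp add: norm_sin_squared u_def)
  have "u + inverse u \<ge> 2"
  proof -
    have "u + inverse u - 2 = (u - 1)\<^sup>2 / u" using u by (simp add: field_simps power2_eq_square)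
    also have "\<dots> \<ge> 0" using u by simp
    finally show ?thesis by simp
  qed
  then show "1 \<le> (norm (sin (of_real pi * z)))\<^sup>2" unfolding eq by simp
  have "exp (2 * pi * \<bar>Im z\<bar>) \<le> u + inverse u"
    using u by (cases "Im z \<ge> 0") (auto simp: u_def mult_ac simp flip: exp_minus)
  then show "exp (2 * pi * \<bar>Im z\<bar>) / 4 \<le> (norm (sin (of_real pi * z)))\<^sup>2" unfolding eq by simp
qed

text \<open>Far from the true size \<open>exp (2 pi M)\<close>, but exponential decay of any rate
  beats the polynomial growth of \<open>f\<close> on horizontal sides of length
  \<open>M\<close>.\<close>

lemma norm_sin_large_Im:
  assumes "\<bar>Im z\<bar> = real M" "M \<ge> 1"
  shows "exp (real M) / 4 \<le> (norm (sin (of_real pi * z)))\<^sup>2"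
proof -
  define u where "u = exp (2 * (pi * Im z))"
  have u: "u > 0" by (simp add: u_def)
  have "exp (real M) * exp (real M) = exp (2 * real M)" by (simp flip: exp_add)
  also have "\<dots> \<le> exp (2 * pi * real M)"
    using pi_gt3 by (simp add: mult_right_mono)
  also have "\<dots> \<le> u + inverse u"
  proof -
    have "Im z = real M \<or> Im z = - real M" using assms(1) by linarith
    then show ?thesis by (auto simp: u_def mult_ac simp flip: exp_minus)
  qed
  finally have "exp (real M) * exp (real M) \<le> u + inverse u" .
  moreover have "exp (real M) \<ge> 2" using exp_ge_add_one_self[of "real M"] assms by linarith
  then have "exp (real M) * 2 \<le> exp (real M) * exp (real M)" by (intro mult_left_mono) auto
  ultimately have "exp (real M) \<le> u + inverse u - 2" using \<open>exp (real M) \<ge> 2\<close> by linarith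
  moreover have "cos (2 * (pi * Re z)) \<le> 1" by simp
  ultimately have "exp (real M) \<le> u + inverse u - 2 * cos (2 * (pi * Re z))" by linarith
  moreover have "(norm (sin (of_real pi * z)))\<^sup>2 = (u + inverse u - 2 * cos (2 * (pi * Re z))) / 4"
    by (simp add: norm_sin_squared u_def)
  ultimately show ?thesis by simp
qed

lemma power_times_geometric_LIMSEQ_0:
  fixes r c :: real
  assumes "0 < r" "r < 1"
  shows "(\<lambda>M. (c + 2 * real M) ^ D * real M * r ^ M) \<longlonglongrightarrow> 0"
proof -
  define l where "l = - ln r"
  have l: "l > 0" "r = exp (- l)" using assms by (auto simp: l_def)
  have "(\<lambda>M. (c + 2 * real M) ^ D * real M * exp (- l * real M)) \<longlonglongrightarrow> 0"
    using l(1) by real_asymp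
  then show ?thesis unfolding l(2) by (simp add: exp_of_nat_mult[symmetric] mult_ac)
qed

text \<open>Letting the rectangle grow to the right and vertically leaves only its left side. There
  the hypothesis on \<open>f\<close> cancels the size of the squared sine, and the integral of
  \<open>1/(1 + y^2)\<close> supplies a factor \<open>pi\<close>: at most \<open>4 pi^3 A\<close>,
  divided by the \<open>2 pi\<close> of the residue theorem.\<close>

lemma norm_suminf_deriv_le:
  fixes f :: "complex \<Rightarrow> complex" and k D :: nat and x K A :: real
  assumes f: "f holomorphic_on UNIV" and k: "k \<ge> 1" and x: "0 < x" "x < 1" and A: "A \<ge> 0" and K: "K \<ge> 0"
    and growth: "\<And>z. Re z \<ge> real k - 1/2 \<Longrightarrow> norm (f z) \<le> K * (1 + norm z) ^ D * x powr (Re z)"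
    and bound: "\<And>y. norm (f (Complex (real k - 1/2) y)) \<le> A * exp (2 * pi * \<bar>y\<bar>) / (1 + y\<^sup>2)"
    and sums: "(\<lambda>\<nu>. deriv f (of_nat (k + \<nu>))) sums s"
  shows "norm s \<le> 2 * pi\<^sup>2 * A"
proof -
  let ?g = "\<lambda>z. f z * (of_real pi / sin (of_real pi * z))\<^sup>2"
  \<comment> \<open>First summand: both horizontal sides, small through the sine. Second summand:
    the right side, small through \<open>x^M\<close>. On the rectangle \<open>1 + |z|\<close> is at
    most \<open>k + 1 + 2M\<close>.\<close>
  define err where "err M = 8 * pi\<^sup>2 * K * ((real k + 1 + 2 * real M) ^ D * real M * exp (-1) ^ M)
      + 2 * pi\<^sup>2 * K * ((real k + 1 + 2 * real M) ^ D * real M * x ^ M)" for M :: nat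
  have main: "norm (2 * of_real pi * \<i> * (\<Sum>\<nu>\<in>{k..<k+M}. deriv f (of_nat \<nu>))) \<le> 4 * pi ^ 3 * A + err M"
    if M: "M \<ge> 1" for M
  proof -
    define c1 c2 where "c1 = real k - 1/2" and "c2 = real (k + M) - 1/2"
    define z1 z2 z3 z4 where "z1 = Complex c1 (- real M)" and "z2 = Complex c2 (- real M)"
      and "z3 = Complex c2 (real M)" and "z4 = Complex c1 (real M)"
    define Q where "Q = K * (real k + 1 + 2 * real M) ^ D"
    have Q: "Q \<ge> 0" using K by (simp add: Q_def)
    note rect = contour_integral_rectpath_csc2[OF f M, of k, folded c1_def c2_def, folded z1_def z3_def]
    have rp: "rectpath z1 z3 = linepath z1 z2 +++ linepath z2 z3 +++ linepath z3 z4 +++ linepath z4 z1"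
      by (simp add: rectpath_def Let_def z1_def z2_def z3_def z4_def)
    have segs: "closed_segment z1 z2 \<union> closed_segment z2 z3 \<union> closed_segment z3 z4 \<union> closed_segment z4 z1 = path_image (rectpath z1 z3)"
      unfolding rp by (simp add: path_image_join Un_assoc)
    have cont: "continuous_on (path_image (rectpath z1 z3)) ?g"
    proof -
      have "sin (of_real pi * z) \<noteq> 0" if "z \<in> path_image (rectpath z1 z3)" for z
        using that rect(2) by (auto simp: sin_pi_eq_0_complex)
      then show ?thesis
        using continuous_on_subset[OF holomorphic_on_imp_continuous_on[OF f]]
        by (intro continuous_intros) auto
    qed
    have int: "?g contour_integrable_on linepath z1 z2" "?g contour_integrable_on linepath z2 z3"
        "?g contour_integrable_on linepath z3 z4" "?g contour_integrable_on linepath z4 z1"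
      using segs by (auto intro!: contour_integrable_continuous_linepath continuous_on_subset[OF cont])
    have eq: "contour_integral (rectpath z1 z3) ?g = contour_integral (linepath z1 z2) ?g
        + (contour_integral (linepath z2 z3) ?g + (contour_integral (linepath z3 z4) ?g + contour_integral (linepath z4 z1) ?g))"
      unfolding rp using int by (simp add: contour_integrable_join)
    have fb: "norm (f z) \<le> Q * x powr Re z" if "c1 \<le> Re z" "Re z \<le> c2" "\<bar>Im z\<bar> \<le> real M" for z
    proof -
      have "norm z \<le> \<bar>Re z\<bar> + \<bar>Im z\<bar>" by (rule cmod_le)
      also have "\<dots> \<le> real k + 2 * real M" using that k by (simp add: c1_def c2_def)
      finally have "(1 + norm z) ^ D \<le> (real k + 1 + 2 * real M) ^ D" by (intro power_mono) auto
      then have "K * (1 + norm z) ^ D * x powr Re z \<le> Q * x powr Re z"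
        unfolding Q_def using K by (intro mult_right_mono mult_left_mono) auto
      then show ?thesis using growth[of z] that by (simp add: c1_def)
    qed
    have gn: "norm (?g z) = norm (f z) * (pi\<^sup>2 / (norm (sin (of_real pi * z)))\<^sup>2)" for z
      by (simp add: norm_mult norm_power norm_divide power_divide)
    have gb: "norm (?g z) \<le> F * (pi\<^sup>2 / B)" if "norm (f z) \<le> F" "0 < B" "B \<le> (norm (sin (of_real pi * z)))\<^sup>2" for z F B
      unfolding gn using that order_trans[OF norm_ge_zero that(1)]
      by (intro mult_mono divide_left_mono mult_pos_pos) auto
    have horiz: "norm (?g z) \<le> Q * (pi\<^sup>2 / (exp (real M) / 4))" if "c1 \<le> Re z" "Re z \<le> c2" "\<bar>Im z\<bar> = real M" for z
    proof (rule gb)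
      have "x powr Re z \<le> 1" using x that k powr_mono'[of 0 "Re z" x] by (simp add: c1_def)
      then have "Q * x powr Re z \<le> Q" using Q by (simp add: mult_left_le)
      then show "norm (f z) \<le> Q" using fb[of z] that by linarith
    qed (use norm_sin_large_Im[OF that(3) M] in auto)
    have seg: "norm (contour_integral (linepath u v) ?g) \<le> 4 * pi\<^sup>2 * (Q * (real M * exp (-1) ^ M))"
      if int: "?g contour_integrable_on linepath u v" and im: "Im u = Im v" "\<bar>Im u\<bar> = real M"
        and re: "Re u = c1 \<and> Re v = c2 \<or> Re u = c2 \<and> Re v = c1" for u v
    proof -
      have "norm (contour_integral (linepath u v) ?g) \<le> Q * (pi\<^sup>2 / (exp (real M) / 4)) * norm (v - u)"
      proof (rule contour_integral_bound_linepath[OF int])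
        fix z assume "z \<in> closed_segment u v"
        then have "c1 \<le> Re z" "Re z \<le> c2" "\<bar>Im z\<bar> = real M"
          using M im re by (auto simp: closed_segment_same_Im[OF im(1)] c1_def c2_def closed_segment_eq_real_ivl)
        then show "norm (?g z) \<le> Q * (pi\<^sup>2 / (exp (real M) / 4))" by (rule horiz)
      qed (use Q in auto)
      moreover have "norm (v - u) = real M" using im re by (auto simp: cmod_def c1_def c2_def)
      ultimately show ?thesis
        by (simp add: exp_of_nat_mult[symmetric] exp_minus field_simps)
    qed
    have s1: "norm (contour_integral (linepath z1 z2) ?g) \<le> 4 * pi\<^sup>2 * (Q * (real M * exp (-1) ^ M))"
      and s3: "norm (contour_integral (linepath z3 z4) ?g) \<le> 4 * pi\<^sup>2 * (Q * (real M * exp (-1) ^ M))"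
      by (rule seg[OF int(1)] seg[OF int(3)]; simp add: z1_def z2_def z3_def z4_def)+
    have "norm (contour_integral (linepath z2 z3) ?g) \<le> Q * x ^ M * (pi\<^sup>2 / 1) * norm (z3 - z2)"
    proof (rule contour_integral_bound_linepath[OF int(2)])
      fix z assume "z \<in> closed_segment z2 z3"
      then have z: "Re z = c2" "\<bar>Im z\<bar> \<le> real M"
        by (auto simp: z2_def z3_def closed_segment_same_Re closed_segment_eq_real_ivl)
      show "norm (?g z) \<le> Q * x ^ M * (pi\<^sup>2 / 1)"
      proof (rule gb)
        have "x powr c2 \<le> x powr real M" using x k by (intro powr_mono') (auto simp: c2_def)
        then have "Q * x powr c2 \<le> Q * x ^ M" using Q x by (intro mult_left_mono) (simp_all add: powr_realpow)
        moreover have "norm (f z) \<le> Q * x powr c2" using fb[of z] z by (simp add: c1_def c2_def)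
        ultimately show "norm (f z) \<le> Q * x ^ M" by linarith
      qed (use norm_sin_half_integer(2)[of z "k + M"] z in \<open>auto simp: c2_def\<close>)
    qed (use Q x in auto)
    moreover have "norm (z3 - z2) = 2 * real M"
    proof -
      have "z3 - z2 = of_real (2 * real M) * \<i>" by (simp add: z3_def z2_def complex_eq_iff)
      then show ?thesis by (simp only: norm_mult norm_of_real) simp
    qed
    ultimately have s2: "norm (contour_integral (linepath z2 z3) ?g) \<le> 2 * pi\<^sup>2 * (Q * (real M * x ^ M))"
      by (simp add: mult_ac)
    have s4: "norm (contour_integral (linepath z4 z1) ?g) \<le> 4 * pi ^ 3 * A"
    proof -
      \<comment> \<open>What remains of the integrand after \<open>exp (2 pi |y|)\<close> has
        cancelled; its primitive is an arctangent, bounded independently of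
        \<open>M\<close>.\<close>
      let ?u = "\<lambda>y. 4 * pi\<^sup>2 * A * (1 / (1 + y\<^sup>2))"
      have c: "continuous_on (closed_segment z4 z1) ?g" using segs by (auto intro: continuous_on_subset[OF cont])
      have "contour_integral (linepath z4 z1) ?g = - contour_integral (linepath z1 z4) ?g"
        using contour_integral_reverse_linepath[OF c] .
      moreover have "contour_integral (linepath z1 z4) ?g = \<i> * integral {- real M..real M} (\<lambda>y. ?g (Complex c1 y))"
        using M by (intro contour_integral_linepath_same_Re) (auto simp: z1_def z4_def)
      moreover have "norm (integral {- real M..real M} (\<lambda>y. ?g (Complex c1 y))) \<le> integral {- real M..real M} ?u"
      proof (rule integral_norm_bound_integral)
        have "Complex c1 ` {- real M..real M} \<subseteq> closed_segment z4 z1"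
          by (auto simp: z1_def z4_def closed_segment_same_Re closed_segment_eq_real_ivl)
        then have "continuous_on {- real M..real M} (\<lambda>y. ?g (Complex c1 y))"
          by (intro continuous_on_compose2[OF c]) (auto intro!: continuous_intros)
        then show "(\<lambda>y. ?g (Complex c1 y)) integrable_on {- real M..real M}"
          by (rule integrable_continuous_real)
        show "?u integrable_on {- real M..real M}"
          by (intro integrable_continuous_real continuous_intros) (auto simp: add_nonneg_eq_0_iff)
        fix y assume "y \<in> {- real M..real M}"
        have "norm (?g (Complex c1 y)) \<le> A * exp (2 * pi * \<bar>y\<bar>) / (1 + y\<^sup>2) * (pi\<^sup>2 / (exp (2 * pi * \<bar>y\<bar>) / 4))"
          using norm_sin_half_integer(1)[of "Complex c1 y" k] bound[of y]
          by (intro gb) (auto simp: c1_def)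
        also have "\<dots> = ?u y"
        proof -
          have "A * e / q * (p / (e / 4)) = 4 * p * A * (1 / q)" if "e \<noteq> 0" for e q p :: real
            using that by (simp add: field_simps)
          then show ?thesis by simp
        qed
        finally show "norm (?g (Complex c1 y)) \<le> ?u y" .
      qed
      moreover have "(?u has_integral (4 * pi\<^sup>2 * A * arctan (real M) - 4 * pi\<^sup>2 * A * arctan (- real M))) {- real M..real M}"
      proof (rule fundamental_theorem_of_calculus)
        fix y :: real assume "y \<in> {- real M..real M}"
        show "((\<lambda>y. 4 * pi\<^sup>2 * A * arctan y) has_vector_derivative ?u y) (at y within {- real M..real M})"
          unfolding has_real_derivative_iff_has_vector_derivative[symmetric]
          by (auto intro!: derivative_eq_intros simp: field_simps)
      qed simp
      then have "integral {- real M..real M} ?u = 4 * pi\<^sup>2 * A * (2 * arctan (real M))"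
        by (simp add: integral_unique arctan_minus)
      moreover have "4 * pi\<^sup>2 * A * (2 * arctan (real M)) \<le> 4 * pi\<^sup>2 * A * pi"
        using arctan_ubound[of "real M"] A by (intro mult_left_mono) auto
      ultimately show ?thesis by (simp add: norm_mult power2_eq_square power3_eq_cube mult_ac)
    qed
    have "norm (contour_integral (rectpath z1 z3) ?g) \<le> 4 * pi\<^sup>2 * (Q * (real M * exp (-1) ^ M))
        + (2 * pi\<^sup>2 * (Q * (real M * x ^ M)) + (4 * pi\<^sup>2 * (Q * (real M * exp (-1) ^ M)) + 4 * pi ^ 3 * A))"
      unfolding eq using s1 s2 s3 s4 by (intro norm_triangle_mono) auto
    then show ?thesis unfolding rect(1) by (simp add: err_def Q_def algebra_simps)
  qed
  have "err \<longlonglongrightarrow> 8 * pi\<^sup>2 * K * 0 + 2 * pi\<^sup>2 * K * 0"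
    unfolding err_def using x by (intro tendsto_add tendsto_mult tendsto_const power_times_geometric_LIMSEQ_0) auto
  then have L1: "(\<lambda>M. 4 * pi ^ 3 * A + err M) \<longlonglongrightarrow> 4 * pi ^ 3 * A + 0"
    by (intro tendsto_add tendsto_const) simp
  have "(\<lambda>M. \<Sum>\<nu>\<in>{k..<k+M}. deriv f (of_nat \<nu>)) \<longlonglongrightarrow> s"
  proof -
    have "(\<Sum>\<nu>\<in>{k..<k+M}. deriv f (of_nat \<nu>)) = (\<Sum>\<nu><M. deriv f (of_nat (k + \<nu>)))" for M
      using sum.shift_bounds_nat_ivl[of "\<lambda>\<nu>. deriv f (of_nat \<nu>)" 0 k M]
      by (simp add: atLeast0LessThan add.commute)
    then show ?thesis using sums by (simp add: sums_def)
  qed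
  then have L2: "(\<lambda>M. norm (2 * of_real pi * \<i> * (\<Sum>\<nu>\<in>{k..<k+M}. deriv f (of_nat \<nu>)))) \<longlonglongrightarrow> norm (2 * of_real pi * \<i> * s)"
    by (intro tendsto_norm tendsto_mult tendsto_const)
  have "norm (2 * of_real pi * \<i> * s) \<le> 4 * pi ^ 3 * A + 0"
    by (rule LIMSEQ_le[OF L2 L1]) (use main in blast)
  then have "2 * pi * norm s \<le> 2 * pi * (2 * pi\<^sup>2 * A)"
    by (simp add: norm_mult power3_eq_cube power2_eq_square mult_ac)
  then show ?thesis by (simp add: mult_ac)
qed

section \<open>Products of linear factors on vertical lines\<close>

text \<open>For \<open>y > 0\<close> and \<open>s = u + i y\<close> this is
  \<open>Re (s log s) + pi y / 2\<close>. The added term makes it odd in \<open>u\<close>; its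
  \<open>u\<close>-derivative is \<open>ln |s| + 1\<close>, so sums of logarithms of linear factors
  are compared with its increments.\<close>

definition lnprim :: "real \<Rightarrow> real \<Rightarrow> real" where
  "lnprim u y = u / 2 * ln (u\<^sup>2 + y\<^sup>2) + y * arctan (u / y)"

lemma sum_squares_pos: "y > 0 \<Longrightarrow> u\<^sup>2 + y\<^sup>2 > (0::real)"
  by (simp add: add_nonneg_pos)

lemma has_real_derivative_lnprim_1:
  assumes y: "y > 0"
  shows "((\<lambda>u. lnprim u y) has_real_derivative ln (u\<^sup>2 + y\<^sup>2) / 2 + 1) (at u)"
proof -
  note pos = sum_squares_pos[OF y, of u]
  have "((\<lambda>u. lnprim u y) has_real_derivative
      1 / 2 * ln (u\<^sup>2 + y\<^sup>2) + u / 2 * (2 * u / (u\<^sup>2 + y\<^sup>2)) + y * ((1 / y) / (1 + (u / y)\<^sup>2))) (at u)"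
    unfolding lnprim_def using y pos
    by (auto intro!: derivative_eq_intros simp: field_simps)
  also have "y * ((1 / y) / (1 + (u / y)\<^sup>2)) = y\<^sup>2 / (u\<^sup>2 + y\<^sup>2)"
    using y pos by (simp add: field_simps power2_eq_square)
  also have "1 / 2 * ln (u\<^sup>2 + y\<^sup>2) + u / 2 * (2 * u / (u\<^sup>2 + y\<^sup>2)) + y\<^sup>2 / (u\<^sup>2 + y\<^sup>2)
      = ln (u\<^sup>2 + y\<^sup>2) / 2 + (u\<^sup>2 + y\<^sup>2) / (u\<^sup>2 + y\<^sup>2)"
    by (simp only: add_divide_distrib) (simp add: power2_eq_square)
  also have "(u\<^sup>2 + y\<^sup>2) / (u\<^sup>2 + y\<^sup>2) = 1" by (rule divide_self[OF less_imp_neq[OF pos, symmetric]])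
  finally show ?thesis .
qed

lemma has_real_derivative_lnprim_2:
  assumes y: "y > 0"
  shows "((\<lambda>y. lnprim u y) has_real_derivative arctan (u / y)) (at y)"
proof -
  note pos = sum_squares_pos[OF y, of u]
  have d1: "((\<lambda>y. u / 2 * ln (u\<^sup>2 + y\<^sup>2)) has_real_derivative u / 2 * (2 * y / (u\<^sup>2 + y\<^sup>2))) (at y)"
    using pos by (intro DERIV_cmult) (auto intro!: derivative_eq_intros)
  have d2: "((\<lambda>y. arctan (u / y)) has_real_derivative (- u / y\<^sup>2) / (1 + (u / y)\<^sup>2)) (at y)"
    using y by (auto intro!: derivative_eq_intros simp: power2_eq_square divide_inverse)
  have "((\<lambda>y. lnprim u y) has_real_derivative
      u / 2 * (2 * y / (u\<^sup>2 + y\<^sup>2)) + (arctan (u / y) + y * ((- u / y\<^sup>2) / (1 + (u / y)\<^sup>2)))) (at y)"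
    unfolding lnprim_def by (rule DERIV_cong[OF DERIV_add[OF d1 DERIV_mult[OF DERIV_ident d2]]]) simp
  also have "y * ((- u / y\<^sup>2) / (1 + (u / y)\<^sup>2)) = - (u * y / (u\<^sup>2 + y\<^sup>2))"
    using y pos by (simp add: field_simps power2_eq_square)
  finally show ?thesis by simp
qed

lemma lnprim_minus: "lnprim (- u) y = - lnprim u y"
  by (simp add: lnprim_def arctan_minus)

text \<open>Passes from the line through \<open>n c\<close> to the line through \<open>c\<close>;
  the extra terms in \<open>ln t\<close> are later absorbed by the factorials in the
  denominator.\<close>

lemma lnprim_scale:
  assumes "t > 0" "y > 0"
  shows "lnprim (t * u) (t * y) = t * lnprim u y + t * u * ln t"
proof -
  have "(t * u)\<^sup>2 + (t * y)\<^sup>2 = t\<^sup>2 * (u\<^sup>2 + y\<^sup>2)" by (simp add: algebra_simps power_mult_distrib)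
  then have "ln ((t * u)\<^sup>2 + (t * y)\<^sup>2) = 2 * ln t + ln (u\<^sup>2 + y\<^sup>2)"
    using assms sum_squares_pos[of y u] by (simp add: ln_mult ln_realpow)
  then show ?thesis using assms by (simp add: lnprim_def field_simps)
qed

lemma lnprim_step:
  assumes y: "y > 0" and u: "u \<ge> 0"
  shows "ln (u\<^sup>2 + y\<^sup>2) / 2 + 1 \<le> lnprim (u + 1) y - lnprim u y"
    and "lnprim (u + 1) y - lnprim u y \<le> ln ((u + 1)\<^sup>2 + y\<^sup>2) / 2 + 1"
proof -
  obtain z where z: "u < z" "z < u + 1" "lnprim (u + 1) y - lnprim u y = (u + 1 - u) * (ln (z\<^sup>2 + y\<^sup>2) / 2 + 1)"
    using MVT2[of u "u + 1" "\<lambda>u. lnprim u y" "\<lambda>u. ln (u\<^sup>2 + y\<^sup>2) / 2 + 1"]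
      has_real_derivative_lnprim_1[OF y] by auto
  have "u\<^sup>2 \<le> z\<^sup>2" "z\<^sup>2 \<le> (u + 1)\<^sup>2" using z u by (auto intro!: power_mono)
  then have "ln (u\<^sup>2 + y\<^sup>2) \<le> ln (z\<^sup>2 + y\<^sup>2)" "ln (z\<^sup>2 + y\<^sup>2) \<le> ln ((u + 1)\<^sup>2 + y\<^sup>2)"
    using sum_squares_pos[OF y, of u] sum_squares_pos[OF y, of z] by (auto simp: ln_le_cancel_iff)
  then show "ln (u\<^sup>2 + y\<^sup>2) / 2 + 1 \<le> lnprim (u + 1) y - lnprim u y"
      "lnprim (u + 1) y - lnprim u y \<le> ln ((u + 1)\<^sup>2 + y\<^sup>2) / 2 + 1"
    using z(3) by auto
qed

lemma lnprim_ge: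
  assumes y: "y > 0" and u: "u \<ge> 0"
  shows "lnprim u y \<ge> u - 1"
proof (cases "u = 0")
  case False
  then have u: "u > 0" using u by simp
  have "1 - 1 / u \<le> ln u"
    using ln_le_minus_one[of "1 / u"] u by (simp add: ln_div)
  then have "u * (1 - 1 / u) \<le> u * ln u" using u by (intro mult_left_mono) auto
  moreover have "u * (1 - 1 / u) = u - 1" using u by (simp add: right_diff_distrib)
  moreover have "u / 2 * ln (u\<^sup>2) = u * ln u" using u by (simp add: ln_realpow)
  ultimately have "u - 1 \<le> u / 2 * ln (u\<^sup>2)" by linarith
  also have "\<dots> \<le> u / 2 * ln (u\<^sup>2 + y\<^sup>2)"
    using u sum_squares_pos[OF y, of u] by (intro mult_left_mono) (auto simp: ln_le_cancel_iff)
  also have "\<dots> \<le> lnprim u y"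
    using u y by (simp add: lnprim_def)
  finally show ?thesis .
qed (simp add: lnprim_def)

text \<open>Near the origin the \<open>u\<close>-derivative is unbounded below, so the mean value
  bound fails there as \<open>y\<close> tends to 0; the increment itself is still bounded, uniformly
  in \<open>y\<close>.\<close>

lemma lnprim_step_ge:
  assumes y: "y > 0" and u: "u \<ge> 0"
  shows "lnprim (u + 1) y - lnprim u y \<ge> -2"
proof (cases "u\<^sup>2 + y\<^sup>2 \<ge> 1")
  case True
  then have "ln (u\<^sup>2 + y\<^sup>2) \<ge> 0" by simp
  then show ?thesis using lnprim_step(1)[OF assms] by linarith
next
  case False
  have "y\<^sup>2 \<le> 1\<^sup>2" unfolding one_power2 using False zero_le_power2[of u] by linarith
  then have y1: "y \<le> 1" by (rule power2_le_imp_le) simp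
  have "u / 2 * ln (u\<^sup>2 + y\<^sup>2) \<le> 0"
    using u False sum_squares_pos[OF y, of u] by (intro mult_nonneg_nonpos) auto
  moreover have "y * arctan (u / y) \<le> 1 * 2"
    using y y1 u arctan_ubound[of "u / y"] pi_less_4 by (intro mult_mono) auto
  ultimately have "lnprim u y \<le> 2" by (simp add: lnprim_def)
  moreover have "lnprim (u + 1) y \<ge> u" using lnprim_ge[OF y, of "u + 1"] u by simp
  ultimately show ?thesis using u by linarith
qed

lemma norm_Complex_le_exp:
  assumes y: "y > 0" and u: "\<bar>v\<bar> \<le> u"
  shows "norm (Complex v y) \<le> exp (ln (u\<^sup>2 + y\<^sup>2) / 2)"
proof -
  have "v\<^sup>2 \<le> u\<^sup>2" using u by (simp add: abs_le_square_iff[symmetric])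
  then have "sqrt (v\<^sup>2 + y\<^sup>2) \<le> sqrt (u\<^sup>2 + y\<^sup>2)" by simp
  also have "\<dots> = exp (ln (u\<^sup>2 + y\<^sup>2) / 2)"
    using ln_sqrt[OF less_imp_le[OF sum_squares_pos[OF y, of u]]] sum_squares_pos[OF y, of u] by (simp flip: ln_sqrt)
  finally show ?thesis by (simp add: cmod_def)
qed

text \<open>Monotone comparison of sum and integral to the left of the line. The actual abscissa
  \<open>c'\<close> is a half-integer near the ideal one \<open>C\<close>; moving the comparison by
  one node absorbs the discrepancy. The term \<open>q - p\<close> is the \<open>+ 1\<close> in the
  derivative of \<open>lnprim\<close>, once per node.\<close>

lemma norm_prod_nodes_left:
  assumes y: "y > 0" and c: "\<bar>c' - C\<bar> \<le> 1" and pq: "p \<le> q" and q: "real q \<le> C"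
  shows "(\<Prod>j\<in>{p<..q}. norm (Complex c' y - of_nat j))
    \<le> exp (lnprim (C + 1 - real p) y - lnprim (C + 1 - real q) y - (real q - real p))"
  using pq q
proof (induction q rule: dec_induct)
  case (step q)
  have ins: "{p<..Suc q} = insert (Suc q) {p<..q}" using step(1) by auto
  have eq: "Complex c' y - of_nat (Suc q) = Complex (c' - real (Suc q)) y" by (simp add: complex_eq_iff)
  have "norm (Complex c' y - of_nat (Suc q)) \<le> exp (ln ((C - real q)\<^sup>2 + y\<^sup>2) / 2)"
    unfolding eq using step.prems c by (intro norm_Complex_le_exp[OF y]) auto
  also have "\<dots> \<le> exp (lnprim (C + 1 - real q) y - lnprim (C - real q) y - 1)"
    using lnprim_step(1)[OF y, of "C - real q"] step.prems by (simp add: algebra_simps)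
  finally have "norm (Complex c' y - of_nat (Suc q)) * (\<Prod>j\<in>{p<..q}. norm (Complex c' y - of_nat j))
      \<le> exp (lnprim (C + 1 - real q) y - lnprim (C - real q) y - 1)
        * exp (lnprim (C + 1 - real p) y - lnprim (C + 1 - real q) y - (real q - real p))"
    using step by (intro mult_mono) (auto intro: prod_nonneg)
  also have "\<dots> = exp (lnprim (C + 1 - real p) y - lnprim (C + 1 - real (Suc q)) y - (real (Suc q) - real p))"
    by (simp flip: exp_add add: algebra_simps)
  finally show ?case unfolding ins by simp
qed simp

lemma norm_prod_nodes_right:
  assumes y: "y > 0" and c: "\<bar>c' - C\<bar> \<le> 1" and pq: "p \<le> q" and p: "C \<le> real p + 1"
  shows "(\<Prod>j\<in>{p<..q}. norm (Complex c' y - of_nat j))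
    \<le> exp (lnprim (real q + 2 - C) y - lnprim (real p + 2 - C) y - (real q - real p))"
  using pq
proof (induction q rule: dec_induct)
  case (step q)
  have ins: "{p<..Suc q} = insert (Suc q) {p<..q}" using step(1) by auto
  have eq: "Complex c' y - of_nat (Suc q) = Complex (c' - real (Suc q)) y" by (simp add: complex_eq_iff)
  have "norm (Complex c' y - of_nat (Suc q)) \<le> exp (ln ((real q + 2 - C)\<^sup>2 + y\<^sup>2) / 2)"
    unfolding eq using step p c by (intro norm_Complex_le_exp[OF y]) auto
  also have "\<dots> \<le> exp (lnprim (real q + 3 - C) y - lnprim (real q + 2 - C) y - 1)"
    using lnprim_step(1)[OF y, of "real q + 2 - C"] step p by (simp add: algebra_simps)
  finally have "norm (Complex c' y - of_nat (Suc q)) * (\<Prod>j\<in>{p<..q}. norm (Complex c' y - of_nat j))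
      \<le> exp (lnprim (real q + 3 - C) y - lnprim (real q + 2 - C) y - 1)
        * exp (lnprim (real q + 2 - C) y - lnprim (real p + 2 - C) y - (real q - real p))"
    using step by (intro mult_mono) (auto intro: prod_nonneg)
  also have "\<dots> = exp (lnprim (real (Suc q) + 2 - C) y - lnprim (real p + 2 - C) y - (real (Suc q) - real p))"
    by (simp flip: exp_add add: algebra_simps)
  finally show ?case unfolding ins by simp
qed simp

text \<open>Removes the shifts at the block ends and at the line. Each costs at most a bounded
  factor times a power of \<open>Z\<close>, an upper bound for all moduli that occur; three powers
  suffice in either case.\<close>

lemma norm_prod_nodes_le:
  assumes y: "y > 0" and c: "\<bar>c' - C\<bar> \<le> 1" and pq: "p \<le> q" and p: "real p \<le> C"
    and Z: "y + C + real q + 2 \<le> Z"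
  shows "(\<Prod>j\<in>{p<..q}. norm (Complex c' y - of_nat j))
    \<le> exp 3 * Z ^ 3 * exp (lnprim (C - real p) y - lnprim (C - real q) y - (real q - real p))"
proof -
  have C0: "C \<ge> 0" and Z1: "Z \<ge> 1" using p Z y by linarith+
  have lnZ: "ln (u\<^sup>2 + y\<^sup>2) / 2 \<le> ln Z" if "0 \<le> u" "u \<le> C + real q + 2" for u
  proof -
    have "u\<^sup>2 + y\<^sup>2 \<le> (u + y)\<^sup>2" using that y by (simp add: power2_sum)
    also have "\<dots> \<le> Z\<^sup>2" using that y Z by (intro power_mono) auto
    finally have "ln (u\<^sup>2 + y\<^sup>2) \<le> ln (Z\<^sup>2)" using sum_squares_pos[OF y, of u] Z1 by (subst ln_le_cancel_iff) auto
    then show ?thesis using Z1 by (simp add: ln_realpow)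
  qed
  have lnZ0: "ln Z \<ge> 0" using Z1 by simp
  have s1: "lnprim (C + 1 - real p) y \<le> lnprim (C - real p) y + ln Z + 1"
    using lnprim_step(2)[OF y, of "C - real p"] lnZ[of "C - real p + 1"] p by (simp add: algebra_simps)
  have "(\<Prod>j\<in>{p<..q}. norm (Complex c' y - of_nat j))
    \<le> exp (3 + 3 * ln Z + (lnprim (C - real p) y - lnprim (C - real q) y - (real q - real p)))"
  proof (cases "real q \<le> C")
    case True
    have "lnprim (C + 1 - real q) y \<ge> lnprim (C - real q) y - 2"
      using lnprim_step_ge[OF y, of "C - real q"] True by (simp add: algebra_simps)
    then show ?thesis
      using s1 lnZ0 by (intro order_trans[OF norm_prod_nodes_left[OF y c pq True]]) simp
  next
    case False
    \<comment> \<open>The line cuts the block: factors left and right of it are estimated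
      separately, and the two increments next to the cut are controlled by
      \<open>lnprim_ge\<close>.\<close>
    define j where "j = nat \<lfloor>C\<rfloor>"
    have j: "real j \<le> C" "C \<le> real j + 1" "p \<le> j" "j \<le> q"
      using C0 p False unfolding j_def by linarith+
    have disj: "{p<..q} = {p<..j} \<union> {j<..q}" "{p<..j} \<inter> {j<..q} = {}" using j by auto
    have "(\<Prod>i\<in>{p<..q}. norm (Complex c' y - of_nat i))
        = (\<Prod>i\<in>{p<..j}. norm (Complex c' y - of_nat i)) * (\<Prod>i\<in>{j<..q}. norm (Complex c' y - of_nat i))"
      unfolding disj(1) using disj(2) by (intro prod.union_disjoint) auto
    also have "\<dots> \<le> exp (lnprim (C + 1 - real p) y - lnprim (C + 1 - real j) y - (real j - real p))
        * exp (lnprim (real q + 2 - C) y - lnprim (real j + 2 - C) y - (real q - real j))"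
      by (intro mult_mono norm_prod_nodes_left[OF y c] norm_prod_nodes_right[OF y c] j prod_nonneg) auto
    also have "\<dots> \<le> exp (3 + 3 * ln Z + (lnprim (C - real p) y - lnprim (C - real q) y - (real q - real p)))"
    proof -
      have "lnprim (C + 1 - real j) y \<ge> C - real j" "lnprim (real j + 2 - C) y \<ge> real j + 1 - C"
        using lnprim_ge[OF y, of "C + 1 - real j"] lnprim_ge[OF y, of "real j + 2 - C"] j by simp_all
      moreover have "lnprim (real q + 2 - C) y \<le> lnprim (real q - C) y + 2 * ln Z + 2"
        using lnprim_step(2)[OF y, of "real q - C"] lnprim_step(2)[OF y, of "real q - C + 1"]
          lnZ[of "real q - C + 1"] lnZ[of "real q - C + 2"] False C0 by (simp add: algebra_simps)
      moreover have "lnprim (real q - C) y = - lnprim (C - real q) y"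
        using lnprim_minus[of "C - real q" y] by simp
      ultimately show ?thesis using s1 unfolding exp_add[symmetric] exp_le_cancel_iff by linarith
    qed
    finally show ?thesis .
  qed
  also have "\<dots> = exp 3 * Z ^ 3 * exp (lnprim (C - real p) y - lnprim (C - real q) y - (real q - real p))"
  proof -
    have "exp (3 * ln Z) = Z ^ 3" using Z1 exp_of_nat_mult[of 3 "ln Z"] by simp
    then show ?thesis by (simp add: exp_add)
  qed
  finally show ?thesis .
qed

text \<open>Each summand is the angle under which the segment from \<open>ia\<close> to
  \<open>b - ia\<close> is seen from the point \<open>c + i y\<close>.\<close>

definition line_angle :: "real \<Rightarrow> real \<Rightarrow> real \<Rightarrow> real \<Rightarrow> real" where
  "line_angle a b c y = (\<Sum>i<(3::nat). arctan ((c - real i * a) / y) - arctan ((c - (b - real i * a)) / y))"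

text \<open>Up to terms independent of \<open>y\<close>, the exponential rate in \<open>n\<close> of
  the integrand at \<open>n (c + i y)\<close>; the last term is the decay of the squared
  cosecant.\<close>

definition line_phase :: "real \<Rightarrow> real \<Rightarrow> real \<Rightarrow> real \<Rightarrow> real" where
  "line_phase a b c y = (\<Sum>i<(3::nat). lnprim (c - real i * a) y - lnprim (c - (b - real i * a)) y) - 2 * pi * y"

lemma has_real_derivative_line_phase:
  assumes "y > 0"
  shows "(line_phase a b c has_real_derivative line_angle a b c y - 2 * pi) (at y)"
  unfolding line_phase_def line_angle_def using assms
  by (auto intro!: derivative_eq_intros has_real_derivative_lnprim_2)

lemma arctan_div_antimono:
  assumes "u \<ge> 0" "0 < y1" "y1 \<le> y2"
  shows "arctan (u / y2) \<le> arctan (u / y1)"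
  using assms by (intro arctan_monotone' divide_left_mono) auto

text \<open>The sign condition for the derivative of \<open>arctan (l t) / arctan t\<close>. Both
  sides vanish at 0, and their difference has derivative
  \<open>2 l t (arctan t - l arctan (l t))\<close>, which is nonnegative.\<close>

lemma arctan_ratio_deriv_aux:
  assumes l: "0 \<le> l" "l \<le> 1" and t: "t \<ge> 0"
  shows "(1 + l\<^sup>2 * t\<^sup>2) * arctan (l * t) \<le> l * (1 + t\<^sup>2) * arctan t"
proof -
  let ?K = "\<lambda>t. l * (1 + t\<^sup>2) * arctan t - (1 + l\<^sup>2 * t\<^sup>2) * arctan (l * t)"
  have "?K 0 \<le> ?K t"
  proof (rule DERIV_nonneg_imp_nondecreasing[OF t])
    fix s :: real assume s: "0 \<le> s" "s \<le> t"
    have p1: "1 + s\<^sup>2 \<noteq> 0" and p2: "1 + (l * s)\<^sup>2 \<noteq> 0" by (simp_all add: add_nonneg_eq_0_iff)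
    have d1: "((\<lambda>t. l * (1 + t\<^sup>2) * arctan t) has_real_derivative 2 * l * s * arctan s + l) (at s)"
    proof (rule DERIV_cong)
      show "((\<lambda>t. l * (1 + t\<^sup>2) * arctan t) has_real_derivative
          (l * (2 * s)) * arctan s + inverse (1 + s\<^sup>2) * (l * (1 + s\<^sup>2))) (at s)"
        by (auto intro!: derivative_eq_intros)
      show "(l * (2 * s)) * arctan s + inverse (1 + s\<^sup>2) * (l * (1 + s\<^sup>2)) = 2 * l * s * arctan s + l"
        using p1 by simp
    qed
    have d2: "((\<lambda>t. (1 + l\<^sup>2 * t\<^sup>2) * arctan (l * t)) has_real_derivative 2 * l\<^sup>2 * s * arctan (l * s) + l) (at s)"
    proof (rule DERIV_cong)
      show "((\<lambda>t. (1 + l\<^sup>2 * t\<^sup>2) * arctan (l * t)) has_real_derivative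
          (l\<^sup>2 * (2 * s)) * arctan (l * s) + (inverse (1 + (l * s)\<^sup>2) * l) * (1 + l\<^sup>2 * s\<^sup>2)) (at s)"
        by (auto intro!: derivative_eq_intros)
      have "(1 + l\<^sup>2 * s\<^sup>2) = 1 + (l * s)\<^sup>2" by (simp add: power_mult_distrib)
      then show "(l\<^sup>2 * (2 * s)) * arctan (l * s) + (inverse (1 + (l * s)\<^sup>2) * l) * (1 + l\<^sup>2 * s\<^sup>2)
          = 2 * l\<^sup>2 * s * arctan (l * s) + l"
        using p2 by simp
    qed
    have "l * arctan (l * s) \<le> 1 * arctan s"
      using l s by (intro mult_mono arctan_monotone' mult_left_le_one_le) auto
    then have "0 \<le> 2 * (l * s) * (arctan s - l * arctan (l * s))"
      using l s by simp
    then show "\<exists>y. (?K has_real_derivative y) (at s) \<and> 0 \<le> y"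
      by (intro exI[of _ "(2 * l * s * arctan s + l) - (2 * l\<^sup>2 * s * arctan (l * s) + l)"] conjI DERIV_diff d1 d2)
         (simp add: algebra_simps power2_eq_square)
  qed
  then show ?thesis by simp
qed

lemma arctan_ratio_mono:
  assumes l: "0 \<le> l" "l \<le> 1" and t: "0 < t1" "t1 \<le> t2"
  shows "arctan (l * t1) / arctan t1 \<le> arctan (l * t2) / arctan t2"
proof (rule DERIV_nonneg_imp_nondecreasing[OF t(2)])
  fix s assume "t1 \<le> s" "s \<le> t2"
  then have s: "s > 0" using t by simp
  have at: "arctan s > 0" using s by simp
  have p1: "1 + s\<^sup>2 > 0" and p2: "1 + l\<^sup>2 * s\<^sup>2 > 0" by (auto intro!: add_pos_nonneg)
  have "((\<lambda>t. arctan (l * t) / arctan t) has_real_derivative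
      ((inverse (1 + (l * s)\<^sup>2) * l) * arctan s - arctan (l * s) * inverse (1 + s\<^sup>2)) / (arctan s * arctan s)) (at s)"
    using at by (auto intro!: derivative_eq_intros)
  moreover have "0 \<le> (inverse (1 + (l * s)\<^sup>2) * l) * arctan s - arctan (l * s) * inverse (1 + s\<^sup>2)"
  proof -
    have "arctan (l * s) / (1 + s\<^sup>2) \<le> l * arctan s / (1 + l\<^sup>2 * s\<^sup>2)"
      using arctan_ratio_deriv_aux[OF l, of s] s p1 p2
      by (simp add: divide_le_eq pos_le_divide_eq mult_ac)
    then show ?thesis by (simp add: divide_inverse power_mult_distrib mult_ac)
  qed
  then have "0 \<le> ((inverse (1 + (l * s)\<^sup>2) * l) * arctan s - arctan (l * s) * inverse (1 + s\<^sup>2)) / (arctan s * arctan s)"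
    using at by (intro divide_nonneg_pos) auto
  ultimately show "\<exists>y. ((\<lambda>t. arctan (l * t) / arctan t) has_real_derivative y) (at s) \<and> 0 \<le> y"
    by blast
qed

lemma arctan_div_eq: "u > 0 \<Longrightarrow> y > 0 \<Longrightarrow> arctan (u / y) = pi / 2 - arctan (y / u)"
  using arctan_inverse[of "y / u"] by (simp add: field_simps)

text \<open>When the line leaves the innermost segment the angle is no longer monotone in \<open>y\<close>; its excess over \<open>2\<pi>\<close> is then
  \<open>arctan (y/\<alpha>) - \<Sum> arctan (y/\<beta>)\<close> with \<open>\<beta> \<ge> \<alpha>\<close>, and the quotients \<open>arctan (y/\<beta>) / arctan (y/\<alpha>)\<close> are monotone.\<close>
lemma line_angle_sign:
  fixes a b c Y :: real
  assumes a: "a > 0" and b: "b > 4 * a" and c: "b / 2 < c" "c < b - a" and Y: "Y > 0"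
    and crit: "line_angle a b c Y = 2 * pi"
  shows "0 < y \<Longrightarrow> y \<le> Y \<Longrightarrow> line_angle a b c y \<ge> 2 * pi"
    and "Y \<le> y \<Longrightarrow> line_angle a b c y \<le> 2 * pi"
proof -
  have eq: "line_angle a b c y = arctan (c / y) + arctan ((c - a) / y) + arctan ((c - 2 * a) / y)
      + arctan ((b - c) / y) + arctan ((b - a - c) / y) + arctan ((b - 2 * a - c) / y)" for y
  proof -
    have "arctan ((c - v) / y) = - arctan ((v - c) / y)" for v
      by (metis arctan_minus minus_diff_eq minus_divide_left)
    then show ?thesis
      unfolding line_angle_def sum_lessThan_3 by simp
  qed
  consider "c \<le> b - 2 * a" | "c > b - 2 * a" by linarith
  then have "(0 < y \<longrightarrow> y \<le> Y \<longrightarrow> line_angle a b c y \<ge> 2 * pi) \<and> (Y \<le> y \<longrightarrow> line_angle a b c y \<le> 2 * pi)" for y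
  proof cases
    case 1
    have mono: "line_angle a b c y2 \<le> line_angle a b c y1" if "0 < y1" "y1 \<le> y2" for y1 y2
      unfolding eq using that 1 a b c by (intro add_mono arctan_div_antimono) auto
    show ?thesis using mono[of y Y] mono[of Y y] Y crit by auto
  next
    case 2
    define \<alpha> where "\<alpha> = c - (b - 2 * a)"
    define \<beta> where "\<beta> = (\<lambda>i::nat. [c, c - a, c - 2 * a, b - c, b - a - c] ! i)"
    have \<alpha>: "\<alpha> > 0" using 2 by (simp add: \<alpha>_def)
    have all5: "(\<forall>i<5. P i) \<longleftrightarrow> P 0 \<and> P 1 \<and> P 2 \<and> P 3 \<and> P (4::nat)" for P
      by (auto simp: eval_nat_numeral less_Suc_eq)
    have sum5: "(\<Sum>i<5. f i) = f 0 + f 1 + f 2 + f 3 + f (4::nat)" for f :: "nat \<Rightarrow> real"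
      by (simp add: eval_nat_numeral)
    have \<beta>: "\<forall>i<5. \<beta> i > 0" unfolding all5 using a b c by (auto simp: \<beta>_def)
    \<comment> \<open>Inverting the arguments produces five times \<open>pi/2\<close> minus one
      \<open>pi/2\<close> from the end left behind, which is exactly \<open>2 pi\<close>.\<close>
    have ex: "line_angle a b c y - 2 * pi = arctan (y / \<alpha>) - (\<Sum>i<5. arctan (y / \<beta> i))" if y: "y > 0" for y
    proof -
      have "arctan ((b - 2 * a - c) / y) = - arctan (\<alpha> / y)"
        by (metis \<alpha>_def arctan_minus minus_diff_eq minus_divide_left)
      also have "\<dots> = arctan (y / \<alpha>) - pi / 2" using arctan_div_eq[OF \<alpha> y] by simp
      finally have 6: "arctan ((b - 2 * a - c) / y) = arctan (y / \<alpha>) - pi / 2" .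
      have "arctan (c / y) = pi / 2 - arctan (y / c)" "arctan ((c - a) / y) = pi / 2 - arctan (y / (c - a))"
        "arctan ((c - 2 * a) / y) = pi / 2 - arctan (y / (c - 2 * a))" "arctan ((b - c) / y) = pi / 2 - arctan (y / (b - c))"
        "arctan ((b - a - c) / y) = pi / 2 - arctan (y / (b - a - c))"
        using a b c by (intro arctan_div_eq y; linarith)+
      then show ?thesis unfolding eq 6 sum5 by (simp add: \<beta>_def)
    qed
    have atpos: "arctan (y / \<beta> i) > 0" if "y > 0" "i < 5" for y i
      using \<beta> that by (simp add: zero_less_arctan_iff)
    have ge: "\<beta> i \<ge> \<alpha>" if "i < 5" for i
    proof -
      \<comment> \<open>The only comparison that does not follow from the position of
        \<open>c\<close>; if it failed, a single subtracted arctangent would already exceed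
        \<open>arctan (Y / \<alpha>)\<close>, against the equation at \<open>Y\<close>.\<close>
      have "\<beta> 4 \<ge> \<alpha>"
      proof (rule ccontr)
        assume "\<not> ?thesis"
        then have "Y / \<alpha> < Y / \<beta> 4" using \<beta> Y \<alpha> by (intro divide_strict_left_mono mult_pos_pos) auto
        then have "arctan (Y / \<alpha>) < arctan (Y / \<beta> 4)" by (simp add: arctan_less_iff)
        moreover have "arctan (Y / \<beta> 4) \<le> (\<Sum>i<5. arctan (Y / \<beta> i))"
          using atpos[OF Y] by (intro member_le_sum) (auto simp: less_imp_le)
        ultimately show False using ex[OF Y] crit by linarith
      qed
      then have "\<forall>i<5. \<beta> i \<ge> \<alpha>" unfolding all5 using a b c by (auto simp: \<beta>_def \<alpha>_def)
      then show ?thesis using that by blast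
    qed
    define R where "R y = (\<Sum>i<5. arctan (y / \<beta> i) / arctan (y / \<alpha>))" for y
    have at\<alpha>: "arctan (y / \<alpha>) > 0" if "y > 0" for y using \<alpha> that by (simp add: zero_less_arctan_iff)
    have Rmono: "R y1 \<le> R y2" if "0 < y1" "y1 \<le> y2" for y1 y2
      unfolding R_def
    proof (rule sum_mono)
      fix i :: nat assume i: "i \<in> {..<5}"
      have "\<alpha> / \<beta> i \<le> 1" "0 \<le> \<alpha> / \<beta> i" using ge[of i] \<beta> i \<alpha> by (auto simp: divide_le_eq_1)
      from arctan_ratio_mono[OF this(2,1), of "y1 / \<alpha>" "y2 / \<alpha>"]
      show "arctan (y1 / \<beta> i) / arctan (y1 / \<alpha>) \<le> arctan (y2 / \<beta> i) / arctan (y2 / \<alpha>)"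
        using that \<alpha> by (simp add: divide_right_mono)
    qed
    have ex2: "line_angle a b c y - 2 * pi = arctan (y / \<alpha>) * (1 - R y)" if y: "y > 0" for y
      unfolding ex[OF y] R_def sum_divide_distrib[symmetric] using at\<alpha>[OF y] \<alpha> y by (simp add: right_diff_distrib)
    have "R Y = 1" using ex2[OF Y] at\<alpha>[OF Y] crit Y \<alpha> by auto
    then have "y > 0 \<Longrightarrow> y \<le> Y \<Longrightarrow> R y \<le> 1" "Y \<le> y \<Longrightarrow> R y \<ge> 1"
      using Rmono[of y Y] Rmono[of Y y] Y by auto
    then show ?thesis
      using ex2[of y] at\<alpha>[of y] Y
      by (smt (verit) mult_nonneg_nonneg mult_nonneg_nonpos)
  qed
  then show "0 < y \<Longrightarrow> y \<le> Y \<Longrightarrow> line_angle a b c y \<ge> 2 * pi" "Y \<le> y \<Longrightarrow> line_angle a b c y \<le> 2 * pi"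
    by blast+
qed

text \<open>The derivative is the angle minus \<open>2 pi\<close>, whose sign changes only from plus
  to minus, at \<open>Y\<close>. Far up all angles tend to 0, so the slope is eventually below
  \<open>-1\<close>; \<open>T\<close> marks that height.\<close>

lemma line_phase_le:
  fixes a b c Y :: real
  assumes a: "a > 0" and b: "b > 4 * a" and c: "b / 2 < c" "c < b - a" and Y: "Y > 0"
    and crit: "line_angle a b c Y = 2 * pi"
  shows "\<exists>T>0. \<forall>y>0. line_phase a b c y \<le> line_phase a b c Y - max 0 (y - T)"
proof -
  note D = has_real_derivative_line_phase[of _ a b c]
  have max: "line_phase a b c y \<le> line_phase a b c Y" if y: "y > 0" for y
  proof (cases "y \<le> Y")
    case True
    show ?thesis
    proof (rule DERIV_nonneg_imp_nondecreasing[OF True, where f = "line_phase a b c"])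
      fix s assume "y \<le> s" "s \<le> Y"
      then show "\<exists>d. (line_phase a b c has_real_derivative d) (at s) \<and> 0 \<le> d"
        using D[of s] line_angle_sign(1)[OF assms, of s] y by (intro exI conjI) auto
    qed
  next
    case False
    show ?thesis
    proof (rule DERIV_nonpos_imp_nonincreasing[where f = "line_phase a b c"])
      show "Y \<le> y" using False by simp
      fix s assume "Y \<le> s" "s \<le> y"
      then show "\<exists>d. (line_phase a b c has_real_derivative d) (at s) \<and> d \<le> 0"
        using D[of s] line_angle_sign(2)[OF assms, of s] Y by (intro exI conjI) auto
    qed
  qed
  have "((\<lambda>y. u / y) \<longlongrightarrow> 0) at_top" for u :: real
    by (intro tendsto_divide_0[OF tendsto_const] filterlim_at_top_imp_at_infinity filterlim_ident)
  then have lim0: "((\<lambda>y. arctan (u / y)) \<longlongrightarrow> arctan 0) at_top" for u :: real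
    by (intro tendsto_intros)
  have "((\<lambda>y. line_angle a b c y - 2 * pi) \<longlongrightarrow> (\<Sum>i<(3::nat). arctan 0 - arctan 0) - 2 * pi) at_top"
    unfolding line_angle_def by (intro tendsto_diff tendsto_sum tendsto_const lim0)
  moreover have "(\<Sum>i<(3::nat). arctan 0 - arctan 0) - 2 * pi < -1" using pi_gt3 by simp
  ultimately have "\<forall>\<^sub>F y in at_top. line_angle a b c y - 2 * pi < -1" by (rule order_tendstoD(2))
  then obtain T0 where T0: "\<And>y. y \<ge> T0 \<Longrightarrow> line_angle a b c y - 2 * pi < -1"
    by (auto simp: eventually_at_top_linorder)
  define T where "T = Max {T0, 1}"
  have T: "T > 0" "T \<ge> T0" by (auto simp: T_def)
  have "line_phase a b c y \<le> line_phase a b c Y - max 0 (y - T)" if y: "y > 0" for y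
  proof (cases "y \<le> T")
    case True
    then show ?thesis using max[OF y] by simp
  next
    case False
    have "line_phase a b c y + y \<le> line_phase a b c T + T"
    proof (rule DERIV_nonpos_imp_nonincreasing[where f = "\<lambda>y. line_phase a b c y + y"])
      show "T \<le> y" using False by simp
      fix s assume s: "T \<le> s" "s \<le> y"
      then have "((\<lambda>y. line_phase a b c y + y) has_real_derivative (line_angle a b c s - 2 * pi) + 1) (at s)"
        using T by (intro DERIV_add D DERIV_ident) auto
      then show "\<exists>d. ((\<lambda>y. line_phase a b c y + y) has_real_derivative d) (at s) \<and> d \<le> 0"
        using T0[of s] s T by (intro exI conjI) auto
    qed
    then show ?thesis using max[OF T(1)] False by simp
  qed
  then show ?thesis using T by blast
qed

lemma Complex_eq_rcis:
  assumes "Y > 0"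
  shows "Complex u Y = of_real (sqrt (u\<^sup>2 + Y\<^sup>2)) * cis (pi / 2 - arctan (u / Y))"
proof -
  have S: "sqrt (1 + (u / Y)\<^sup>2) = sqrt (u\<^sup>2 + Y\<^sup>2) / Y"
  proof -
    have "1 + (u / Y)\<^sup>2 = (u\<^sup>2 + Y\<^sup>2) / Y\<^sup>2" using assms by (simp add: power_divide add_divide_distrib)
    then show ?thesis using assms by (simp add: real_sqrt_divide)
  qed
  have pos: "sqrt (u\<^sup>2 + Y\<^sup>2) > 0" using sum_squares_pos[OF assms] by simp
  have "sqrt (u\<^sup>2 + Y\<^sup>2) * sin (arctan (u / Y)) = u"
    unfolding sin_arctan S using assms pos by (simp del: real_sqrt_gt_0_iff)
  moreover have "sqrt (u\<^sup>2 + Y\<^sup>2) * cos (arctan (u / Y)) = Y"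
    unfolding cos_arctan S using assms pos by (simp del: real_sqrt_gt_0_iff)
  ultimately show ?thesis
    by (simp add: complex_eq_iff cos_diff sin_diff)
qed

text \<open>The argument of the equation says that the total angle is a multiple of
  \<open>2 pi\<close>; being a sum of three angles strictly between 0 and \<open>pi\<close>, it
  equals \<open>2 pi\<close>. The modulus says that \<open>w\<close> is farther from the left ends
  than from the right ends, which puts it right of \<open>b/2\<close>.\<close>

lemma critical_point:
  fixes a b r :: real and w :: complex
  assumes a: "a > 0" and b: "b > 4 * a" and r: "r > 1" and w: "Im w > 0"
    and eq: "(\<Prod>i<(3::nat). w - of_real (real i * a)) / (\<Prod>i<(3::nat). w - of_real (b - real i * a)) = of_real r"
  shows "b / 2 < Re w" "Re w < b - a" "line_angle a b (Re w) (Im w) = 2 * pi"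
proof -
  define c Y where "c = Re w" and "Y = Im w"
  have Y: "Y > 0" using w by (simp add: Y_def)
  define \<rho> where "\<rho> v = sqrt ((c - v)\<^sup>2 + Y\<^sup>2)" for v
  define \<theta> where "\<theta> v = pi / 2 - arctan ((c - v) / Y)" for v
  have wv: "w - of_real v = of_real (\<rho> v) * cis (\<theta> v)" for v
  proof -
    have "w - of_real v = Complex (c - v) Y" by (simp add: complex_eq_iff c_def Y_def)
    then show ?thesis by (simp add: Complex_eq_rcis[OF Y] \<rho>_def \<theta>_def)
  qed
  have \<rho>: "\<rho> v > 0" for v using sum_squares_pos[OF Y] by (simp add: \<rho>_def)
  define N D where "N = (\<Prod>i<(3::nat). \<rho> (real i * a))" and "D = (\<Prod>i<(3::nat). \<rho> (b - real i * a))"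
  have ND: "N > 0" "D > 0" unfolding N_def D_def by (auto intro!: prod_pos \<rho>)
  have cisprod: "(\<Prod>i<(3::nat). cis (g i)) = cis (\<Sum>i<(3::nat). g i)" for g
    by (simp add: eval_nat_numeral cis_mult)
  define L where "L = line_angle a b c Y"
  have "(\<Sum>i<(3::nat). \<theta> (real i * a)) - (\<Sum>i<(3::nat). \<theta> (b - real i * a)) = - L"
    unfolding L_def line_angle_def \<theta>_def sum_lessThan_3 by simp
  then have "of_real (N / D) * cis (- L) = of_real r"
  proof -
    assume AB: "(\<Sum>i<(3::nat). \<theta> (real i * a)) - (\<Sum>i<(3::nat). \<theta> (b - real i * a)) = - L"
    have "of_real N * cis A / (of_real D * cis B) = of_real (N / D) * cis (A - B)" for A B
      by (simp flip: cis_divide)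
    then show ?thesis
      using eq unfolding wv prod.distrib cisprod of_real_prod[symmetric] N_def[symmetric] D_def[symmetric] AB[symmetric]
      by simp
  qed
  then have e: "of_real (N / D) * cis (- L) = (of_real r :: complex)" .
  have "norm (of_real (N / D) * cis (- L)) = norm (of_real r :: complex)" unfolding e ..
  then have NDr: "N / D = r" using ND r by (simp add: norm_mult norm_divide)
  then have "cis (- L) = 1" using e r by simp
  then have "cos L = 1" by (simp add: complex_eq_iff)
  then obtain n :: int where n: "L = of_int n * 2 * pi" by (auto simp: cos_one_2pi_int)
  define t where "t v = arctan ((c - v) / Y) - arctan ((c - (b - v)) / Y)" for v
  have L: "L = t 0 + t a + t (2 * a)"
    unfolding L_def line_angle_def t_def sum_lessThan_3 by simp
  have tpos: "t v > 0" if "v < b / 2" for v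
    using that Y unfolding t_def by (simp add: arctan_less_iff divide_strict_right_mono)
  have tlt: "t v < pi" for v
    using arctan_ubound[of "(c - v) / Y"] arctan_lbound[of "(c - (b - v)) / Y"] unfolding t_def by linarith
  have "0 < of_int n * 2 * pi" "of_int n * 2 * pi < 3 * pi"
    using tpos[of 0] tpos[of a] tpos[of "2 * a"] tlt[of 0] tlt[of a] tlt[of "2 * a"] a b n L by linarith+
  then have "0 < real_of_int n" "real_of_int n * 2 < 3" by (auto simp: zero_less_mult_iff)
  then have "n = 1" by linarith
  then have L2: "L = 2 * pi" using n by simp
  then show "line_angle a b (Re w) (Im w) = 2 * pi" by (simp add: L_def c_def Y_def)
  \<comment> \<open>The nested segments give ordered angles, and the outer one is below
    \<open>pi\<close>, so the middle one exceeds \<open>pi/2\<close>. This is possible only above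
    the interior of the middle segment.\<close>
  have "t (2 * a) \<le> t a"
    unfolding t_def using a Y by (intro diff_mono) (auto simp: arctan_le_iff divide_right_mono)
  then have "t a > pi / 2" using L L2 tlt[of 0] by linarith
  then have "arctan ((c - (b - a)) / Y) < 0"
    using arctan_ubound[of "(c - a) / Y"] unfolding t_def by linarith
  then show "Re w < b - a" using Y by (simp add: c_def divide_less_0_iff)
  show "b / 2 < Re w"
  proof (rule ccontr)
    assume "\<not> ?thesis"
    then have cb: "c \<le> b / 2" by (simp add: c_def)
    have "N \<le> D"
      unfolding N_def D_def
    proof (rule prod_mono)
      fix i :: nat assume "i \<in> {..<3}"
      then have "real i * a \<le> 2 * a" using a by (intro mult_right_mono) auto
      then have "\<bar>c - real i * a\<bar> \<le> \<bar>c - (b - real i * a)\<bar>" using cb b by linarith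
      then have "(c - real i * a)\<^sup>2 \<le> (c - (b - real i * a))\<^sup>2" by (simp add: abs_le_square_iff)
      then show "0 \<le> \<rho> (real i * a) \<and> \<rho> (real i * a) \<le> \<rho> (b - real i * a)" by (simp add: \<rho>_def)
    qed
    then show False using NDr r ND by (simp add: field_simps)
  qed
qed

section \<open>Growth of the positive series\<close>

lemma ln_fact_ge: "real m * ln (real m) - real m \<le> ln (fact m)"
proof (cases "m = 0")
  case False
  have "real m ^ m / fact m \<le> exp (real m)"
  proof -
    have "(\<Sum>k\<in>{m}. real m ^ k /\<^sub>R fact k) \<le> (\<Sum>k. real m ^ k /\<^sub>R fact k)"
      by (intro sum_le_suminf summable_exp_generic) auto
    then show ?thesis by (simp add: exp_def divide_inverse mult.commute)
  qed
  then have "ln (real m ^ m / fact m) \<le> ln (exp (real m))"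
    using False by (subst ln_le_cancel_iff) auto
  then show ?thesis using False by (simp add: ln_div ln_realpow)
qed simp

lemma ln_fact_le:
  assumes "m \<ge> 1"
  shows "ln (fact m) \<le> real m * ln (real m) - real m + 1 + ln (real m)"
  using assms
proof (induction m rule: dec_induct)
  case (step m)
  have m: "real m > 0" using step by simp
  have "ln (real m / real (Suc m)) \<le> real m / real (Suc m) - 1" using m by (intro ln_le_minus_one) simp
  then have "ln (real (Suc m)) - ln (real m) \<ge> 1 / real (Suc m)"
    using m by (simp add: ln_div field_simps)
  then have "real (Suc m) * (ln (real (Suc m)) - ln (real m)) \<ge> 1"
    by (simp add: field_simps)
  moreover have "ln (fact (Suc m) :: real) = ln (real (Suc m)) + ln (fact m)"
    by (simp only: fact_Suc) (simp add: ln_mult)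
  ultimately show ?case using step.IH by (simp add: algebra_simps)
qed simp

text \<open>The subtracted \<open>M ln n\<close> makes a finite limit possible and cancels in a
  binomial coefficient, where the lower factorials have the same total argument as the upper
  one.\<close>

lemma tendsto_ln_fact:
  fixes M :: "nat \<Rightarrow> nat"
  assumes lim: "(\<lambda>n. real (M n) / real n) \<longlonglongrightarrow> \<mu>" and \<mu>: "\<mu> > 0"
  shows "(\<lambda>n. (ln (fact (M n)) - real (M n) * ln (real n)) / real n) \<longlonglongrightarrow> \<mu> * ln \<mu> - \<mu>"
proof -
  have pos: "\<forall>\<^sub>F n in sequentially. n \<ge> 1 \<and> M n \<ge> 1"
    using order_tendstoD(1)[OF lim \<mu>] eventually_gt_at_top[of 0]
    by eventually_elim (auto simp: zero_less_divide_iff)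
  let ?f = "\<lambda>n. real (M n) / real n"
  have lnlim: "(\<lambda>n. ln (?f n)) \<longlonglongrightarrow> ln \<mu>" using lim \<mu> by (intro tendsto_intros) auto
  have l1: "(\<lambda>n. ?f n * ln (?f n) - ?f n) \<longlonglongrightarrow> \<mu> * ln \<mu> - \<mu>"
    by (intro tendsto_diff tendsto_mult lim lnlim)
  have z: "(\<lambda>n. (1 + ln (real n)) / real n) \<longlonglongrightarrow> 0" "(\<lambda>n. 1 / real n) \<longlonglongrightarrow> 0" by real_asymp+
  have "(\<lambda>n. ?f n * ln (?f n) - ?f n + (ln (?f n) * (1 / real n) + (1 + ln (real n)) / real n)) \<longlonglongrightarrow> \<mu> * ln \<mu> - \<mu> + (ln \<mu> * 0 + 0)"
    by (intro tendsto_add tendsto_mult l1 lnlim z)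
  then have l2: "(\<lambda>n. ?f n * ln (?f n) - ?f n + (ln (?f n) * (1 / real n) + (1 + ln (real n)) / real n)) \<longlonglongrightarrow> \<mu> * ln \<mu> - \<mu>"
    by simp
  have eq: "(real (M n) * ln (real (M n)) - real (M n) - real (M n) * ln (real n)) / real n = ?f n * ln (?f n) - ?f n"
    if "n \<ge> 1 \<and> M n \<ge> 1" for n
    using that by (simp add: ln_div field_simps)
  show ?thesis
  proof (rule real_tendsto_sandwich[OF _ _ l1 l2])
    show "\<forall>\<^sub>F n in sequentially. ?f n * ln (?f n) - ?f n \<le> (ln (fact (M n)) - real (M n) * ln (real n)) / real n"
      using pos
    proof eventually_elim
      case (elim n)
      then show ?case unfolding eq[OF elim, symmetric] using ln_fact_ge[of "M n"] by (intro divide_right_mono) auto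
    qed
    show "\<forall>\<^sub>F n in sequentially. (ln (fact (M n)) - real (M n) * ln (real n)) / real n
        \<le> ?f n * ln (?f n) - ?f n + (ln (?f n) * (1 / real n) + (1 + ln (real n)) / real n)"
      using pos
    proof eventually_elim
      case (elim n)
      have "ln (?f n) * (1 / real n) + (1 + ln (real n)) / real n = (1 + ln (real (M n))) / real n"
        using elim by (simp add: ln_div add_divide_distrib diff_divide_distrib)
      then show ?case unfolding eq[OF elim, symmetric] add_divide_distrib[symmetric]
        using ln_fact_le[of "M n"] elim by (auto intro!: divide_right_mono simp flip: add_divide_distrib)
    qed
  qed
qed

lemma tendsto_ln_binomial:
  fixes N M :: "nat \<Rightarrow> nat"
  assumes N: "(\<lambda>n. real (N n) / real n) \<longlonglongrightarrow> \<nu>" and M: "(\<lambda>n. real (M n) / real n) \<longlonglongrightarrow> \<mu>"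
    and \<mu>: "0 < \<mu>" "\<mu> < \<nu>" and le: "\<And>n. M n \<le> N n"
  shows "(\<lambda>n. ln (real (N n choose M n)) / real n) \<longlonglongrightarrow> \<nu> * ln \<nu> - \<mu> * ln \<mu> - (\<nu> - \<mu>) * ln (\<nu> - \<mu>)"
proof -
  have NM: "(\<lambda>n. real (N n - M n) / real n) \<longlonglongrightarrow> \<nu> - \<mu>"
    using tendsto_diff[OF N M] le by (simp add: of_nat_diff diff_divide_distrib)
  have "(\<lambda>n. (ln (fact (N n)) - real (N n) * ln (real n)) / real n
      - (ln (fact (M n)) - real (M n) * ln (real n)) / real n
      - (ln (fact (N n - M n)) - real (N n - M n) * ln (real n)) / real n)
     \<longlonglongrightarrow> (\<nu> * ln \<nu> - \<nu>) - (\<mu> * ln \<mu> - \<mu>) - ((\<nu> - \<mu>) * ln (\<nu> - \<mu>) - (\<nu> - \<mu>))"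
    using \<mu> by (intro tendsto_diff tendsto_ln_fact N M NM) auto
  moreover have "(ln (fact (N n)) - real (N n) * ln (real n)) / real n
      - (ln (fact (M n)) - real (M n) * ln (real n)) / real n
      - (ln (fact (N n - M n)) - real (N n - M n) * ln (real n)) / real n = ln (real (N n choose M n)) / real n" for n
  proof -
    have "ln (real (N n choose M n)) = ln (fact (N n)) - ln (fact (M n)) - ln (fact (N n - M n))"
      using le[of n] by (simp add: binomial_fact ln_div ln_mult)
    moreover have "real (N n - M n) = real (N n) - real (M n)" using le[of n] by (simp add: of_nat_diff)
    ultimately show ?thesis by (simp add: diff_divide_distrib[symmetric] algebra_simps)
  qed
  ultimately show ?thesis by (simp add: algebra_simps)
qed

text \<open>One term of the expansion of \<open>(s + (1-s))^N\<close>, which is 1. With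
  \<open>s\<close> fixed at the limiting ratio the bound is sharp to exponential order.\<close>

lemma choose_le_tangent:
  fixes s :: real
  assumes "0 < s" "s < 1" "M \<le> N"
  shows "real (N choose M) \<le> 1 / (s ^ M * (1 - s) ^ (N - M))"
proof -
  have "real (N choose M) * s ^ M * (1 - s) ^ (N - M) \<le> (\<Sum>k\<le>N. real (N choose k) * s ^ k * (1 - s) ^ (N - k))"
    using assms by (intro member_le_sum) auto
  also have "\<dots> = (s + (1 - s)) ^ N" by (simp only: binomial_ring)
  finally show ?thesis using assms by (simp add: pos_le_divide_eq mult_ac)
qed

text \<open>\<open>R(\<nu>) x^\<nu>\<close> at \<open>\<nu> = bn + 1 + \<mu>\<close>: the index
  starts just beyond the last zero, so all terms are positive.\<close>

definition triple_term :: "nat \<Rightarrow> nat \<Rightarrow> real \<Rightarrow> nat \<Rightarrow> nat \<Rightarrow> real" where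
  "triple_term a b x n \<mu> = (\<Prod>i<3. real ((b * n + \<mu> - i * a * n) choose ((b - 2 * i * a) * n))) * x ^ (b * n + 1 + \<mu>)"

text \<open>The lower bound is the single term near \<open>z0 n\<close>. For the upper bound the
  binomials with \<open>i = 1, 2\<close> are replaced by tangent bounds at \<open>s i\<close>, the
  ratio of lower to upper index at \<open>z0\<close>. The equation for \<open>z0\<close> says that
  the product of the \<open>1 - s i\<close> is \<open>x\<close>, so the
  \<open>\<mu>\<close>-dependence collapses to \<open>(1 - s 0)^\<mu>\<close> times the remaining
  binomial, a series with closed form.\<close>

lemma
  fixes a b :: nat and z0 x :: real
  assumes ab: "0 < a" "4 * a < b" and z0: "z0 > real b" and x: "0 < x" "x < 1"
    and eq: "(\<Prod>i<3. z0 - real (b - i * a)) = x * (\<Prod>i<3. z0 - real (i * a))"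
  shows summable_triple_term: "summable (triple_term a b x n)"
    and suminf_triple_term_pos: "0 < suminf (triple_term a b x n)"
    and ln_suminf_triple_term: "(\<lambda>n. ln (suminf (triple_term a b x n)) / real n) \<longlonglongrightarrow>
      (\<Sum>i<3. real (b - i * a) * ln (z0 - real (b - i * a)) - real (i * a) * ln (z0 - real (i * a))
          - real (b - 2 * i * a) * ln (real (b - 2 * i * a)))"
proof -
  define P Q m where "P i = z0 - real (i * a)" and "Q i = z0 - real (b - i * a)" and "m i = b - 2 * i * a" for i :: nat
  define s where "s i = real (m i) / P i" for i
  have ia: "i * a \<le> 2 * a" if "i < 3" for i using that by (intro mult_right_mono) auto
  have mb: "real (m i) = real b - 2 * real (i * a)" "real (b - i * a) = real b - real (i * a)" "m i > 0" if "i < 3" for i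
  proof -
    have e: "2 * i * a = 2 * (i * a)" and le: "2 * (i * a) < b" "i * a \<le> b"
      using ia[OF that] ab by linarith+
    show "real (m i) = real b - 2 * real (i * a)"
      unfolding m_def e using of_nat_diff[of "2 * (i * a)" b, where 'a = real] le by simp
    show "real (b - i * a) = real b - real (i * a)" using le by (intro of_nat_diff)
    show "m i > 0" unfolding m_def e using le by simp
  qed
  have Q: "Q i > 0" for i using z0 unfolding Q_def by (smt (verit) diff_le_self of_nat_mono)
  have PQ: "P i = Q i + real (m i)" if "i < 3" for i using mb[OF that] by (simp add: P_def Q_def)
  have P: "P i > 0" if "i < 3" for i using PQ[OF that] Q[of i] mb(3)[OF that] by simp
  have s: "0 < s i" "s i < 1" "1 - s i = Q i / P i" if "i < 3" for i
    using P[OF that] Q[of i] PQ[OF that] mb(3)[OF that] by (auto simp: s_def field_simps)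
  have eq': "(\<Prod>i<3. Q i) = x * (\<Prod>i<3. P i)"
    unfolding P_def Q_def by (rule eq)
  have "(\<Prod>i<3. 1 - s i) = (\<Prod>i<3. Q i) / (\<Prod>i<3. P i)"
    unfolding prod_dividef[symmetric] using s by (intro prod.cong) auto
  also have "\<dots> = x"
  proof -
    have "(\<Prod>i<3. P i) > 0" by (intro prod_pos P) auto
      then have ne: "(\<Prod>i<3. P i) \<noteq> 0" by linarith
    show ?thesis unfolding eq' by (rule nonzero_mult_div_cancel_right[OF ne])
  qed
  finally have sx: "(1 - s 0) * (1 - s 1) * (1 - s 2) = x"
    by (simp add: eval_nat_numeral)
  \<comment> \<open>All \<open>n\<close>-th powers of the majorant together. The factor
    \<open>1 / s 0 ^ b\<close> anticipates the sum of the closed series; it is compensated by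
    \<open>s 0 ^ (b * n)\<close> in \<open>bound\<close>.\<close>
  define K where "K = 1 / s 0 ^ b / s 1 ^ m 1 / s 2 ^ m 2 / (1 - s 1) ^ a / (1 - s 2) ^ (2 * a) * x ^ b"
  have s3: "0 < s 0" "s 0 < 1" "0 < s 1" "s 1 < 1" "0 < s 2" "s 2 < 1" using s by auto
  have bound: "triple_term a b x n \<mu> \<le> K ^ n * (x * s 0 ^ (b * n)) * (real ((\<mu> + b * n) choose (b * n)) * (1 - s 0) ^ \<mu>)" for n \<mu>
  proof -
    have c: "real ((b * n + \<mu> - i * a * n) choose (m i * n)) \<le> 1 / (s i ^ (m i * n) * (1 - s i) ^ (i * a * n + \<mu>))"
      if i: "i < 3" for i
    proof -
      have 1: "b * n = i * a * n + (m i * n + i * a * n)"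
      proof -
        have e: "2 * i * a = 2 * (i * a)" by simp
        have "b = i * a + (m i + i * a)" unfolding m_def e using ia[OF i] ab(2) by linarith
        then have "b * n = (i * a + (m i + i * a)) * n" by simp
        then show ?thesis by (simp add: distrib_right)
      qed
      have 2: "m i * n \<le> b * n + \<mu> - i * a * n" "b * n + \<mu> - i * a * n - m i * n = i * a * n + \<mu>"
        using 1 by simp_all
      show ?thesis using choose_le_tangent[OF s(1,2)[OF i] 2(1)] unfolding 2(2) .
    qed
    have "triple_term a b x n \<mu> = real ((b * n + \<mu>) choose (b * n)) *
        (real ((b * n + \<mu> - 1 * a * n) choose (m 1 * n)) * real ((b * n + \<mu> - 2 * a * n) choose (m 2 * n))) * x ^ (b * n + 1 + \<mu>)"
      by (simp add: triple_term_def sum_lessThan_3 eval_nat_numeral m_def)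
    also have "\<dots> \<le> real ((b * n + \<mu>) choose (b * n)) *
        (1 / (s 1 ^ (m 1 * n) * (1 - s 1) ^ (1 * a * n + \<mu>)) * (1 / (s 2 ^ (m 2 * n) * (1 - s 2) ^ (2 * a * n + \<mu>)))) * x ^ (b * n + 1 + \<mu>)"
      using x s3 by (intro mult_right_mono mult_left_mono mult_mono c) auto
    also have "x ^ (b * n + 1 + \<mu>) = x ^ (b * n) * x * ((1 - s 0) ^ \<mu> * (1 - s 1) ^ \<mu> * (1 - s 2) ^ \<mu>)"
      by (simp only: power_add power_one_right sx flip: power_mult_distrib)
    finally show ?thesis
      using s3 by (simp add: K_def power_add power_mult_distrib power_divide power_mult[symmetric] field_simps)
  qed
  have sums0: "(\<lambda>\<mu>. real ((\<mu> + b * n) choose (b * n)) * (1 - s 0) ^ \<mu>) sums (1 / s 0 ^ (b * n + 1))" for n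
    using choose_shift_sums[of "1 - s 0" "b * n" "b * n"] s3 by simp
  then have sums1: "(\<lambda>\<mu>. K ^ n * (x * s 0 ^ (b * n)) * (real ((\<mu> + b * n) choose (b * n)) * (1 - s 0) ^ \<mu>))
      sums (K ^ n * (x * s 0 ^ (b * n)) * (1 / s 0 ^ (b * n + 1)))" for n
    by (intro sums_mult)
  have nonneg: "triple_term a b x n \<mu> \<ge> 0" for n \<mu>
    unfolding triple_term_def using x by (intro mult_nonneg_nonneg prod_nonneg) auto
  show summ: "summable (triple_term a b x n)" for n
    by (rule summable_comparison_test'[OF sums_summable[OF sums1[of n]], of 0]) (use bound nonneg in auto)
  have K: "K > 0" unfolding K_def using s3 x by simp
  have upper: "suminf (triple_term a b x n) \<le> K ^ n * (x / s 0)" for n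
  proof -
    have "suminf (triple_term a b x n) \<le> K ^ n * (x * s 0 ^ (b * n)) * (1 / s 0 ^ (b * n + 1))"
      using sums_le[OF bound summable_sums[OF summ] sums1] .
    also have "\<dots> = K ^ n * (x / s 0)" using s3 by simp
    finally show ?thesis .
  qed
  have lower: "triple_term a b x n \<mu> \<le> suminf (triple_term a b x n)" for n \<mu>
    using sum_le_suminf[OF summ, of "{\<mu>}" n] nonneg by simp
  have mle: "(b - 2 * i * a) * n \<le> b * n + \<mu> - i * a * n" if "i < 3" for i n \<mu>
  proof -
    have e: "2 * i * a = 2 * (i * a)" by simp
    have "b - 2 * i * a + i * a \<le> b" unfolding e using ia[OF that] ab by linarith
    then have "(b - 2 * i * a + i * a) * n \<le> b * n" by (rule mult_right_mono) simp
    then show ?thesis by (simp add: distrib_right)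
  qed
  have tpos: "triple_term a b x n \<mu> > 0" for n \<mu>
    unfolding triple_term_def using x mle by (intro mult_pos_pos prod_pos) auto
  show pos: "0 < suminf (triple_term a b x n)" for n
    using lower[of n 0] tpos[of n 0] by linarith
  define L where "L = (\<Sum>i<3. real (b - i * a) * ln (z0 - real (b - i * a)) - real (i * a) * ln (z0 - real (i * a))
          - real (b - 2 * i * a) * ln (real (b - 2 * i * a)))"
  have lnx: "ln x = (\<Sum>i<3. ln (Q i) - ln (P i))"
  proof -
    have "x = (\<Prod>i<3. Q i) / (\<Prod>i<3. P i)"
    proof -
      have "(\<Prod>i<3. P i) > 0" by (intro prod_pos P) auto
      then have ne: "(\<Prod>i<3. P i) \<noteq> 0" by linarith
      show ?thesis unfolding eq' by (rule nonzero_mult_div_cancel_right[OF ne, symmetric])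
    qed
    moreover have "(\<Prod>i<3. Q i) > 0" "(\<Prod>i<3. P i) > 0" by (auto intro!: prod_pos P Q)
    ultimately have "ln x = ln (\<Prod>i<3. Q i) - ln (\<Prod>i<3. P i)"
      by (simp only: ln_div less_imp_neq[symmetric] simp_thms if_True)
    also have "\<dots> = (\<Sum>i<3. ln (Q i)) - (\<Sum>i<3. ln (P i))"
    proof -
      have "Q i \<noteq> 0" for i using Q[of i] by simp
      moreover have "P i \<noteq> 0" if "i \<in> {..<3}" for i using P[of i] that by auto
      ultimately show ?thesis by (subst (1 2) ln_prod) auto
    qed
    finally show ?thesis by (simp add: sum_subtractf)
  qed
  have LPQ: "L = (\<Sum>i<3. (real b - real (i * a)) * ln (Q i) - real (i * a) * ln (P i) - real (m i) * ln (real (m i)))"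
    unfolding L_def by (intro sum.cong refl) (simp add: P_def Q_def m_def mb)
  have lnK: "ln K = L"
  proof -
    have "ln K = - real b * ln (s 0) - real (m 1) * ln (s 1) - real (m 2) * ln (s 2) - real a * ln (1 - s 1) - real (2 * a) * ln (1 - s 2) + real b * ln x"
      unfolding K_def using s3 x by (simp add: ln_mult ln_div ln_realpow)
    also have "\<dots> = L"
    proof -
      have ls: "ln (s i) = ln (real (m i)) - ln (P i)" "ln (1 - s i) = ln (Q i) - ln (P i)" if "i < 3" for i
        using s(3)[OF that] P[OF that] Q[of i] mb(3)[OF that] by (simp_all add: s_def ln_div)
      have l012: "ln (s 0) = ln (real (m 0)) - ln (P 0)" "ln (s 1) = ln (real (m 1)) - ln (P 1)"
          "ln (s 2) = ln (real (m 2)) - ln (P 2)" "ln (1 - s 1) = ln (Q 1) - ln (P 1)" "ln (1 - s 2) = ln (Q 2) - ln (P 2)"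
        by (rule ls; simp)+
      have m: "m 0 = b" "real (m 1) * ln (P 1) = (real b - 2 * real a) * ln (P 1)"
          "real (m 2) * ln (P 2) = (real b - 4 * real a) * ln (P 2)"
        using mb(1)[of 1] mb(1)[of 2] by (simp_all add: m_def)
      show ?thesis
        unfolding LPQ lnx sum_lessThan_3 l012
        using m by (simp add: algebra_simps)
    qed
    finally show ?thesis .
  qed
  \<comment> \<open>Chosen so that \<open>bn + 1 + \<mu> n\<close> is close to
    \<open>z0 n\<close>.\<close>
  define \<mu> where "\<mu> n = nat \<lceil>(z0 - real b) * real n\<rceil>" for n :: nat
  let ?ch = "\<lambda>n i. real ((b * n + \<mu> n - i * a * n) choose ((b - 2 * i * a) * n))"
  let ?\<Lambda> = "\<lambda>i. P i * ln (P i) - real (m i) * ln (real (m i)) - (P i - real (m i)) * ln (P i - real (m i))"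
  have \<mu>lim: "(\<lambda>n. real (\<mu> n) / real n) \<longlonglongrightarrow> z0 - real b"
  proof -
    have "z0 - real b > 0" using z0 by simp
    then have "(\<lambda>n. real_of_int \<lceil>(z0 - real b) * real n\<rceil> / real n) \<longlonglongrightarrow> z0 - real b" by real_asymp
    moreover have "real (\<mu> n) = real_of_int \<lceil>(z0 - real b) * real n\<rceil>" for n
      unfolding \<mu>_def using z0 by (simp add: ceiling_le_zero order_less_le_trans[of _ 0])
    ultimately show ?thesis by simp
  qed
  have nn: "(\<lambda>n. real (c * n) / real n) \<longlonglongrightarrow> real c" for c :: nat
  proof (rule tendsto_eventually)
    show "\<forall>\<^sub>F n in sequentially. real (c * n) / real n = real c"
      using eventually_gt_at_top[of 0] by eventually_elim simp
  qed
  have clim: "(\<lambda>n. ln (?ch n i) / real n)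
      \<longlonglongrightarrow> ?\<Lambda> i" if i: "i < 3" for i
  proof (rule tendsto_ln_binomial)
    have "i * a \<le> b" using ia[OF i] ab by linarith
    then have le: "i * a * n \<le> b * n" for n by (rule mult_right_mono) simp
    have "(\<lambda>n. real (b * n) / real n + real (\<mu> n) / real n - real (i * a * n) / real n) \<longlonglongrightarrow> real b + (z0 - real b) - real (i * a)"
      by (intro tendsto_intros nn \<mu>lim)
    moreover have "real (b * n) / real n + real (\<mu> n) / real n - real (i * a * n) / real n = real (b * n + \<mu> n - i * a * n) / real n" for n
    proof -
      have "i * a * n \<le> b * n + \<mu> n" by (rule order_trans[OF le]) simp
      from of_nat_diff[OF this, where 'a = real] show ?thesis
        by (simp add: diff_divide_distrib add_divide_distrib)
    qed
    ultimately show "(\<lambda>n. real (b * n + \<mu> n - i * a * n) / real n) \<longlonglongrightarrow> P i" by (simp add: P_def)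
    show "(\<lambda>n. real ((b - 2 * i * a) * n) / real n) \<longlonglongrightarrow> real (m i)" unfolding m_def by (rule nn)
  qed (use mb(3)[OF i] PQ[OF i] Q[of i] mle[OF i] in auto)
  have xlim: "(\<lambda>n. real (b * n + 1 + \<mu> n) * ln x / real n) \<longlonglongrightarrow> (real b + 0 + (z0 - real b)) * ln x"
  proof -
    have "(\<lambda>n. 1 / real n) \<longlonglongrightarrow> 0" by real_asymp
    then have "(\<lambda>n. (real (b * n) / real n + 1 / real n + real (\<mu> n) / real n) * ln x) \<longlonglongrightarrow> (real b + 0 + (z0 - real b)) * ln x"
      by (intro tendsto_intros nn \<mu>lim)
    moreover have "(u / r + 1 / r + v / r) * l = (u + 1 + v) * l / r" for u v r l :: real
      by (simp add: algebra_simps add_divide_distrib)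
    ultimately show ?thesis by (simp only: of_nat_add of_nat_1)
  qed
  have tln: "ln (triple_term a b x n (\<mu> n)) / real n =
      (\<Sum>i<3. ln (?ch n i) / real n) + real (b * n + 1 + \<mu> n) * ln x / real n" for n
  proof -
    have 1: "(\<Prod>i<3. ?ch n i) > 0"
      using mle by (intro prod_pos) auto
    have 2: "ln (\<Prod>i<3. ?ch n i)
        = (\<Sum>i<3. ln (?ch n i))"
    proof (rule ln_prod)
      fix i :: nat assume "i \<in> {..<3}"
      then have "(b - 2 * i * a) * n \<le> b * n + \<mu> n - i * a * n" by (intro mle) simp
      then show "?ch n i \<noteq> 0" by simp
    qed simp
    have "ln (p * x ^ N) = ln p + real N * ln x" if "p > 0" for p N
      using that x by (simp add: ln_mult_pos ln_realpow)
    from this[OF 1] show ?thesis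
      unfolding triple_term_def 2 by (simp only: add_divide_distrib sum_divide_distrib)
  qed
  have "(\<lambda>n. ln (triple_term a b x n (\<mu> n)) / real n) \<longlonglongrightarrow>
      (\<Sum>i<3. ?\<Lambda> i) + (real b + 0 + (z0 - real b)) * ln x"
    unfolding tln by (intro tendsto_add tendsto_sum clim xlim) auto
  also have "(\<Sum>i<3. ?\<Lambda> i) + (real b + 0 + (z0 - real b)) * ln x = L"
  proof -
    have "(\<Sum>i<3. ?\<Lambda> i) + z0 * ln x
       = (\<Sum>i<3. ?\<Lambda> i + z0 * (ln (Q i) - ln (P i)))"
      unfolding lnx by (simp add: sum.distrib sum_distrib_left)
    also have "\<dots> = L"
      unfolding LPQ
    proof (intro sum.cong refl)
      fix i :: nat assume "i \<in> {..<3}"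
      then have i: "i < 3" by simp
      have pm: "P i - real (m i) = Q i" using PQ[OF i] by simp
      have eqs: "P i = z0 - real (i * a)" "Q i = z0 - (real b - real (i * a))"
        using mb[OF i] by (simp_all add: P_def Q_def)
      have gen: "(z0 - u) * lp - e - (z0 - v) * lq + z0 * (lq - lp) = v * lq - u * lp - e" for u v lp lq e :: real
        by (simp add: algebra_simps)
      show "?\<Lambda> i + z0 * (ln (Q i) - ln (P i))
         = (real b - real (i * a)) * ln (Q i) - real (i * a) * ln (P i) - real (m i) * ln (real (m i))"
        unfolding pm using gen[of "real (i * a)" "ln (P i)" "real (m i) * ln (real (m i))" "real b - real (i * a)" "ln (Q i)"]
        unfolding eqs[symmetric] .
    qed
    finally show ?thesis by simp
  qed
  finally have lowlim: "(\<lambda>n. ln (triple_term a b x n (\<mu> n)) / real n) \<longlonglongrightarrow> L" .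
  have "(\<lambda>n. ln (x / s 0) / real n) \<longlonglongrightarrow> 0" by real_asymp
  then have uplim: "(\<lambda>n. L + ln (x / s 0) / real n) \<longlonglongrightarrow> L" using tendsto_add[OF tendsto_const] by fastforce
  show "(\<lambda>n. ln (suminf (triple_term a b x n)) / real n) \<longlonglongrightarrow> L"
  proof (rule real_tendsto_sandwich[OF _ _ lowlim uplim])
    show "\<forall>\<^sub>F n in sequentially. ln (triple_term a b x n (\<mu> n)) / real n \<le> ln (suminf (triple_term a b x n)) / real n"
      using lower tpos pos by (intro always_eventually allI divide_right_mono) (auto simp: ln_le_cancel_iff)
    show "\<forall>\<^sub>F n in sequentially. ln (suminf (triple_term a b x n)) / real n \<le> L + ln (x / s 0) / real n"
      using eventually_gt_at_top[of 0]
    proof eventually_elim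
      case (elim n)
      have "ln (suminf (triple_term a b x n)) \<le> ln (K ^ n * (x / s 0))"
        using pos[of n] upper[of n] by (subst ln_le_cancel_iff) auto
      also have "\<dots> = real n * L + ln (x / s 0)"
        using K x s3 by (subst ln_mult) (auto simp: ln_realpow lnK)
      finally have "ln (suminf (triple_term a b x n)) / real n \<le> (real n * L + ln (x / s 0)) / real n"
        by (intro divide_right_mono) auto
      then show ?case using elim by (simp add: add_divide_distrib)
    qed
  qed
qed

section \<open>Decay of the linear form\<close>

definition kernel :: "nat \<Rightarrow> nat \<Rightarrow> real \<Rightarrow> nat \<Rightarrow> complex \<Rightarrow> complex" where
  "kernel a b x n z = node_prod (nodes a b n) z / of_nat (nodes_den a b n) * exp (z * of_real (ln x))"

definition kernel_deriv :: "nat \<Rightarrow> nat \<Rightarrow> real \<Rightarrow> nat \<Rightarrow> nat \<Rightarrow> real" where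
  "kernel_deriv a b x n \<nu> = ((\<Sum>s\<in>nodes a b n. node_prod (nodes a b n - {s}) (real \<nu>)) / real (nodes_den a b n)
     + node_prod (nodes a b n) (real \<nu>) / real (nodes_den a b n) * ln x) * x ^ \<nu>"

lemma node_prod_of_real: "node_prod I (of_real t :: complex) = of_real (node_prod I t)"
  by (simp add: node_prod_def)

lemma nodes_den_pos: "nodes_den a b n > 0"
  by (simp add: nodes_den_def prod_pos)

lemma has_field_derivative_node_prod:
  assumes "finite I"
  shows "(node_prod I has_field_derivative (\<Sum>s\<in>I. node_prod (I - {s}) z)) (at (z::'a::real_normed_field))"
proof -
  have "((\<lambda>z. \<Prod>r\<in>I. z - of_nat (snd r)) has_field_derivative
      (\<Sum>s\<in>I. 1 * (\<Prod>r\<in>I - {s}. z - of_nat (snd r)))) (at z)"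
    by (rule has_field_derivative_prod) (auto intro!: derivative_eq_intros)
  then show ?thesis by (simp add: node_prod_def[abs_def])
qed

lemma holomorphic_kernel: "kernel a b x n holomorphic_on S"
  unfolding kernel_def node_prod_def using nodes_den_pos[of a b n] by (intro holomorphic_intros) auto

lemma deriv_kernel:
  assumes "x > 0"
  shows "deriv (kernel a b x n) (of_nat \<nu>) = of_real (kernel_deriv a b x n \<nu>)"
proof (rule DERIV_imp_deriv)
  let ?I = "nodes a b n" and ?d = "of_nat (nodes_den a b n) :: complex" and ?z = "of_nat \<nu> :: complex"
  have e: "exp (?z * of_real (ln x)) = of_real (x ^ \<nu>)"
  proof -
    have "exp (?z * of_real (ln x)) = of_real (exp (real \<nu> * ln x))" by (simp flip: exp_of_real)
    also have "exp (real \<nu> * ln x) = x ^ \<nu>" using assms by (simp add: exp_of_nat_mult)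
    finally show ?thesis .
  qed
  have z: "?z = of_real (real \<nu>)" by simp
  have "(kernel a b x n has_field_derivative
      (\<Sum>s\<in>?I. node_prod (?I - {s}) ?z) / ?d * exp (?z * of_real (ln x))
      + node_prod ?I ?z / ?d * (exp (?z * of_real (ln x)) * of_real (ln x))) (at ?z)"
    unfolding kernel_def[abs_def]
    by (rule DERIV_cong[OF DERIV_mult[OF DERIV_cdivide[OF has_field_derivative_node_prod[OF finite_nodes]]
          DERIV_fun_exp[OF DERIV_cmult_right[OF DERIV_ident]]]]) (simp add: mult_ac)
  also have "(\<Sum>s\<in>?I. node_prod (?I - {s}) ?z) / ?d * exp (?z * of_real (ln x))
      + node_prod ?I ?z / ?d * (exp (?z * of_real (ln x)) * of_real (ln x)) = of_real (kernel_deriv a b x n \<nu>)"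
    unfolding e unfolding z node_prod_of_real by (simp add: kernel_deriv_def distrib_right distrib_left mult_ac)
  finally show "(kernel a b x n has_field_derivative of_real (kernel_deriv a b x n \<nu>)) (at ?z)" .
qed

text \<open>Such \<open>\<nu>\<close> belongs to the blocks 0 and 1, so it is at least a double zero
  and one zero factor survives the removal of any node.\<close>

lemma kernel_deriv_eq_0:
  assumes ab: "4 * a < b" and \<nu>: "a * n < \<nu>" "\<nu> \<le> (b - a) * n"
  shows "kernel_deriv a b x n \<nu> = 0"
    "(\<Sum>s\<in>nodes a b n. node_prod (nodes a b n - {s}) (real \<nu>)) = 0"
proof -
  let ?I = "nodes a b n"
  have "(b - a) * n \<le> b * n" by simp
  then have "\<nu> \<le> b * n" by (rule order_trans[OF \<nu>(2)])
  then have mem: "(0, \<nu>) \<in> ?I" "(1, \<nu>) \<in> ?I" using \<nu> by (auto simp: nodes_def)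
  have z: "node_prod I (real \<nu>) = 0" if "finite I" "(i, \<nu>) \<in> I" for I i
    unfolding node_prod_def using that by (intro prod_zero) force+
  have "node_prod (?I - {s}) (real \<nu>) = 0" for s
  proof (cases "s = (0, \<nu>)")
    case True
    then show ?thesis using mem by (intro z[where i = 1]) auto
  next
    case False
    then show ?thesis using mem by (intro z[where i = 0]) auto
  qed
  then show s: "(\<Sum>s\<in>?I. node_prod (?I - {s}) (real \<nu>)) = 0" by simp
  have "node_prod ?I (real \<nu>) = 0" using mem by (intro z[where i = 0]) auto
  then show "kernel_deriv a b x n \<nu> = 0" unfolding kernel_deriv_def s by simp
qed

lemma norm_kernel:
  assumes "x > 0"
  shows "norm (kernel a b x n z) = (\<Prod>r\<in>nodes a b n. norm (z - of_nat (snd r))) / real (nodes_den a b n) * x powr Re z"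
  using assms by (simp add: kernel_def node_prod_def norm_mult norm_divide powr_def flip: prod_norm)

lemma nodes_snd_le:
  assumes "r \<in> nodes a b n"
  shows "snd r \<le> b * n"
proof -
  obtain i j where r: "r = (i, j)" "j \<le> (b - i * a) * n" using assms by (auto simp: nodes_def)
  have "(b - i * a) * n \<le> b * n" by simp
  then have "j \<le> b * n" by (rule order_trans[OF r(2)])
  then show ?thesis using r(1) by simp
qed

text \<open>A crude bound in the whole plane; it serves only to discard the far sides of the
  rectangle.\<close>

lemma norm_kernel_growth:
  assumes x: "x > 0"
  shows "norm (kernel a b x n z) \<le> (1 + real (b * n)) ^ card (nodes a b n) / real (nodes_den a b n) * (1 + norm z) ^ card (nodes a b n) * x powr Re z"
proof -
  have "norm (z - of_nat (snd r)) \<le> (1 + real (b * n)) * (1 + norm z)" if "r \<in> nodes a b n" for r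
  proof -
    have "norm (z - of_nat (snd r)) \<le> norm z + real (snd r)"
      using norm_triangle_ineq4[of z "of_nat (snd r)"] by simp
    also have "\<dots> \<le> norm z + real (b * n)" using nodes_snd_le[OF that] by (simp del: of_nat_mult)
    also have "\<dots> \<le> (1 + real (b * n)) * (1 + norm z)" by (simp add: algebra_simps)
    finally show ?thesis .
  qed
  then have "(\<Prod>r\<in>nodes a b n. norm (z - of_nat (snd r))) \<le> (\<Prod>r\<in>nodes a b n. (1 + real (b * n)) * (1 + norm z))"
    by (intro prod_mono) auto
  also have "\<dots> = (1 + real (b * n)) ^ card (nodes a b n) * (1 + norm z) ^ card (nodes a b n)"
    by (simp add: power_mult_distrib)
  finally show ?thesis
    unfolding norm_kernel[OF x] using x
    by (simp add: divide_right_mono mult_right_mono)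
qed

lemma power_le_fact_exp:
  fixes t :: real
  assumes "t \<ge> 0"
  shows "t ^ k \<le> fact k * exp t"
proof -
  have "(\<Sum>i\<in>{k}. t ^ i /\<^sub>R fact i) \<le> (\<Sum>i. t ^ i /\<^sub>R fact i)"
    using assms by (intro sum_le_suminf summable_exp_generic) auto
  then have "t ^ k / fact k \<le> exp t" by (simp add: exp_def divide_inverse mult.commute)
  then show ?thesis by (simp add: pos_divide_le_eq mult.commute)
qed

text \<open>Beyond height \<open>n T\<close> the linear decay of the phase beats the polynomial factor, so the bound stays integrable in \<open>y\<close>.\<close>
lemma norm_kernel_line:
  fixes a b n :: nat and c c' x T \<Phi> :: real
  assumes ab: "a > 0" "4 * a < b" and n: "n \<ge> 1" and x: "0 < x" "x < 1"
    and c: "real b / 2 < c" "c < real b" and c': "\<bar>c' - real n * c\<bar> \<le> 1" and T: "T > 0"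
    and phase: "\<And>y. y > 0 \<Longrightarrow> line_phase (real a) (real b) c y \<le> \<Phi> - max 0 (y - T)"
    and y: "y > 0"
  shows "norm (kernel a b x n (Complex c' y)) \<le>
     (exp 10 * fact 11 * (T + 4 * real b) ^ 11 / x) * real n ^ 11 *
       exp (real n * (\<Phi> + c * ln x - (\<Sum>i<3. real (b - 2 * i * a) * ln (real (b - 2 * i * a))))) * exp (2 * pi * y) / (1 + y\<^sup>2)"
proof -
  let ?num = "\<Prod>r\<in>nodes a b n. norm (Complex c' y - of_nat (snd r))"
  let ?bl = "\<lambda>i. \<Prod>j\<in>{i * a * n<..(b - i * a) * n}. norm (Complex c' y - of_nat j)"
  define m where "m i = b - 2 * i * a" for i :: nat
  define t where "t = y / real n"
  define Z where "Z = y + 4 * real (b * n)"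
  have np: "real n > 0" using n by simp
  have b0: "b \<ge> 1" and bn: "real (b * n) \<ge> 1" using ab n by (auto simp: Suc_le_eq simp del: of_nat_mult)
  have t: "t > 0" "y = real n * t" using y np by (auto simp: t_def)
  have ia: "i * a \<le> 2 * a" if "i < 3" for i using that by (intro mult_right_mono) auto
  have mb: "real (m i) = real b - 2 * (real i * real a)" "real (b - i * a) = real b - real i * real a" "m i > 0"
      "i * a * n \<le> (b - i * a) * n" "i * a \<le> b - i * a"
    if "i < 3" for i
  proof -
    have e: "2 * i * a = 2 * (i * a)" and le: "2 * (i * a) < b" "i * a \<le> b"
      using ia[OF that] ab by linarith+
    show "real (m i) = real b - 2 * (real i * real a)"
      unfolding m_def e using of_nat_diff[of "2 * (i * a)" b, where 'a = real] le by simp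
    show "real (b - i * a) = real b - real i * real a" using of_nat_diff[OF le(2), where 'a = real] by simp
    show "m i > 0" unfolding m_def e using le by simp
    show "i * a \<le> b - i * a" using le by simp
    then show "i * a * n \<le> (b - i * a) * n" by (rule mult_right_mono) simp
  qed
  define E where "E i = lnprim (c - real i * real a) t - lnprim (c - (real b - real i * real a)) t" for i :: nat
  let ?ex = "\<lambda>i. real n * E i + real n * real (m i) * ln (real n) - real (m i * n)"
  let ?ph = "line_phase (real a) (real b) c t"
  have brick: "?bl i
      \<le> exp 3 * Z ^ 3 * exp (?ex i)" if i: "i < 3" for i
  proof -
    have rbn: "real ((b - i * a) * n) = (real b - real i * real a) * real n"
      by (simp only: of_nat_mult mb(2)[OF i])
    have "?bl i
      \<le> exp 3 * Z ^ 3 * exp (lnprim (real n * c - real (i * a * n)) y - lnprim (real n * c - real ((b - i * a) * n)) y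
          - (real ((b - i * a) * n) - real (i * a * n)))"
    proof (rule norm_prod_nodes_le[OF y c' mb(4)[OF i]])
      have "real (i * a) \<le> real b / 2"
      proof -
        define k where "k = i * a"
        have "2 * k \<le> b" using ia[OF i] ab unfolding k_def by linarith
        then have "real k \<le> real b / 2" by simp
        then show ?thesis unfolding k_def .
      qed
      then have "real (i * a) \<le> c" using c by linarith
      then have "real (i * a) * real n \<le> c * real n" by (rule mult_right_mono) simp
      then show "real (i * a * n) \<le> real n * c" by (simp add: mult_ac)
      have "real n * c \<le> real (b * n)" using c np by (simp add: mult.commute)
      moreover have "real ((b - i * a) * n) \<le> real (b * n)" by (intro of_nat_mono mult_right_mono) auto
      ultimately show "y + real n * c + real ((b - i * a) * n) + 2 \<le> Z" using bn unfolding Z_def by linarith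
    qed
    also have "real n * c - real (i * a * n) = real n * (c - real i * real a)" by (simp add: algebra_simps)
    also have "real n * c - real ((b - i * a) * n) = real n * (c - (real b - real i * real a))"
      unfolding rbn by (simp add: algebra_simps)
    also have "real ((b - i * a) * n) - real (i * a * n) = real (m i * n)"
      unfolding rbn unfolding of_nat_mult mb(1)[OF i] by (simp add: algebra_simps)
    also have "lnprim (real n * (c - real i * real a)) y - lnprim (real n * (c - (real b - real i * real a))) y
        = real n * E i + real n * real (m i) * ln (real n)"
      unfolding t(2) lnprim_scale[OF np t(1)] E_def mb(1)[OF i] by (simp add: algebra_simps)
    finally show ?thesis .
  qed
  define ent where "ent = (\<Sum>i<3. real (m i) * ln (real (m i)))"
  have den: "real (nodes_den a b n) \<ge> exp (\<Sum>i<3. real (m i * n) * ln (real (m i * n)) - real (m i * n))"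
  proof -
    have "exp (real (m i * n) * ln (real (m i * n)) - real (m i * n)) \<le> fact (m i * n)" for i
      using ln_fact_ge[of "m i * n"] by (subst ln_ge_iff[symmetric]) auto
    then show ?thesis unfolding nodes_den_def m_def
      by (simp add: exp_sum prod_mono)
  qed
  have "?num
      = (\<Prod>i<3. ?bl i)"
    unfolding nodes_def by (subst prod.Sigma) (auto simp: case_prod_beta)
  also have "\<dots> \<le> (\<Prod>i<3. exp 3 * Z ^ 3 * exp (?ex i))"
    using brick by (intro prod_mono) (auto intro: prod_nonneg)
  also have "\<dots> = exp 9 * Z ^ 9 * exp (\<Sum>i<3. ?ex i)"
  proof -
    have "(exp 3 :: real) ^ 3 = exp 9" using exp_of_nat_mult[of 3 "3 :: real"] by simp
    then show ?thesis by (simp add: prod.distrib exp_sum power_mult_distrib power_mult[symmetric])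
  qed
  finally have num: "?num
      \<le> exp 9 * Z ^ 9 * exp (\<Sum>i<3. ?ex i)" .
  have Z0: "Z \<ge> 0" using y by (simp add: Z_def)
  have "?num / real (nodes_den a b n)
      \<le> exp 9 * Z ^ 9 * exp (\<Sum>i<3. ?ex i)
        / exp (\<Sum>i<3. real (m i * n) * ln (real (m i * n)) - real (m i * n))"
    using num den Z0 by (intro frac_le) auto
  also have "\<dots> = exp 9 * Z ^ 9 * exp ((\<Sum>i<3. ?ex i)
        - (\<Sum>i<3. real (m i * n) * ln (real (m i * n)) - real (m i * n)))"
    by (simp add: exp_diff)
  \<comment> \<open>The \<open>ln n\<close> terms created by scaling and the linear terms
    \<open>m i n\<close> are matched exactly by the lower bounds for the factorials.\<close>
  also have "(\<Sum>i<3. ?ex i)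
        - (\<Sum>i<3. real (m i * n) * ln (real (m i * n)) - real (m i * n))
      = (\<Sum>i<3. real n * E i - real n * (real (m i) * ln (real (m i))))"
    unfolding sum_subtractf[symmetric]
  proof (intro sum.cong refl)
    fix i :: nat assume "i \<in> {..<3}"
    then have "ln (real (m i * n)) = ln (real (m i)) + ln (real n)"
      using mb(3)[of i] np by (simp add: ln_mult)
    then show "?ex i - (real (m i * n) * ln (real (m i * n)) - real (m i * n))
        = real n * E i - real n * (real (m i) * ln (real (m i)))"
      by (simp add: algebra_simps)
  qed
  also have "(\<Sum>i<3. real n * E i - real n * (real (m i) * ln (real (m i))))
      = real n * (?ph - ent) + 2 * pi * y"
    unfolding line_phase_def E_def[symmetric] ent_def t(2)
    by (simp add: sum_subtractf sum_distrib_left algebra_simps)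
  finally have ratio: "?num / real (nodes_den a b n)
      \<le> exp 9 * Z ^ 9 * exp (real n * (?ph - ent) + 2 * pi * y)" .
  define s where "s = max 0 (y - real n * T)"
  have s0: "s \<ge> 0" by (simp add: s_def)
  have "real n * max 0 (t - T) = s"
    using np by (simp add: s_def t(2) max_mult_distrib_left right_diff_distrib)
  then have "real n * (?ph - ent) \<le> real n * (\<Phi> - ent) - s"
    using mult_left_mono[OF phase[OF t(1)], of "real n"] np by (simp add: algebra_simps)
  then have "exp 9 * Z ^ 9 * exp (real n * (?ph - ent) + 2 * pi * y)
      \<le> exp 9 * Z ^ 9 * exp (real n * (\<Phi> - ent) - s + 2 * pi * y)"
    using Z0 by (intro mult_left_mono) auto
  with ratio have ratio2: "?num / real (nodes_den a b n)
      \<le> exp 9 * Z ^ 9 * exp (real n * (\<Phi> - ent) - s + 2 * pi * y)" by linarith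
  \<comment> \<open>The line may lie up to 1 to the left of \<open>n c\<close>, which costs one
    factor \<open>1/x\<close>.\<close>
  have xp: "x powr c' \<le> exp (real n * c * ln x) / x"
  proof -
    have "x powr c' \<le> x powr (real n * c - 1)" using x c' by (intro powr_mono') auto
    then show ?thesis using x by (simp add: powr_diff) (simp add: powr_def mult_ac)
  qed
  \<comment> \<open>The exponent 11 is three blocks times three plus two for \<open>1 + y^2\<close>.
    \<open>Z\<close> is at most \<open>n (T + 4b) (1 + s)\<close>, and powers of
    \<open>1 + s\<close> are absorbed by \<open>exp (- s)\<close>.\<close>
  have poly: "Z ^ 9 * (1 + y\<^sup>2) * exp (- s) \<le> exp 1 * fact 11 * (T + 4 * real b) ^ 11 * real n ^ 11"
  proof -
    have "1 + y\<^sup>2 \<le> Z\<^sup>2"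
    proof -
      have "1 + y\<^sup>2 \<le> (1 + y)\<^sup>2" using y by (simp add: power2_sum)
      also have "\<dots> \<le> Z\<^sup>2" using y bn by (intro power_mono) (auto simp: Z_def)
      finally show ?thesis .
    qed
    then have "Z ^ 9 * (1 + y\<^sup>2) \<le> Z ^ 9 * Z\<^sup>2" using Z0 by (intro mult_left_mono) auto
    also have "\<dots> = Z ^ 11" by (simp flip: power_add)
    also have "\<dots> \<le> (real n * (T + 4 * real b) * (1 + s)) ^ 11"
    proof (intro power_mono Z0)
      have "Z \<le> s + real n * (T + 4 * real b)" by (auto simp: Z_def s_def algebra_simps)
      also have "s \<le> real n * (T + 4 * real b) * s"
      proof -
        have "1 \<le> real n * (T + 4 * real b)"
        proof -
          have "0 \<le> real n * T" using T by simp
          moreover have "real n * (T + 4 * real b) = real n * T + 4 * real (b * n)" by (simp add: algebra_simps)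
          ultimately show ?thesis using bn by linarith
        qed
        then show ?thesis using mult_right_mono[OF _ s0, of 1 "real n * (T + 4 * real b)"] by simp
      qed
      finally show "Z \<le> real n * (T + 4 * real b) * (1 + s)" by (simp add: algebra_simps)
    qed
    also have "\<dots> = (T + 4 * real b) ^ 11 * real n ^ 11 * (1 + s) ^ 11" by (simp add: power_mult_distrib mult_ac)
    also have "\<dots> \<le> (T + 4 * real b) ^ 11 * real n ^ 11 * (fact 11 * exp (1 + s))"
      using power_le_fact_exp[of "1 + s" 11] s0 T by (intro mult_left_mono) auto
    finally have "Z ^ 9 * (1 + y\<^sup>2) * exp (- s) \<le> (T + 4 * real b) ^ 11 * real n ^ 11 * (fact 11 * exp (1 + s)) * exp (- s)"
      by (intro mult_right_mono) auto
    also have "\<dots> = (T + 4 * real b) ^ 11 * real n ^ 11 * fact 11 * (exp (1 + s) * exp (- s))" by simp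
    also have "exp (1 + s) * exp (- s) = exp 1" by (simp flip: exp_add)
    finally show ?thesis by (simp add: mult_ac)
  qed
  have "norm (kernel a b x n (Complex c' y)) * (1 + y\<^sup>2)
      \<le> exp 9 * Z ^ 9 * exp (real n * (\<Phi> - ent) - s + 2 * pi * y) * (exp (real n * c * ln x) / x) * (1 + y\<^sup>2)"
    unfolding norm_kernel[OF x(1)] complex.sel using xp ratio2 Z0
    by (intro mult_right_mono mult_mono) auto
  also have "\<dots> = exp 9 / x * (Z ^ 9 * (1 + y\<^sup>2) * exp (- s)) * (exp (real n * (\<Phi> + c * ln x - ent)) * exp (2 * pi * y))"
  proof -
    have "exp (real n * (\<Phi> - ent) - s + 2 * pi * y) = exp (real n * (\<Phi> - ent)) * exp (- s) * exp (2 * pi * y)"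
      "exp (real n * (\<Phi> + c * ln x - ent)) = exp (real n * (\<Phi> - ent)) * exp (real n * c * ln x)"
      by (simp_all flip: exp_add add: algebra_simps)
    then show ?thesis by (simp only:) (simp add: mult_ac)
  qed
  also have "\<dots> \<le> exp 9 / x * (exp 1 * fact 11 * (T + 4 * real b) ^ 11 * real n ^ 11) * (exp (real n * (\<Phi> + c * ln x - ent)) * exp (2 * pi * y))"
    using poly x by (intro mult_right_mono mult_left_mono) auto
  also have "\<dots> = (exp 10 * fact 11 * (T + 4 * real b) ^ 11 / x) * real n ^ 11 * exp (real n * (\<Phi> + c * ln x - ent)) * exp (2 * pi * y)"
  proof -
    have e: "exp (10::real) = exp 9 * exp 1" by (simp flip: exp_add)
    show ?thesis unfolding e by (simp add: mult_ac)
  qed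
  finally show ?thesis unfolding ent_def m_def by (subst pos_le_divide_eq) (auto intro: add_pos_nonneg)
qed

text \<open>Both terms depending on the position of \<open>w\<close> drop out: the one in
  \<open>Im w\<close> because the angle is \<open>2 pi\<close>, the one in \<open>Re w\<close>
  because the modulus of the equation expresses \<open>ln x\<close> through the same
  logarithms.\<close>

lemma line_phase_at_critical_point:
  fixes a b x :: real and w :: complex
  assumes x: "x > 0" and w: "Im w > 0" and crit: "line_angle a b (Re w) (Im w) = 2 * pi"
    and eq: "(\<Prod>i<(3::nat). w - of_real (real i * a)) / (\<Prod>i<(3::nat). w - of_real (b - real i * a)) = of_real (1 / x)"
  shows "line_phase a b (Re w) (Im w) + Re w * ln x
    = (\<Sum>i<(3::nat). (b - real i * a) * ln (norm (w - of_real (b - real i * a))) - real i * a * ln (norm (w - of_real (real i * a))))"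
proof -
  let ?N = "\<Prod>i<(3::nat). norm (w - of_real (real i * a))" and ?D = "\<Prod>i<(3::nat). norm (w - of_real (b - real i * a))"
  define c Y where "c = Re w" and "Y = Im w"
  define l where "l v = ln (norm (w - of_real v))" for v
  have pos: "norm (w - of_real v) > 0" for v using w by (auto simp: complex_eq_iff)
  have prim: "lnprim (c - v) Y = (c - v) * l v + Y * arctan ((c - v) / Y)" for v
  proof -
    have "norm (w - of_real v) = sqrt ((c - v)\<^sup>2 + Y\<^sup>2)" by (simp add: cmod_def c_def Y_def)
    then show ?thesis by (simp add: lnprim_def l_def ln_sqrt)
  qed
  have "norm ((\<Prod>i<(3::nat). w - of_real (real i * a)) / (\<Prod>i<(3::nat). w - of_real (b - real i * a))) = 1 / x"
    unfolding eq using x by (simp add: norm_divide)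
  then have "?N / ?D = 1 / x"
    by (simp only: norm_divide prod_norm)
  then have h1: "ln (?N / ?D) = ln (1 / x)"
    by (rule arg_cong)
  have h2: "ln (?N / ?D)
      = ln ?N - ln ?D"
    by (rule ln_divide_pos) (intro prod_pos pos)+
  have h3: "ln (\<Prod>i<(3::nat). norm (w - of_real (g i))) = (\<Sum>i<(3::nat). l (g i))" for g
    unfolding l_def using pos by (intro ln_prod finite_lessThan less_imp_neq[symmetric])
  have lnx: "ln x = (\<Sum>i<(3::nat). l (b - real i * a) - l (real i * a))"
  proof -
    have "ln (1 / x) = - ln x" using x by (simp add: ln_div)
    then show ?thesis
      unfolding sum_subtractf using h1 h2 h3[of "\<lambda>i. real i * a"] h3[of "\<lambda>i. b - real i * a"] by linarith
  qed
  have "line_phase a b c Y = (\<Sum>i<(3::nat). (c - real i * a) * l (real i * a) - (c - (b - real i * a)) * l (b - real i * a))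
      + Y * line_angle a b c Y - 2 * pi * Y"
    unfolding line_phase_def line_angle_def prim by (simp add: sum_distrib_left sum.distrib sum_subtractf right_diff_distrib)
  also have "\<dots> = (\<Sum>i<(3::nat). (c - real i * a) * l (real i * a) - (c - (b - real i * a)) * l (b - real i * a))"
    using crit by (simp add: c_def Y_def)
  finally have "line_phase a b c Y + c * ln x =
      (\<Sum>i<(3::nat). (c - real i * a) * l (real i * a) - (c - (b - real i * a)) * l (b - real i * a)
         + c * (l (b - real i * a) - l (real i * a)))"
    unfolding lnx by (simp add: sum.distrib sum_distrib_left)
  also have "\<dots> = (\<Sum>i<(3::nat). (b - real i * a) * l (b - real i * a) - real i * a * l (real i * a))"
    by (intro sum.cong refl) (simp add: algebra_simps)
  finally show ?thesis by (simp add: l_def c_def Y_def)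
qed

text \<open>All starting indices between \<open>an + 1\<close> and \<open>(b-a)n + 1\<close> give
  the same sum, since the terms between them are zero. This links the arithmetic start
  \<open>c\<close> with the start dictated by the contour.\<close>

lemma kernel_deriv_sums_shift:
  assumes ab: "4 * a < b" and j: "a * n < j" "j \<le> (b - a) * n + 1"
  shows "(\<lambda>\<nu>. kernel_deriv a b x n (j + \<nu>)) sums V \<longleftrightarrow> (\<lambda>\<nu>. if \<nu> \<le> (b - a) * n then 0 else kernel_deriv a b x n \<nu>) sums V"
proof -
  let ?g = "\<lambda>\<nu>. if \<nu> \<le> (b - a) * n then 0 else kernel_deriv a b x n \<nu>"
  have "(\<lambda>\<nu>. kernel_deriv a b x n (j + \<nu>)) = (\<lambda>\<nu>. ?g (\<nu> + j))"
    using kernel_deriv_eq_0(1)[OF ab] j by (auto simp: add.commute)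
  then show ?thesis using sums_zero_iff_shift[of j ?g V] j by simp
qed

lemma kernel_deriv_sum_le:
  fixes a b :: nat and x :: real and w :: complex
  assumes ab: "a > 0" "4 * a < b" and x: "0 < x" "x < 1" and w: "Im w > 0"
    and eq: "(\<Prod>i<(3::nat). w - of_real (real i * real a)) / (\<Prod>i<(3::nat). w - of_real (real b - real i * real a)) = of_real (1 / x)"
  shows "\<exists>K>0. \<forall>n\<ge>1. \<forall>j V. a * n < j \<longrightarrow> j \<le> (b - a) * n + 1 \<longrightarrow> (\<lambda>\<nu>. kernel_deriv a b x n (j + \<nu>)) sums V \<longrightarrow>
     \<bar>V\<bar> \<le> K * real n ^ 11 * exp (real n * (\<Sum>i<(3::nat). (real b - real i * real a) * ln (norm (w - of_real (real b - real i * real a)))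
        - real i * real a * ln (norm (w - of_real (real i * real a))) - real (b - 2 * i * a) * ln (real (b - 2 * i * a))))"
proof -
  define G where "G = (\<Sum>i<(3::nat). (real b - real i * real a) * ln (norm (w - of_real (real b - real i * real a)))
        - real i * real a * ln (norm (w - of_real (real i * real a))) - real (b - 2 * i * a) * ln (real (b - 2 * i * a)))"
  define c Y \<Phi> where "c = Re w" and "Y = Im w" and "\<Phi> = line_phase (real a) (real b) (Re w) (Im w)"
  have rab: "real a > 0" "real b > 4 * real a" using ab by auto
  have x1: "1 / x > 1" using x by simp
  note cp = critical_point[OF rab x1 w eq]
  have c: "real b / 2 < c" "c < real b - real a" using cp by (simp_all add: c_def)
  have G: "G = \<Phi> + c * ln x - (\<Sum>i<3. real (b - 2 * i * a) * ln (real (b - 2 * i * a)))"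
    using line_phase_at_critical_point[OF x(1) w cp(3) eq] by (simp add: G_def \<Phi>_def c_def sum_subtractf)
  obtain T where T: "T > 0" "\<And>y. y > 0 \<Longrightarrow> line_phase (real a) (real b) c y \<le> \<Phi> - max 0 (y - T)"
    using line_phase_le[OF rab c, of Y] cp(3) w unfolding \<Phi>_def c_def Y_def by blast
  define K0 where "K0 = exp 10 * fact 11 * (T + 4 * real b) ^ 11 / x"
  have K0: "K0 > 0" unfolding K0_def using T x by (intro divide_pos_pos mult_pos_pos zero_less_power) auto
  define K where "K = 2 * pi\<^sup>2 * K0 * exp (2 * pi)"
  have "\<bar>V\<bar> \<le> K * real n ^ 11 * exp (real n * G)"
    if n: "n \<ge> 1" and j: "a * n < j" "j \<le> (b - a) * n + 1" and V: "(\<lambda>\<nu>. kernel_deriv a b x n (j + \<nu>)) sums V" for n j V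
  proof -
    define A0 where "A0 = K0 * real n ^ 11 * exp (real n * G)"
    have A0: "A0 > 0" unfolding A0_def using K0 n by (intro mult_pos_pos) auto
    \<comment> \<open>The line \<open>Re z = k - 1/2\<close> is the half-integer line nearest to
      \<open>n c\<close>, up to ties.\<close>
    define k where "k = nat \<lfloor>real n * c\<rfloor> + 1"
    define c' where "c' = real k - 1 / 2"
    have c0: "c > 0" using c rab by linarith
    have np: "real n > 0" using n by simp
    have rk: "real k = real_of_int \<lfloor>real n * c\<rfloor> + 1" using c0 by (simp add: k_def)
    have c': "\<bar>c' - real n * c\<bar> \<le> 1" unfolding c'_def rk by linarith
    have k: "a * n < k" "k \<le> (b - a) * n + 1"
    proof -
      have "real a * real n \<le> c * real n" using c rab by (intro mult_right_mono) auto
      then have "real (a * n) < real k" unfolding rk by (simp add: mult.commute) linarith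
      then show "a * n < k" by (simp only: of_nat_less_iff)
      have "c * real n < (real b - real a) * real n" using c np by (intro mult_strict_right_mono) auto
      also have "(real b - real a) * real n = real ((b - a) * n)" using ab by (simp add: of_nat_diff)
      finally have "real k < real ((b - a) * n) + 1 + 1" unfolding rk by (simp add: mult.commute) linarith
      then have "real k < real ((b - a) * n + 1 + 1)" by simp
      then show "k \<le> (b - a) * n + 1" by (simp only: of_nat_less_iff)
    qed
    have sym: "norm (kernel a b x n (Complex c' (- y))) = norm (kernel a b x n (Complex c' y))" for y
    proof -
      have "norm (Complex c' (- y) - of_nat i) = norm (Complex c' y - of_nat i)" for i by (simp add: cmod_def)
      then show ?thesis using x by (simp add: norm_kernel)
    qed
    have line: "norm (kernel a b x n (Complex c' y)) \<le> A0 * exp (2 * pi * y) / (1 + y\<^sup>2)" if "y > 0" for y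
    proof -
      have "c < real b" using c rab by linarith
      from norm_kernel_line[OF ab n x c(1) this c' T(1) T(2) that]
      show ?thesis unfolding A0_def K0_def G by simp
    qed
    \<comment> \<open>The line estimate needs \<open>y > 0\<close>. Negative heights follow by
      conjugation; height 0 is compared with height 1, where every factor is larger, at the price of
      \<open>exp (2 * pi)\<close>.\<close>
    have bound: "norm (kernel a b x n (Complex c' y)) \<le> A0 * exp (2 * pi) * exp (2 * pi * \<bar>y\<bar>) / (1 + y\<^sup>2)" for y
    proof (cases "y = 0")
      case True
      have "norm (Complex c' 0 - of_nat i) \<le> norm (Complex c' 1 - of_nat i)" for i
        by (simp add: cmod_def real_le_rsqrt)
      then have "norm (kernel a b x n (Complex c' 0)) \<le> norm (kernel a b x n (Complex c' 1))"
        using x unfolding norm_kernel[OF x(1)] complex.sel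
        by (intro mult_right_mono divide_right_mono prod_mono) auto
      also have "\<dots> \<le> A0 * exp (2 * pi) / 2" using line[of 1] by simp
      also have "\<dots> \<le> A0 * exp (2 * pi)" using A0 by simp
      finally show ?thesis using True by simp
    next
      case False
      have "norm (kernel a b x n (Complex c' y)) = norm (kernel a b x n (Complex c' \<bar>y\<bar>))"
        using sym[of y] by (cases "y \<ge> 0") auto
      also have "\<dots> \<le> A0 * exp (2 * pi * \<bar>y\<bar>) / (1 + y\<^sup>2)" using line[of "\<bar>y\<bar>"] False by simp
      also have "\<dots> \<le> A0 * exp (2 * pi) * exp (2 * pi * \<bar>y\<bar>) / (1 + y\<^sup>2)"
      proof (intro divide_right_mono mult_right_mono)
        have "1 \<le> exp (2 * pi)" by simp
        then show "A0 \<le> A0 * exp (2 * pi)" using A0 by (simp del: one_le_exp_iff)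
      qed (auto intro: add_nonneg_nonneg)
      finally show ?thesis .
    qed
    have "(\<lambda>\<nu>. kernel_deriv a b x n (k + \<nu>)) sums V"
      using V kernel_deriv_sums_shift[OF ab(2) j] kernel_deriv_sums_shift[OF ab(2) k] by simp
    then have "(\<lambda>\<nu>. of_real (kernel_deriv a b x n (k + \<nu>))) sums (of_real V :: complex)"
      by (simp add: sums_of_real_iff)
    then have sums: "(\<lambda>\<nu>. deriv (kernel a b x n) (of_nat (k + \<nu>))) sums (of_real V)"
      by (simp only: deriv_kernel[OF x(1)])
    have "norm (of_real V :: complex) \<le> 2 * pi\<^sup>2 * (A0 * exp (2 * pi))"
      by (rule norm_suminf_deriv_le[OF holomorphic_kernel _ x _ _ norm_kernel_growth[OF x(1)] bound[unfolded c'_def] sums])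
         (use A0 k in auto)
    then show ?thesis by (simp add: K_def A0_def mult_ac)
  qed
  moreover have "K > 0" unfolding K_def using K0 by simp
  ultimately show ?thesis unfolding G_def[symmetric] by blast
qed

section \<open>Integrality of the linear form\<close>

text \<open>\<open>R(c + t)\<close> with \<open>c = (bn + 1)/2\<close>; the division is exact when
  \<open>b\<close> and \<open>n\<close> are odd.\<close>

definition centered_poly :: "nat \<Rightarrow> nat \<Rightarrow> nat \<Rightarrow> real poly" where
  "centered_poly a b n = smult (1 / real (nodes_den a b n))
     (\<Prod>r\<in>nodes a b n. [:real ((b * n + 1) div 2) - real (snd r), 1:])"

lemma poly_centered_poly:
  "poly (centered_poly a b n) t = node_prod (nodes a b n) (real ((b * n + 1) div 2) + t) / real (nodes_den a b n)"
  by (simp add: centered_poly_def poly_prod node_prod_def algebra_simps)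

lemma poly_pderiv_centered_poly:
  "poly (pderiv (centered_poly a b n)) t =
     (\<Sum>s\<in>nodes a b n. node_prod (nodes a b n - {s}) (real ((b * n + 1) div 2) + t)) / real (nodes_den a b n)"
  by (simp add: centered_poly_def pderiv_smult pderiv_prod poly_sum poly_prod node_prod_def pderiv_pCons algebra_simps)

lemma card_nodes:
  assumes "4 * a < b"
  shows "card (nodes a b n) = b * n + (b - 2 * a) * n + (b - 4 * a) * n"
proof -
  have "b - a - a = b - 2 * a" "b - 2 * a - 2 * a = b - 4 * a" by linarith+
  then have "(b - a) * n - a * n = (b - 2 * a) * n" "(b - 2 * a) * n - 2 * a * n = (b - 4 * a) * n"
    by (simp_all only: diff_mult_distrib[symmetric])
  then show ?thesis
    unfolding nodes_def by (simp add: sum_lessThan_3)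
qed

lemma degree_centered_poly:
  "degree (centered_poly a b n) \<le> card (nodes a b n)"
proof -
  have "degree (\<Prod>r\<in>nodes a b n. [:real ((b * n + 1) div 2) - real (snd r), 1:])
      \<le> (\<Sum>r\<in>nodes a b n. degree [:real ((b * n + 1) div 2) - real (snd r), 1:])"
    by (rule degree_prod_sum_le[OF finite_nodes, unfolded o_def])
  then show ?thesis unfolding centered_poly_def by (intro order_trans[OF degree_smult_le]) simp
qed

text \<open>The reflection \<open>j\<close> to \<open>bn + 1 - j\<close> maps each block to itself,
  and the number of linear factors, a sum of three odd numbers, is odd.\<close>

lemma centered_poly_minus:
  assumes ab: "4 * a < b" and odd: "odd b" "odd n"
  shows "poly (centered_poly a b n) (- t) = - poly (centered_poly a b n) t"
proof -
  let ?I = "nodes a b n" and ?c = "real ((b * n + 1) div 2)"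
  let ?f = "\<lambda>r. (fst r, b * n + 1 - snd r)"
  have "2 * ((b * n + 1) div 2) = b * n + 1" using odd by (intro dvd_mult_div_cancel) simp
  then have c: "2 * ?c = real (b * n) + 1"
    by (metis of_nat_1 of_nat_add of_nat_mult of_nat_numeral)
  have mem: "?f r \<in> ?I \<and> ?f (?f r) = r \<and> real (snd (?f r)) = real (b * n) + 1 - real (snd r)" if r: "r \<in> ?I" for r
  proof -
    obtain i j where ij: "r = (i, j)" by (cases r)
    have i: "i < 3" "i * a * n < j" "j \<le> (b - i * a) * n" using r by (auto simp: ij nodes_def)
    have "i * a \<le> 2 * a" using i by (intro mult_right_mono) auto
    then have "i * a \<le> b" using ab by linarith
    then have "i * a * n + (b - i * a) * n = b * n" by (simp flip: distrib_right)
    then have "i * a * n < b * n + 1 - j" "b * n + 1 - j \<le> (b - i * a) * n" "j \<le> b * n" using i by linarith+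
    then show ?thesis using i by (auto simp: ij nodes_def of_nat_diff simp del: of_nat_mult)
  qed
  have "node_prod ?I (?c - t) = (\<Prod>r\<in>?I. - (?c + t - real (snd r)))"
    unfolding node_prod_def
  proof (rule prod.reindex_bij_witness[of _ ?f ?f])
    fix r assume "r \<in> ?I"
    with mem[OF this] c show "- (?c + t - real (snd (?f r))) = ?c - t - real (snd r)"
      by (simp del: of_nat_mult)
  qed (use mem in auto)
  also have "\<dots> = (\<Prod>r\<in>?I. -1) * node_prod ?I (?c + t)"
    unfolding node_prod_def prod.distrib[symmetric] by simp
  also have "(\<Prod>r\<in>?I. -1) = (-1 :: real)"
  proof -
    have "odd (card ?I)" unfolding card_nodes[OF ab] using odd ab by auto
    then show ?thesis by simp
  qed
  finally show ?thesis by (simp add: poly_centered_poly)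
qed

lemma pderiv_centered_poly_minus:
  assumes "4 * a < b" "odd b" "odd n"
  shows "poly (pderiv (centered_poly a b n)) (- t) = poly (pderiv (centered_poly a b n)) t"
proof -
  let ?h = "centered_poly a b n"
  have "?h \<circ>\<^sub>p [:0, -1:] = - ?h"
    unfolding poly_eq_poly_eq_iff[symmetric]
    by (rule ext) (simp add: poly_pcompose centered_poly_minus[OF assms])
  then have "pderiv (?h \<circ>\<^sub>p [:0, -1:]) = - pderiv ?h" by (simp add: pderiv_minus)
  then have "poly (pderiv (?h \<circ>\<^sub>p [:0, -1:])) t = - poly (pderiv ?h) t" by simp
  then show ?thesis by (simp add: pderiv_pcompose poly_pcompose pderiv_pCons)
qed

lemma node_prod_of_nat: "node_prod I (real \<nu>) = real_of_int (node_prod I (int \<nu>))"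
  by (simp add: node_prod_def)

lemma dlcm_node_prod_Ints:
  assumes ab: "4 * a < b" and s: "s \<in> nodes a b n"
  shows "real (dlcm (b * n)) / real (Delta a b n) * (node_prod (nodes a b n - {s}) (real \<nu>) / real (nodes_den a b n)) \<in> \<int>"
proof -
  obtain k where k: "int (dlcm (b * n)) * node_prod (nodes a b n - {s}) (int \<nu>) = int (nodes_den a b n * Delta a b n) * k"
    using nodes_dvd[OF assms, of "int \<nu>"] by (elim dvdE)
  have "real_of_int (int (dlcm (b * n)) * node_prod (nodes a b n - {s}) (int \<nu>)) = real_of_int (int (nodes_den a b n * Delta a b n) * k)"
    unfolding k ..
  then have "real (dlcm (b * n)) * node_prod (nodes a b n - {s}) (real \<nu>) = real (nodes_den a b n) * real (Delta a b n) * of_int k"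
    by (simp add: node_prod_of_nat)
  then have "real (dlcm (b * n)) / real (Delta a b n) * (node_prod (nodes a b n - {s}) (real \<nu>) / real (nodes_den a b n)) = of_int k"
    using nodes_den_pos[of a b n] Delta_pos[of a b n] by (simp add: field_simps)
  then show ?thesis by simp
qed

text \<open>\<open>R'\<close> is a sum of products with one node removed, to which
  \<open>nodes_dvd\<close> applies directly; \<open>R\<close> itself is such a product times the
  integer \<open>\<nu> - 1\<close>, with the node \<open>(0, 1)\<close> removed.\<close>

lemma centered_poly_Ints:
  assumes ab: "4 * a < b" and n: "n > 0"
  shows "real (dlcm (b * n)) / real (Delta a b n) * poly (centered_poly a b n) (real i) \<in> \<int>"
    and "real (dlcm (b * n)) / real (Delta a b n) * poly (pderiv (centered_poly a b n)) (real i) \<in> \<int>"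
proof -
  define \<nu> where "\<nu> = (b * n + 1) div 2 + i"
  let ?I = "nodes a b n" and ?C = "real (dlcm (b * n)) / real (Delta a b n)" and ?d = "real (nodes_den a b n)"
  have \<nu>: "real ((b * n + 1) div 2) + real i = real \<nu>" by (simp add: \<nu>_def)
  have "0 < b * n" using ab n by simp
  then have s: "(0, 1) \<in> ?I" by (auto simp: nodes_def Suc_le_eq simp del: nat_0_less_mult_iff)
  have "node_prod ?I (real \<nu>) = (real \<nu> - 1) * node_prod (?I - {(0, 1)}) (real \<nu>)"
    unfolding node_prod_def using prod.remove[OF finite_nodes s, of "\<lambda>r. real \<nu> - real (snd r)"] by simp
  then have "?C * (node_prod ?I (real \<nu>) / ?d) = of_int (int \<nu> - 1) * (?C * (node_prod (?I - {(0, 1)}) (real \<nu>) / ?d))"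
    by simp
  also have "\<dots> \<in> \<int>" by (rule Ints_mult[OF Ints_of_int dlcm_node_prod_Ints[OF ab s]])
  finally show "?C * poly (centered_poly a b n) (real i) \<in> \<int>"
    unfolding poly_centered_poly \<nu> .
  have "?C * ((\<Sum>s\<in>?I. node_prod (?I - {s}) (real \<nu>)) / ?d) = (\<Sum>s\<in>?I. ?C * (node_prod (?I - {s}) (real \<nu>) / ?d))"
    by (simp add: sum_divide_distrib sum_distrib_left)
  also have "\<dots> \<in> \<int>" using dlcm_node_prod_Ints[OF ab] by (intro Ints_sum)
  finally show "?C * poly (pderiv (centered_poly a b n)) (real i) \<in> \<int>"
    unfolding poly_pderiv_centered_poly \<nu> .
qed

lemma centered_poly_eq_0:
  assumes "b > 0" "n > 0" "odd (b * n)" "i < (b * n + 1) div 2"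
  shows "poly (centered_poly a b n) (real i) = 0"
proof -
  define \<nu> where "\<nu> = (b * n + 1) div 2 + i"
  have \<nu>: "real ((b * n + 1) div 2) + real i = real \<nu>" by (simp add: \<nu>_def)
  have "2 * ((b * n + 1) div 2) = b * n + 1" using assms by (intro dvd_mult_div_cancel) simp
  then have "\<nu> \<le> b * n" "0 < \<nu>" using assms(4) unfolding \<nu>_def by linarith+
  then have "(0, \<nu>) \<in> nodes a b n" by (simp add: nodes_def)
  then have "node_prod (nodes a b n) (real \<nu>) = 0"
    unfolding node_prod_def by (intro prod_zero[OF finite_nodes]) force
  then show ?thesis unfolding poly_centered_poly \<nu> by simp
qed

text \<open>The bound on \<open>i\<close> is the distance from the centre to the end of the overlap
  of two blocks: \<open>c\<close> plus it equals \<open>(b-a)n + 1\<close>. It becomes the exponent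
  \<open>e\<close> of the removable power of \<open>k\<close>.\<close>

lemma pderiv_centered_poly_eq_0:
  assumes ab: "4 * a < b" and "odd b" "odd n" "i < ((b - 2 * a) * n + 1) div 2"
  shows "poly (pderiv (centered_poly a b n)) (real i) = 0"
proof -
  define \<nu> where "\<nu> = (b * n + 1) div 2 + i"
  have \<nu>: "real ((b * n + 1) div 2) + real i = real \<nu>" by (simp add: \<nu>_def)
  have n: "n > 0" using assms by (auto intro: Nat.gr0I)
  have 1: "2 * ((b * n + 1) div 2) = b * n + 1" using assms by (intro dvd_mult_div_cancel) simp
  have 2: "2 * (((b - 2 * a) * n + 1) div 2) = (b - 2 * a) * n + 1" using assms by (intro dvd_mult_div_cancel) auto
  have "b + (b - 2 * a) = 2 * (b - a)" using ab by simp
  then have "(b + (b - 2 * a)) * n = 2 * (b - a) * n" by simp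
  then have 3: "b * n + (b - 2 * a) * n = 2 * ((b - a) * n)" by (simp only: distrib_right mult.assoc)
  have "2 * a * n < b * n" using ab n by simp
  then have "2 * (a * n) < b * n" by simp
  then have "a * n < \<nu>" using 1 unfolding \<nu>_def by linarith
  moreover have "\<nu> \<le> (b - a) * n" using assms(4) 1 2 3 unfolding \<nu>_def by linarith
  ultimately have "(\<Sum>s\<in>nodes a b n. node_prod (nodes a b n - {s}) (real \<nu>)) = 0"
    by (rule kernel_deriv_eq_0(2)[OF ab])
  then show ?thesis unfolding poly_pderiv_centered_poly \<nu> by simp
qed

text \<open>Clears denominators of, and removes the common factor from, the powers \<open>(k/2)\<^sup>j\<close> with \<open>e \<le> j \<le> J\<close>; its growth rate is \<open>K\<^sub>1\<close>.\<close>
definition power_scale :: "nat \<Rightarrow> nat \<Rightarrow> nat \<Rightarrow> real" where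
  "power_scale k e J = (if even k then 1 / real (k div 2) ^ e else 2 ^ J / real k ^ e)"

lemma power_scale_Ints:
  assumes "k \<ge> 1" "e \<le> j" "j \<le> J"
  shows "power_scale k e J * (real k / 2) ^ j \<in> \<int>"
proof (cases "even k")
  case True
  then obtain m where m: "k = 2 * m" by auto
  have "m > 0" using assms m by simp
  then have "power_scale k e J * (real k / 2) ^ j = real (m ^ (j - e))"
    using assms power_diff[of "real m" e j] by (simp add: power_scale_def m)
  then show ?thesis by (simp only: Ints_of_nat)
next
  case False
  have "power_scale k e J * (real k / 2) ^ j = (2 ^ J / 2 ^ j) * (real k ^ j / real k ^ e)"
    using False by (simp add: power_scale_def power_divide)
  also have "\<dots> = real (2 ^ (J - j) * k ^ (j - e))"
    using assms power_diff[of "real k" e j] power_diff[of "2 :: real" j J] by simp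
  finally show ?thesis by (simp only: Ints_of_nat)
qed

lemma node_prod_eq_triple:
  assumes ab: "4 * a < b"
  shows "node_prod (nodes a b n) (real (b * n + 1 + \<mu>)) / real (nodes_den a b n)
     = (\<Prod>i<3. real ((b * n + \<mu> - i * a * n) choose ((b - 2 * i * a) * n)))"
proof -
  have brick: "(\<Prod>j\<in>{i * a * n<..(b - i * a) * n}. real (b * n + 1 + \<mu>) - real j)
      = fact ((b - 2 * i * a) * n) * real ((b * n + \<mu> - i * a * n) choose ((b - 2 * i * a) * n))" if i: "i < 3" for i
  proof -
    define M N where "M = (b - 2 * i * a) * n" and "N = b * n + \<mu> - i * a * n"
    have "i * a \<le> 2 * a" using i by (intro mult_right_mono) auto
    then have 1: "2 * (i * a) \<le> b" "i * a \<le> b" using ab by linarith+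
    have "b - 2 * (i * a) + i * a = b - i * a" using 1 by linarith
    then have "(b - 2 * (i * a)) * n + i * a * n = (b - i * a) * n"
      by (simp only: distrib_right[symmetric])
    then have q: "(b - i * a) * n = i * a * n + M" by (simp add: M_def mult.assoc)
    have le: "i * a * n \<le> b * n" using 1 by (intro mult_right_mono) auto
    have N: "real N = real (b * n + \<mu>) - real (i * a * n)" unfolding N_def by (rule of_nat_diff) (use le in linarith)
    have "(\<Prod>j\<in>{i * a * n<..(b - i * a) * n}. real (b * n + 1 + \<mu>) - real j)
        = (\<Prod>j\<in>{0..<M}. real N - real j)"
      unfolding q
      by (rule prod.reindex_bij_witness[of _ "\<lambda>j. i * a * n + 1 + j" "\<lambda>j. j - (i * a * n + 1)"])
         (auto simp: N of_nat_diff)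
    also have "\<dots> = fact M * (real N gchoose M)" by (simp add: gbinomial_mult_fact)
    finally show ?thesis by (simp add: M_def N_def binomial_gbinomial)
  qed
  have "node_prod (nodes a b n) (real (b * n + 1 + \<mu>))
      = (\<Prod>i<3. \<Prod>j\<in>{i * a * n<..(b - i * a) * n}. real (b * n + 1 + \<mu>) - real j)"
    unfolding node_prod_def nodes_def by (subst prod.Sigma) (auto simp: case_prod_beta)
  also have "\<dots> = (\<Prod>i<3. fact ((b - 2 * i * a) * n)) * (\<Prod>i<3. real ((b * n + \<mu> - i * a * n) choose ((b - 2 * i * a) * n)))"
    unfolding prod.distrib[symmetric] by (intro prod.cong refl brick) auto
  also have "(\<Prod>i<3. fact ((b - 2 * i * a) * n)) = real (nodes_den a b n)" by (simp add: nodes_den_def)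
  finally show ?thesis using nodes_den_pos[of a b n] by simp
qed

text \<open>\<open>q = W S\<close> and \<open>p = (2k+1) W T\<close>, with
  \<open>d^2 = 2k + 1\<close> clearing the square root from the derivative part. \<open>2J\<close>
  is the number of nodes plus one, so it bounds the degree. The factor \<open>x^c\<close> stays on
  the left because the series run over \<open>\<nu>\<close> and the generating functions over
  \<open>t = \<nu> - c\<close>.\<close>

lemma linear_form:
  fixes a b k n :: nat
  defines "d \<equiv> sqrt (2 * real k + 1)"
  defines "x \<equiv> (d - 1) / (d + 1)"
  defines "c \<equiv> (b * n + 1) div 2" and "e \<equiv> ((b - 2 * a) * n + 1) div 2"
    and "J \<equiv> (b * n + (b - 2 * a) * n + (b - 4 * a) * n + 1) div 2"
  defines "W \<equiv> real (dlcm (b * n)) / real (Delta a b n) * power_scale k e J"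
  assumes k: "k \<ge> 1" and ab: "a > 0" "4 * a < b" and odd: "odd b" "odd n" and summ: "summable (triple_term a b x n)"
  shows "\<exists>(q::int) (p::int) V. of_int q * x ^ c = W * suminf (triple_term a b x n) \<and>
     (\<lambda>\<nu>. kernel_deriv a b x n (c + \<nu>)) sums V \<and>
     (of_int q * (d * ln x) + of_int p) * x ^ c = W * d * V"
proof -
  let ?h = "centered_poly a b n" and ?C = "real (dlcm (b * n)) / real (Delta a b n)"
  have d1: "d > 1" using k by (simp add: d_def real_less_rsqrt)
  have dd: "d * d = 2 * real k + 1" by (simp add: d_def)
  have x: "0 < x" "x < 1" "\<bar>x\<bar> < 1" using d1 by (auto simp: x_def)
  have "1 - x = 2 / (d + 1)" "1 + x = 2 * d / (d + 1)" using d1 by (simp_all add: x_def field_simps)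
  then have xd: "(1 + x) / (1 - x) = d" and xk: "x / (1 - x)\<^sup>2 = real k / 2"
    using d1 dd by (simp_all add: x_def field_simps power2_eq_square)
  have n: "n > 0" and b: "b > 0" and bn: "odd (b * n)" using odd ab by (auto intro: Nat.gr0I)
  have ec: "e \<le> c" unfolding e_def c_def by (intro div_le_mono add_right_mono mult_right_mono) auto
  have deg: "degree ?h \<le> 2 * J"
  proof -
    have "2 * J = card (nodes a b n) + 1"
      unfolding J_def card_nodes[OF ab(2)] using odd ab by (intro dvd_mult_div_cancel) auto
    then show ?thesis using degree_centered_poly[of a b n] by linarith
  qed
  have degd: "degree (pderiv ?h) \<le> 2 * J" using deg by (simp add: degree_pderiv)
  note gA = odd_poly_generating_function[OF deg centered_poly_minus[OF ab(2) odd] centered_poly_Ints(1)[OF ab(2) n]]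
  obtain A where A': "\<forall>j. ?C * A j \<in> \<int>" "\<forall>j. (\<forall>i\<le>j. poly ?h (real i) = 0) \<longrightarrow> A j = 0"
      "\<forall>x. \<bar>x\<bar> < 1 \<longrightarrow> (\<lambda>t. poly ?h (real t) * x ^ t) sums (\<Sum>j=1..J. A j * (x / (1 - x)\<^sup>2) ^ j)"
    using gA by (elim exE conjE)
  note A = A'(1,2)[rule_format] A'(3)[rule_format, OF x(3), unfolded xk]
  have h0: "poly (pderiv ?h) 0 = 0"
  proof -
    have "0 < (b - 2 * a) * n" using ab n by simp
    then have "0 < ((b - 2 * a) * n + 1) div 2" by linarith
    from pderiv_centered_poly_eq_0[OF ab(2) odd this] show ?thesis by simp
  qed
  note gB = even_poly_generating_function[OF degd pderiv_centered_poly_minus[OF ab(2) odd] h0 centered_poly_Ints(2)[OF ab(2) n]]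
  obtain B where B': "\<forall>j. ?C * B j \<in> \<int>" "\<forall>j. (\<forall>i\<le>j. poly (pderiv ?h) (real i) = 0) \<longrightarrow> B j = 0"
      "\<forall>x. \<bar>x\<bar> < 1 \<longrightarrow> (\<lambda>t. poly (pderiv ?h) (real t) * x ^ t) sums
         ((1 + x) / (1 - x) * (\<Sum>j=1..J. B j * (x / (1 - x)\<^sup>2) ^ j))"
    using gB by (elim exE conjE)
  note B = B'(1,2)[rule_format] B'(3)[rule_format, OF x(3), unfolded xk xd]
  define S T where "S = (\<Sum>j=1..J. A j * (real k / 2) ^ j)" and "T = (\<Sum>j=1..J. B j * (real k / 2) ^ j)"
  \<comment> \<open>One scale factor serves both sums: the derivative vanishes only for
    \<open>i < e\<close>, the polynomial even for \<open>i < c\<close>, and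
    \<open>e \<le> c\<close>.\<close>
  have int: "W * (\<Sum>j=1..J. F j * (real k / 2) ^ j) \<in> \<int>"
    if F: "\<And>j. ?C * F j \<in> \<int>" "\<And>j. j < e \<Longrightarrow> F j = 0" for F
  proof -
    have "W * (\<Sum>j=1..J. F j * (real k / 2) ^ j) = (\<Sum>j=1..J. (?C * F j) * (power_scale k e J * (real k / 2) ^ j))"
      by (simp add: W_def sum_distrib_left mult_ac)
    also have "\<dots> \<in> \<int>"
    proof (rule Ints_sum)
      fix j assume j: "j \<in> {1..J}"
      show "(?C * F j) * (power_scale k e J * (real k / 2) ^ j) \<in> \<int>"
      proof (cases "j < e")
        case True
        then show ?thesis using F(2) by simp
      next
        case False
        then have "power_scale k e J * (real k / 2) ^ j \<in> \<int>" using j by (intro power_scale_Ints[OF k]) auto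
          then show ?thesis by (rule Ints_mult[OF F(1)])
      qed
    qed
    finally show ?thesis .
  qed
  have "W * S \<in> \<int>" unfolding S_def
    by (rule int[OF A(1) A(2)]) (use centered_poly_eq_0[OF b n bn, of _ a] ec in \<open>auto simp: c_def\<close>)
  then obtain q where q: "W * S = of_int q" by (elim Ints_cases)
  have "W * T \<in> \<int>" unfolding T_def
    by (rule int[OF B(1) B(2)]) (use pderiv_centered_poly_eq_0[OF ab(2) odd] in \<open>auto simp: e_def\<close>)
  then obtain p where p: "W * T = of_int p" by (elim Ints_cases)
  have hn: "poly ?h (real t) = node_prod (nodes a b n) (real (c + t)) / real (nodes_den a b n)" for t
    by (simp add: poly_centered_poly c_def)
  have c2: "2 * c = b * n + 1" unfolding c_def using bn by (intro dvd_mult_div_cancel) simp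
  \<comment> \<open>The first \<open>c\<close> terms vanish, and a further shift by \<open>c\<close>
    lands on \<open>2c = bn + 1\<close>, the start of the positive terms.\<close>
  have Su: "S * x ^ c = suminf (triple_term a b x n)"
  proof -
    have "(\<lambda>t. poly ?h (real (t + c)) * x ^ (t + c)) sums S"
      using sums_zero_iff_shift[of c "\<lambda>t. poly ?h (real t) * x ^ t" S] A(3)
        centered_poly_eq_0[OF b n bn, of _ a] by (simp add: S_def c_def)
    then have "(\<lambda>t. poly ?h (real (t + c)) * x ^ (t + c) * x ^ c) sums (S * x ^ c)" by (rule sums_mult2)
    moreover have "poly ?h (real (t + c)) * x ^ (t + c) * x ^ c = triple_term a b x n t" for t
    proof -
      have ct: "c + (t + c) = b * n + 1 + t" using c2 by simp
      have "x ^ (t + c) * x ^ c = x ^ (b * n + 1 + t)" unfolding ct[symmetric] by (simp add: power_add mult_ac)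
      then show ?thesis
        unfolding hn ct node_prod_eq_triple[OF ab(2)] triple_term_def by (simp only: mult.assoc)
    qed
    ultimately show ?thesis by (simp add: sums_iff)
  qed
  define V where "V = x ^ c * (d * T + S * ln x)"
  have kd: "kernel_deriv a b x n (c + t) = x ^ c * (poly (pderiv ?h) (real t) * x ^ t + poly ?h (real t) * x ^ t * ln x)" for t
    unfolding kernel_deriv_def hn poly_pderiv_centered_poly
    by (simp add: c_def power_add algebra_simps)
  have "(\<lambda>\<nu>. kernel_deriv a b x n (c + \<nu>)) sums V"
    unfolding kd V_def using A(3) B(3) by (intro sums_mult sums_add sums_mult2) (simp_all add: S_def T_def)
  moreover have "of_int q * x ^ c = W * suminf (triple_term a b x n)"
    unfolding q[symmetric] Su[symmetric] by simp
  moreover have "(of_int q * (d * ln x) + of_int ((2 * int k + 1) * p)) * x ^ c = W * d * V"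
  proof -
    have "real_of_int ((2 * int k + 1) * p) = d * d * (W * T)" by (simp add: dd p)
    then show ?thesis unfolding q[symmetric] V_def by (simp add: algebra_simps)
  qed
  ultimately show ?thesis by blast
qed

section \<open>The irrationality measure\<close>

lemma power_scale_pos: "k \<ge> 1 \<Longrightarrow> power_scale k e J > 0"
  by (auto simp: power_scale_def elim!: evenE)

lemma ln_power_scale:
  assumes "k \<ge> 1"
  shows "ln (power_scale k e J) = (if even k then - real e * ln (real (k div 2)) else real J * ln 2 - real e * ln (real k))"
  using assms by (auto simp: power_scale_def ln_div ln_realpow elim!: evenE)

lemma tendsto_linear_over_odd:
  fixes u v :: real
  shows "(\<lambda>m. (u * real (2 * m + 1) + v) / real (2 * m + 1)) \<longlonglongrightarrow> u"
proof -
  have "(\<lambda>m. u + v / real (2 * m + 1)) \<longlonglongrightarrow> u" by real_asymp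
  moreover have "(u * real (2 * m + 1) + v) / real (2 * m + 1) = u + v / real (2 * m + 1)" for m
    by (simp add: field_simps)
  ultimately show ?thesis by simp
qed

text \<open>The forms are numbered by \<open>m\<close> but grow with \<open>n = 2m + 1\<close>; the
  resulting factor 2 affects both rates and cancels in their quotient.\<close>

lemma tendsto_over_odd_imp:
  fixes f :: "nat \<Rightarrow> real"
  assumes "(\<lambda>m. f m / real (2 * m + 1)) \<longlonglongrightarrow> l"
  shows "(\<lambda>m. f m / real m) \<longlonglongrightarrow> 2 * l"
proof -
  have "(\<lambda>m. real (2 * m + 1) / real m) \<longlonglongrightarrow> 2" by real_asymp
  from tendsto_mult[OF this assms] have "(\<lambda>m. real (2 * m + 1) / real m * (f m / real (2 * m + 1))) \<longlonglongrightarrow> 2 * l" .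
  moreover have "u / v * (g / u) = g / v" if "u \<noteq> 0" for u v g :: real
    using that by simp
  then have "real (2 * m + 1) / real m * (f m / real (2 * m + 1)) = f m / real m" for m
    by (metis of_nat_eq_0_iff add_is_0 one_neq_zero)
  ultimately show ?thesis by (simp only:)
qed

lemma ln_power_quotient:
  fixes A B C D E F G H :: real
  assumes "A > 0" "B > 0" "C > 0" "D > 0" "E > 0" "F > 0" "G > 0" "H > 0"
  shows "ln (A ^ i * B ^ j * C ^ l / (D ^ r * E ^ s * F ^ t * G ^ u * H ^ v))
    = real i * ln A + real j * ln B + real l * ln C - real r * ln D - real s * ln E - real t * ln F - real u * ln G - real v * ln H"
  using assms by (simp add: ln_mult_pos ln_divide_pos ln_realpow)

theorem theorem1:
  fixes k a b :: nat and z0 :: real and z1 :: complex and N1 :: real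
  assumes hk: "k \<ge> 1"
    and hab: "a > 0" "b > 0" "odd b" "b > 4 * a"
    and hz0: "z0 > real b"
      "z0 * (z0 - real a) * (z0 - 2 * real a) /
         ((z0 - real (b - 2 * a)) * (z0 - real (b - a)) * (z0 - real b))
       = 1 / ((sqrt (2 * real k + 1) - 1) / (sqrt (2 * real k + 1) + 1))"
      "\<forall>z::real. z > real b \<and>
         z * (z - real a) * (z - 2 * real a) /
           ((z - real (b - 2 * a)) * (z - real (b - a)) * (z - real b))
         = 1 / ((sqrt (2 * real k + 1) - 1) / (sqrt (2 * real k + 1) + 1))
         \<longrightarrow> z = z0"
    and hz1: "Im z1 > 0"
      "(z1 + 2 * of_nat a) * (z1 + of_nat a) * z1 /
         ((z1 + of_nat (b - 2 * a)) * (z1 + of_nat (b - a)) * (z1 + of_nat b))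
       = complex_of_real (1 / ((sqrt (2 * real k + 1) - 1) / (sqrt (2 * real k + 1) + 1)))"
    and hN1: "(\<lambda>m::nat. (1 / real (2 * m + 1)) *
                 ln (real (dlcm (b * (2 * m + 1))) / real (Delta a b (2 * m + 1))))
              \<longlonglongrightarrow> N1"
  defines "xk \<equiv> (sqrt (2 * real k + 1) - 1) / (sqrt (2 * real k + 1) + 1)"
    and "\<alpha>k \<equiv> sqrt (2 * real k + 1) * ln ((sqrt (2 * real k + 1) - 1) / (sqrt (2 * real k + 1) + 1))"
    and "M1 \<equiv> ln ((z0 - real (b - 2 * a)) ^ (b - 2 * a) * (z0 - real (b - a)) ^ (b - a) * (z0 - real b) ^ b
              / ((z0 - 2 * real a) ^ (2 * a) * (z0 - real a) ^ a * real (b - 4 * a) ^ (b - 4 * a)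
                 * real (b - 2 * a) ^ (b - 2 * a) * real b ^ b))
             - real b / 2 * ln ((sqrt (2 * real k + 1) - 1) / (sqrt (2 * real k + 1) + 1))"
    and "M2 \<equiv> ln (cmod (z1 + of_nat (b - 2 * a)) ^ (b - 2 * a) * cmod (z1 + of_nat (b - a)) ^ (b - a)
                  * cmod (z1 + of_nat b) ^ b
              / (cmod (z1 + 2 * of_nat a) ^ (2 * a) * cmod (z1 + of_nat a) ^ a * real (b - 4 * a) ^ (b - 4 * a)
                 * real (b - 2 * a) ^ (b - 2 * a) * real b ^ b))
             - real b / 2 * ln ((sqrt (2 * real k + 1) - 1) / (sqrt (2 * real k + 1) + 1))"
    and "K1 \<equiv> (if even k then - (real (b - 2 * a) / 2) * ln (real (k div 2))
               else - (real (b - 2 * a) / 2) * ln (real k) + 3 * real (b - 2 * a) / 2 * ln 2)"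
  assumes hneg: "M2 + K1 + N1 < 0"
  shows "irrationality_measure \<alpha>k \<le> ereal (1 - (M1 + K1 + N1) / (M2 + K1 + N1))"
proof -
  define n where "n m = 2 * m + 1" for m :: nat
  define d where "d = sqrt (2 * real k + 1)"
  have xk: "xk = (d - 1) / (d + 1)" and \<alpha>k: "\<alpha>k = d * ln xk" by (simp_all add: xk_def \<alpha>k_def d_def)
  have d1: "d > 1" using hk by (simp add: d_def real_less_rsqrt)
  then have x: "0 < xk" "xk < 1" by (auto simp: xk)
  have ab: "0 < a" "4 * a < b" using hab by auto
  have sub: "real (b - 2 * a) = real b - 2 * real a" "real (b - a) = real b - real a" "real (b - 4 * a) = real b - 4 * real a"
    using ab by auto
  note folded = xk_def[symmetric]

  \<comment> \<open>Growth rate of the positive series and \<open>M1\<close>\<close>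
  define Mc where "Mc = (\<Sum>i<3. real (b - i * a) * ln (z0 - real (b - i * a)) - real (i * a) * ln (z0 - real (i * a))
          - real (b - 2 * i * a) * ln (real (b - 2 * i * a)))"
  have z0pos: "z0 - real b > 0" "z0 - real (b - a) > 0" "z0 - real (b - 2 * a) > 0" "z0 > 0" "z0 - real a > 0" "z0 - 2 * real a > 0"
    using hz0(1) ab unfolding sub by auto
  have eq0: "(\<Prod>i<3. z0 - real (b - i * a)) = xk * (\<Prod>i<3. z0 - real (i * a))"
    using hz0(2) z0pos x unfolding folded sum_lessThan_3 by (simp add: eval_nat_numeral field_simps)
  note growth = summable_triple_term[OF ab hz0(1) x eq0] suminf_triple_term_pos[OF ab hz0(1) x eq0]
    ln_suminf_triple_term[OF ab hz0(1) x eq0, folded Mc_def]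
  have M1: "M1 = Mc - real b / 2 * ln xk"
    unfolding M1_def Mc_def folded sum_lessThan_3
    by (subst ln_power_quotient) (use z0pos ab in \<open>simp_all add: algebra_simps\<close>)

  \<comment> \<open>Since \<open>w - v = - cnj (z1 + v)\<close> for real \<open>v\<close>, the
    equation for \<open>z1\<close>, whose right side is real, becomes the critical equation of the
    kernel; moduli are kept and \<open>w\<close> stays in the upper half-plane.\<close>
  define w where "w = - cnj z1"
  have w: "Im w > 0" using hz1(1) by (simp add: w_def)
  have wv: "w - of_real v = - cnj (z1 + of_real v)" for v by (simp add: w_def)
  have eqw: "(\<Prod>i<(3::nat). w - of_real (real i * real a)) / (\<Prod>i<(3::nat). w - of_real (real b - real i * real a)) = of_real (1 / xk)"
  proof -
    have "(\<Prod>i<(3::nat). w - of_real (real i * real a)) / (\<Prod>i<(3::nat). w - of_real (real b - real i * real a))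
      = cnj ((z1 + 2 * of_nat a) * (z1 + of_nat a) * z1 / ((z1 + of_nat (b - 2 * a)) * (z1 + of_nat (b - a)) * (z1 + of_nat b)))"
    proof -
      have "of_nat (b - 2 * a) = (of_real (real b - 2 * real a) :: complex)" "of_nat (b - a) = (of_real (real b - real a) :: complex)"
        by (simp_all flip: sub)
      moreover have "(- u0) * (- u1) * (- u2) / ((- v0) * (- v1) * (- v2)) = u2 * u1 * u0 / (v2 * v1 * v0)"
        for u0 u1 u2 v0 v1 v2 :: complex
        by (simp add: mult_ac)
      moreover have "(\<Prod>i<(3::nat). f i) = f 0 * f 1 * f 2" for f :: "nat \<Rightarrow> complex"
        by (simp add: eval_nat_numeral)
      ultimately show ?thesis unfolding wv by (simp only:) simp
    qed
    then show ?thesis unfolding hz1(2) folded by simp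
  qed
  define G where "G = (\<Sum>i<(3::nat). (real b - real i * real a) * ln (norm (w - of_real (real b - real i * real a)))
        - real i * real a * ln (norm (w - of_real (real i * real a))) - real (b - 2 * i * a) * ln (real (b - 2 * i * a)))"
  have nw: "norm (w - of_real v) = norm (z1 + of_real v)" for v unfolding wv by (metis complex_mod_cnj norm_minus_cancel)
  have z1pos: "norm (z1 + of_real v) > 0" for v using hz1(1) by (auto simp: complex_eq_iff)
  have M2: "M2 = G - real b / 2 * ln xk"
  proof -
    have "of_nat (b - 2 * a) = (of_real (real b - 2 * real a) :: complex)" "of_nat (b - a) = (of_real (real b - real a) :: complex)"
      "of_nat b = (of_real (real b) :: complex)" "2 * of_nat a = (of_real (2 * real a) :: complex)" "of_nat a = (of_real (real a) :: complex)"
      by (simp_all flip: sub)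
    note cs = this
    have "ln (cmod (z1 + of_real (real b - 2 * real a)) ^ (b - 2 * a) * cmod (z1 + of_real (real b - real a)) ^ (b - a) * cmod (z1 + of_real (real b)) ^ b
              / (cmod (z1 + of_real (2 * real a)) ^ (2 * a) * cmod (z1 + of_real (real a)) ^ a * real (b - 4 * a) ^ (b - 4 * a)
                 * real (b - 2 * a) ^ (b - 2 * a) * real b ^ b)) = G"
      unfolding G_def nw sum_lessThan_3
      by (subst ln_power_quotient[OF z1pos z1pos z1pos z1pos z1pos]) (use ab in \<open>simp_all add: sub algebra_simps\<close>)
    then show ?thesis unfolding M2_def folded cs by simp
  qed
  obtain K where K: "K > 0" "\<And>n j V. n \<ge> 1 \<Longrightarrow> a * n < j \<Longrightarrow> j \<le> (b - a) * n + 1 \<Longrightarrow> (\<lambda>\<nu>. kernel_deriv a b xk n (j + \<nu>)) sums V \<Longrightarrow>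
     \<bar>V\<bar> \<le> K * real n ^ 11 * exp (real n * G)"
    using kernel_deriv_sum_le[OF ab x w eqw, folded G_def] by (elim exE conjE) simp

  \<comment> \<open>The linear forms for \<open>n = 2m + 1\<close>\<close>
  define c e J where "c m = (b * n m + 1) div 2" and "e m = ((b - 2 * a) * n m + 1) div 2"
    and "J m = (b * n m + (b - 2 * a) * n m + (b - 4 * a) * n m + 1) div 2" for m
  define C where "C m = real (dlcm (b * n m)) / real (Delta a b (n m))" for m
  define \<kappa> where "\<kappa> m = power_scale k (e m) (J m)" for m
  define U where "U m = suminf (triple_term a b xk (n m))" for m
  have oddn: "odd (n m)" "n m \<ge> 1" for m by (auto simp: n_def)
  have Cpos: "C m > 0" for m unfolding C_def using dlcm_pos Delta_pos by simp
  have \<kappa>pos: "\<kappa> m > 0" for m unfolding \<kappa>_def by (rule power_scale_pos[OF hk])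
  have Upos: "U m > 0" for m unfolding U_def by (rule growth(2))
  have "\<forall>m. \<exists>(q::int) (p::int) V. of_int q * xk ^ c m = C m * \<kappa> m * U m \<and>
     (\<lambda>\<nu>. kernel_deriv a b xk (n m) (c m + \<nu>)) sums V \<and> (of_int q * (d * ln xk) + of_int p) * xk ^ c m = C m * \<kappa> m * d * V"
  proof
    fix m
    have "summable (triple_term a b ((d - 1) / (d + 1)) (n m))" using growth(1) unfolding xk .
    from linear_form[OF hk ab hab(3) oddn(1)[of m], folded d_def, OF this]
    show "\<exists>(q::int) (p::int) V. of_int q * xk ^ c m = C m * \<kappa> m * U m \<and>
     (\<lambda>\<nu>. kernel_deriv a b xk (n m) (c m + \<nu>)) sums V \<and> (of_int q * (d * ln xk) + of_int p) * xk ^ c m = C m * \<kappa> m * d * V"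
      unfolding xk c_def e_def J_def C_def \<kappa>_def U_def .
  qed
  then obtain q p :: "nat \<Rightarrow> int" and V :: "nat \<Rightarrow> real" where
    q: "\<And>m. of_int (q m) * xk ^ c m = C m * \<kappa> m * U m" and
    V: "\<And>m. (\<lambda>\<nu>. kernel_deriv a b xk (n m) (c m + \<nu>)) sums V m" and
    p: "\<And>m. (of_int (q m) * (d * ln xk) + of_int (p m)) * xk ^ c m = C m * \<kappa> m * d * V m"
    by metis

  have rc: "real (c m) = real b / 2 * real (n m) + 1 / 2" for m
  proof -
    have "2 * c m = b * n m + 1" unfolding c_def using hab(3) oddn(1)[of m] by (intro dvd_mult_div_cancel) simp
    then have "real (2 * c m) = real (b * n m + 1)" by (rule arg_cong)
    then show ?thesis by simp
  qed
  have re: "real (e m) = real (b - 2 * a) / 2 * real (n m) + 1 / 2" for m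
  proof -
    have "2 * e m = (b - 2 * a) * n m + 1" unfolding e_def using hab(3) oddn(1)[of m] ab by (intro dvd_mult_div_cancel) auto
    then have "real (2 * e m) = real ((b - 2 * a) * n m + 1)" by (rule arg_cong)
    then show ?thesis by (simp only: of_nat_mult of_nat_add)
  qed
  \<comment> \<open>The three block lengths average to \<open>b - 2a\<close>; this gives the term
    \<open>3(b-2a)/2 ln 2\<close> of \<open>K1\<close> for odd \<open>k\<close>.\<close>
  have rJ: "real (J m) = 3 * real (b - 2 * a) / 2 * real (n m) + 1 / 2" for m
  proof -
    have "2 * J m = b * n m + (b - 2 * a) * n m + (b - 4 * a) * n m + 1"
      unfolding J_def using hab(3) oddn(1)[of m] ab by (intro dvd_mult_div_cancel) auto
    then have "real (2 * J m) = real (b * n m + (b - 2 * a) * n m + (b - 4 * a) * n m + 1)" by (rule arg_cong)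
    then have "2 * real (J m) = (real b + real (b - 2 * a) + real (b - 4 * a)) * real (n m) + 1"
      by (simp only: of_nat_mult of_nat_add) (simp add: algebra_simps)
    also have "real b + real (b - 2 * a) + real (b - 4 * a) = 3 * real (b - 2 * a)" unfolding sub by simp
    finally show ?thesis by simp
  qed
  have lC: "(\<lambda>m. ln (C m) / real (n m)) \<longlonglongrightarrow> N1"
    using hN1 unfolding C_def n_def by simp
  have lc: "(\<lambda>m. real (c m) / real (n m)) \<longlonglongrightarrow> real b / 2"
    unfolding rc unfolding n_def by (rule tendsto_linear_over_odd)
  have le: "(\<lambda>m. real (e m) / real (n m)) \<longlonglongrightarrow> real (b - 2 * a) / 2"
    unfolding re unfolding n_def by (rule tendsto_linear_over_odd)
  have lJ: "(\<lambda>m. real (J m) / real (n m)) \<longlonglongrightarrow> 3 * real (b - 2 * a) / 2"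
    unfolding rJ unfolding n_def by (rule tendsto_linear_over_odd)
  have l\<kappa>: "(\<lambda>m. ln (\<kappa> m) / real (n m)) \<longlonglongrightarrow> K1"
  proof (cases "even k")
    case True
    have "(\<lambda>m. - (real (e m) / real (n m)) * ln (real (k div 2))) \<longlonglongrightarrow> - (real (b - 2 * a) / 2) * ln (real (k div 2))"
      by (intro tendsto_intros le)
    then show ?thesis using True by (simp add: \<kappa>_def ln_power_scale[OF hk] K1_def)
  next
    case False
    have "(\<lambda>m. real (J m) / real (n m) * ln 2 - real (e m) / real (n m) * ln (real k))
        \<longlonglongrightarrow> 3 * real (b - 2 * a) / 2 * ln 2 - real (b - 2 * a) / 2 * ln (real k)"
      by (intro tendsto_intros le lJ)
    then show ?thesis using False by (simp add: \<kappa>_def ln_power_scale[OF hk] K1_def diff_divide_distrib)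
  qed
  have lU: "(\<lambda>m. ln (U m) / real (n m)) \<longlonglongrightarrow> Mc"
  proof -
    have "filterlim n at_top sequentially" unfolding n_def by real_asymp
    from filterlim_compose[OF growth(3) this] show ?thesis by (simp add: U_def)
  qed
  \<comment> \<open>Dividing by \<open>xk ^ c m\<close> is the source of \<open>- b/2 ln xk\<close>
    in both \<open>M1\<close> and \<open>M2\<close>.\<close>
  have lcx: "(\<lambda>m. real (c m) * ln xk / real (n m)) \<longlonglongrightarrow> real b / 2 * ln xk"
    using tendsto_mult[OF lc tendsto_const, of "ln xk"] by simp

  \<comment> \<open>Positivity of the series turns the limit of its logarithm into the exact growth
    rate of the coefficients.\<close>
  have qpos: "real_of_int (q m) > 0" for m
  proof -
    have "real_of_int (q m) * xk ^ c m > 0" unfolding q using Cpos \<kappa>pos Upos by simp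
    then show ?thesis using x by (simp add: zero_less_mult_iff)
  qed
  have lnq: "ln (real_of_int (q m)) = ln (C m) + ln (\<kappa> m) + ln (U m) - real (c m) * ln xk" for m
  proof -
    have "ln (real_of_int (q m) * xk ^ c m) = ln (C m * \<kappa> m * U m)" unfolding q ..
    then show ?thesis using qpos[of m] x Cpos[of m] \<kappa>pos[of m] Upos[of m]
      by (simp add: ln_mult_pos ln_realpow)
  qed
  define \<sigma> \<tau> where "\<sigma> = M1 + K1 + N1" and "\<tau> = - (M2 + K1 + N1)"
  have \<tau>: "\<tau> > 0" using hneg by (simp add: \<tau>_def)
  have limq: "(\<lambda>m. ln \<bar>real_of_int (q m)\<bar> / real m) \<longlonglongrightarrow> 2 * \<sigma>"
  proof (rule tendsto_over_odd_imp)
    have "(\<lambda>m. ln (C m) / real (n m) + ln (\<kappa> m) / real (n m) + ln (U m) / real (n m) - real (c m) * ln xk / real (n m))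
        \<longlonglongrightarrow> N1 + K1 + Mc - real b / 2 * ln xk"
      by (intro tendsto_intros lC l\<kappa> lU lcx)
    moreover have "N1 + K1 + Mc - real b / 2 * ln xk = \<sigma>" by (simp add: \<sigma>_def M1)
    moreover have "ln \<bar>real_of_int (q m)\<bar> / real (2 * m + 1)
        = ln (C m) / real (n m) + ln (\<kappa> m) / real (n m) + ln (U m) / real (n m) - real (c m) * ln xk / real (n m)" for m
      unfolding abs_of_pos[OF qpos] lnq n_def by (simp add: add_divide_distrib diff_divide_distrib)
    ultimately show "(\<lambda>m. ln \<bar>real_of_int (q m)\<bar> / real (2 * m + 1)) \<longlonglongrightarrow> \<sigma>" by simp
  qed
  \<comment> \<open>The logarithm of the upper bound for the linear form; the bracket is the
    subexponential loss of the contour estimate.\<close>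
  define B where "B m = ln (C m) + ln (\<kappa> m) + (ln (d * K) + 11 * ln (real (n m))) + real (n m) * G - real (c m) * ln xk" for m
  have limB: "(\<lambda>m. B m / real m) \<longlonglongrightarrow> 2 * (- \<tau>)"
  proof (rule tendsto_over_odd_imp)
    have "(\<lambda>m. (ln (d * K) + 11 * ln (real (n m))) / real (n m)) \<longlonglongrightarrow> 0" unfolding n_def by real_asymp
    then have "(\<lambda>m. ln (C m) / real (n m) + ln (\<kappa> m) / real (n m) + (ln (d * K) + 11 * ln (real (n m))) / real (n m) + G
        - real (c m) * ln xk / real (n m)) \<longlonglongrightarrow> N1 + K1 + 0 + G - real b / 2 * ln xk"
      by (intro tendsto_intros lC l\<kappa> lcx)
    moreover have "N1 + K1 + 0 + G - real b / 2 * ln xk = - \<tau>" by (simp add: \<tau>_def M2)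
    moreover have "B m / real (2 * m + 1) = ln (C m) / real (n m) + ln (\<kappa> m) / real (n m)
        + (ln (d * K) + 11 * ln (real (n m))) / real (n m) + G - real (c m) * ln xk / real (n m)" for m
    proof -
      have "real (n m) * G / real (n m) = G" using oddn(2)[of m] by simp
      then show ?thesis unfolding B_def n_def[symmetric] by (simp only: add_divide_distrib diff_divide_distrib)
    qed
    ultimately show "(\<lambda>m. B m / real (2 * m + 1)) \<longlonglongrightarrow> - \<tau>" by simp
  qed
  have err: "\<bar>real_of_int (q m) * \<alpha>k + real_of_int (p m)\<bar> \<le> exp (B m)" for m
  proof -
    have "2 * c m = b * n m + 1" unfolding c_def using hab(3) oddn(1)[of m] by (intro dvd_mult_div_cancel) simp
    moreover have "2 * (a * n m) < b * n m" using ab oddn(2)[of m] by simp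
    moreover have "b * n m \<le> 2 * ((b - a) * n m)"
    proof -
      have "b \<le> 2 * (b - a)" using ab by simp
      then have "b * n m \<le> 2 * (b - a) * n m" by (rule mult_right_mono) simp
      then show ?thesis by simp
    qed
    ultimately have "a * n m < c m" "c m \<le> (b - a) * n m + 1" by linarith+
    from K(2)[OF oddn(2) this V] have Vb: "\<bar>V m\<bar> \<le> K * real (n m) ^ 11 * exp (real (n m) * G)" .
    have "\<bar>real_of_int (q m) * \<alpha>k + real_of_int (p m)\<bar> * xk ^ c m = C m * \<kappa> m * d * \<bar>V m\<bar>"
      using arg_cong[OF p[of m], of abs] x Cpos[of m] \<kappa>pos[of m] d1 by (simp add: \<alpha>k abs_mult)
    also have "\<dots> \<le> C m * \<kappa> m * d * (K * real (n m) ^ 11 * exp (real (n m) * G))"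
      using Vb Cpos[of m] \<kappa>pos[of m] d1 by (intro mult_left_mono) auto
    also have "\<dots> = exp (B m) * xk ^ c m"
    proof -
      have "exp (B m) = C m * \<kappa> m * (d * K * exp (11 * ln (real (n m)))) * exp (real (n m) * G) / exp (real (c m) * ln xk)"
        unfolding B_def exp_diff exp_add using Cpos[of m] \<kappa>pos[of m] d1 K(1) by simp
      moreover have "exp (11 * ln (real (n m))) = real (n m) ^ 11"
        using exp_of_nat_mult[of 11 "ln (real (n m))"] oddn(2)[of m] by simp
      moreover have "exp (real (c m) * ln xk) = xk ^ c m" using x by (simp add: exp_of_nat_mult)
      ultimately show ?thesis using x by (simp add: mult_ac)
    qed
    finally show ?thesis using x by simp
  qed
  have "irrationality_measure \<alpha>k \<le> ereal (1 + 2 * \<sigma> / (2 * \<tau>))"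
  proof (rule irrationality_measure_le[OF _ limq])
    show "q m \<noteq> 0" for m using qpos[of m] by auto
    show "2 * \<tau> > 0" using \<tau> by simp
    fix \<epsilon> :: real assume \<epsilon>: "\<epsilon> > 0"
    have "\<forall>\<^sub>F m in sequentially. B m / real m < 2 * (- \<tau>) + \<epsilon>"
      using limB \<epsilon> by (intro order_tendstoD(2)[OF limB]) simp
    then show "\<forall>\<^sub>F m in sequentially. \<bar>real_of_int (q m) * \<alpha>k + real_of_int (p m)\<bar> \<le> exp (- (2 * \<tau> - \<epsilon>) * real m)"
      using eventually_gt_at_top[of 0]
    proof eventually_elim
      case (elim m)
      then have "B m \<le> - (2 * \<tau> - \<epsilon>) * real m" by (simp add: pos_divide_less_eq)
      then show ?case using err[of m] by (meson exp_le_cancel_iff order_trans)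
    qed
  qed
  also have "1 + 2 * \<sigma> / (2 * \<tau>) = 1 - (M1 + K1 + N1) / (M2 + K1 + N1)"
    unfolding mult_divide_mult_cancel_left_if \<sigma>_def \<tau>_def by (simp add: divide_minus_right del: minus_add_distrib)
  finally show ?thesis .
qed

end
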